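(* Let $Z$ be a semi-Markov jump process on the finite state space $\mathcal{Z}$ with duration-dependent transition intensities $\mu_{jk}$, and let $R$ be a right-censoring time independent of $Z$. Fix $j,k\in\mathcal{Z}$ with $j\ne k$, a time $t$ and a duration $u$ with $t>u$. Assume $\mu_{jk}(t,u)>0$ and $\mathbb{E}[N_{jk}(r)^4]<\infty$ for all $r\ge0$. For each $n$ let $(m_1,m_2)=(m_{1,n},m_{2,n})$ be such that $(t,u)\in I_n^{(1)}\times I_n^{(2)}$, where $I_n^{(1)}=[t_{m_1-1},t_{m_1})$ and $I_n^{(2)}=[u_{m_2-1},u_{m_2})$, and put $\Delta_n^{(1)}=t_{m_1}-t_{m_1-1}$, $\Delta_n^{(2)}=u_{m_2}-u_{m_2-1}$. Assume $p_j^{c}$ and $\mu_{jk}$ are $C^2$ in a neighbourhood of $(t,u)$ with $\partial_2p_j^{c}(t,u)>0$. Suppose that, as $n\to\infty$, (i) $\Delta_n^{(1)}\to0$ and $\Delta_n^{(2)}\to0$; (ii) $n\Delta_n^{(1)}\Delta_n^{(2)}\to\infty$; (iii) $n\Delta_n^{(1)}\bigl(\Delta_n^{(2)}\bigr)^3\to0$ and $n\bigl(\Delta_n^{(1)}\bigr)^3\Delta_n^{(2)}\to0$. Then, as $n\to\infty$, $$\sqrt{n\Delta_n^{(1)}\Delta_n^{(2)}}\,\Bigl(\hat\mu_{jk}^{(m_1,m_2)}-\mu_{jk}(t,u)\Bigr)\overset{d}{\longrightarrow}N\Bigl(0,\frac{\mu_{jk}(t,u)}{\partial_2p_j^{c}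(t,u)}\Bigr).$$
   Context: Setting. $Z=(Z_t)_{t\ge0}$ is a jump process on a finite state space $\mathcal{Z}$, defined on a filtered probability space satisfying the usual conditions. $N_{jk}(t)=\#\{s\in(0,t]:Z_{s-}=j,Z_s=k\}$ for $j\ne k$, and $\mathbb{E}[N_{jk}(t)]<\infty$ for all $t\ge0$ and all $j\neq k$. The duration process is $U_t=\inf\{r>0: Z_{t-r}\ne Z_t\}$, the time since the previous jump (before the first jump the duration coincides with calendar time, $U_t=t$). $Z$ is semi-Markov, i.e. $(Z,U)$ is Markov, with (measurable) transition intensities $\mu_{jk}(\cdot,\cdot)$: with respect to the completed natural filtration of $Z$, the compensator of $N_{jk}$ is $\int_0^t1_{(Z_{s-}=j)}\mu_{jk}(s,U_{s-})\,ds$. $R\ge0$ is a random variable (right-censoring time) with $Z$ and $R$ independent. Define $p_j^{c}(t,u):=\mathbb{P}(Z_t=j,\ U_t\le u,\ t\le R)$; $\partial_2p_j^{c}$ denotes its partial derivative with respect to the second (duration) argument. Data and estimator. $(Z^i,R^i)$, $i=1,2,\dots$, are iid copies of $(Z,R)$, with counting processes $N^i_{jk}$ and duration processes $U^i$. For each $n$ deterministic partitions of the time axis into intervals $[t_{m_1-1},t_{m_1})$ and of the duration axis into intervals $[u_{m_2-1},u_{m_2})$ are given (dependence on $n$ suppressed). The occurrence and exposure based on the first $n$ observations are $$O_{jk}(m_1,m_2)=\sum_{i=1}^n\int_0^{R^i}1_{(t_{m_1-1}\le s<t_{m_1})}1_{(u_{m_2-1}\le U^i_{s-}<u_{m_2})}\,dN^i_{jk}(s),$$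 $$E_j(m_1,m_2)=\sum_{i=1}^n\int_0^{R^i}1_{(t_{m_1-1}\le s<t_{m_1})}1_{(u_{m_2-1}\le U^i_{s-}<u_{m_2})}1_{(Z^i_{s-}=j)}\,ds,$$ and the occurrence/exposure rate is $\hat\mu_{jk}^{(m_1,m_2)}=O_{jk}(m_1,m_2)/E_j(m_1,m_2)$ (set to $0$, say, if the exposure is zero). *)

theory Defs
  imports "HOL-Probability.Probability"
begin

section \<open>Paths of jump processes\<close>

text \<open>
  Time is \<open>[0, \<infinity>)\<close>, embedded in \<^typ>\<open>real\<close>; values of paths at negative times are never used.
  A jump path is right-continuous with left limits in the discrete topology of the state space,
  hence piecewise constant with finitely many jumps on bounded intervals.
\<close>

definition jump_path :: "(real \<Rightarrow> 'z) \<Rightarrow> bool" where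
  "jump_path x \<longleftrightarrow>
     (\<forall>t\<ge>0. eventually (\<lambda>s. x s = x t) (at_right t)) \<and>
     (\<forall>t>0. \<exists>z. eventually (\<lambda>s. x s = z) (at_left t))"

definition left_state :: "(real \<Rightarrow> 'z) \<Rightarrow> real \<Rightarrow> 'z" where
  "left_state x t = (THE z. eventually (\<lambda>s. x s = z) (at_left t))"

definition duration :: "(real \<Rightarrow> 'z) \<Rightarrow> real \<Rightarrow> real" where
  "duration x t =
     (if \<exists>r\<in>{0<..t}. x (t - r) \<noteq> x t then Inf {r \<in> {0<..t}. x (t - r) \<noteq> x t} else t)"

definition left_duration :: "(real \<Rightarrow> 'z) \<Rightarrow> real \<Rightarrow> real" where
  "left_duration x t = Lim (at_left t) (duration x)"

definition jump_count :: "(real \<Rightarrow> 'z) \<Rightarrow> 'z \<Rightarrow> 'z \<Rightarrow> real \<Rightarrow> real" where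
  "jump_count x j k t = real (card {s \<in> {0<..t}. left_state x s = j \<and> x s = k})"

section \<open>Filtrations, martingales and compensators on the time set \<open>[0, \<infinity>)\<close>\<close>

definition usual_filtration :: "'w measure \<Rightarrow> (real \<Rightarrow> 'w measure) \<Rightarrow> bool" where
  "usual_filtration M F \<longleftrightarrow>
     (\<forall>t\<ge>0. subalgebra M (F t)) \<and>
     (\<forall>s t. 0 \<le> s \<longrightarrow> s \<le> t \<longrightarrow> sets (F s) \<subseteq> sets (F t)) \<and>
     (\<forall>t\<ge>0. sets (F t) = (\<Inter>s\<in>{t<..}. sets (F s))) \<and>
     complete_measure M \<and> null_sets M \<subseteq> sets (F 0)"

definition adapted_process ::
  "(real \<Rightarrow> 'w measure) \<Rightarrow> 'b measure \<Rightarrow> (real \<Rightarrow> 'w \<Rightarrow> 'b) \<Rightarrow> bool" where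
  "adapted_process F S X \<longleftrightarrow> (\<forall>t\<ge>0. X t \<in> measurable (F t) S)"

text \<open>Adjoining \<^term>\<open>null_sets M\<close> is the usual completion when \<^term>\<open>M\<close> is complete.\<close>

definition completed_natural_filtration ::
  "'w measure \<Rightarrow> 'b measure \<Rightarrow> (real \<Rightarrow> 'w \<Rightarrow> 'b) \<Rightarrow> real \<Rightarrow> 'w measure" where
  "completed_natural_filtration M S X t =
     sigma (space M)
       ({X s -` A \<inter> space M | s A. 0 \<le> s \<and> s \<le> t \<and> A \<in> sets S} \<union> null_sets M)"

definition markov_process :: "'w measure \<Rightarrow> 'b measure \<Rightarrow> (real \<Rightarrow> 'w \<Rightarrow> 'b) \<Rightarrow> bool" where
  "markov_process M S X \<longleftrightarrow>
     (\<forall>t\<ge>0. X t \<in> measurable M S) \<and>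
     (\<forall>s t A. 0 \<le> s \<longrightarrow> s \<le> t \<longrightarrow> A \<in> sets S \<longrightarrow>
        (AE w in M.
           real_cond_exp M (completed_natural_filtration M S X s)
             (indicator (X t -` A \<inter> space M)) w =
           real_cond_exp M (vimage_algebra (space M) (X s) S)
             (indicator (X t -` A \<inter> space M)) w))"

definition martingale_process ::
  "'w measure \<Rightarrow> (real \<Rightarrow> 'w measure) \<Rightarrow> (real \<Rightarrow> 'w \<Rightarrow> real) \<Rightarrow> bool" where
  "martingale_process M F X \<longleftrightarrow>
     adapted_process F borel X \<and>
     (\<forall>t\<ge>0. integrable M (X t)) \<and>
     (\<forall>s t. 0 \<le> s \<longrightarrow> s \<le> t \<longrightarrow> (AE w in M. real_cond_exp M (F s) (X t) w = X s w))"

definition predictable_algebra ::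
  "'w measure \<Rightarrow> (real \<Rightarrow> 'w measure) \<Rightarrow> (real \<times> 'w) measure" where
  "predictable_algebra M F =
     sigma ({0..} \<times> space M)
       ({{0} \<times> A | A. A \<in> sets (F 0)} \<union>
        {{s<..t} \<times> A | s t A. 0 \<le> s \<and> s \<le> t \<and> A \<in> sets (F s)})"

text \<open>
  The compensator \<^term>\<open>A\<close> of an increasing process \<^term>\<open>N\<close> with \<open>E[N t] < \<infinity>\<close> for all \<open>t\<close>; under this
  integrability a local martingale \<open>N - A\<close> is automatically a true martingale.
\<close>

definition is_compensator ::
  "'w measure \<Rightarrow> (real \<Rightarrow> 'w measure) \<Rightarrow> (real \<Rightarrow> 'w \<Rightarrow> real) \<Rightarrow> (real \<Rightarrow> 'w \<Rightarrow> real) \<Rightarrow> bool" where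
  "is_compensator M F N A \<longleftrightarrow>
     (\<lambda>(t, w). A t w) \<in> borel_measurable (predictable_algebra M F) \<and>
     (AE w in M. A 0 w = 0 \<and> mono_on {0..} (\<lambda>t. A t w) \<and>
        (\<forall>t\<ge>0. continuous (at_right t) (\<lambda>s. A s w))) \<and>
     martingale_process M F (\<lambda>t w. N t w - A t w)"

section \<open>Semi-Markov processes with transition intensities\<close>

text \<open>
  The integrability clause makes the Bochner integral the true cumulative intensity:
  for non-integrable integrands it would return 0.
\<close>

definition has_transition_intensities ::
  "'w measure \<Rightarrow> (real \<Rightarrow> 'w \<Rightarrow> 'z) \<Rightarrow> ('z \<Rightarrow> 'z \<Rightarrow> real \<Rightarrow> real \<Rightarrow> real) \<Rightarrow> bool" where
  "has_transition_intensities M Z \<mu> \<longleftrightarrow>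
     (\<forall>j k. j \<noteq> k \<longrightarrow>
        (\<lambda>(s, v). \<mu> j k s v) \<in> borel_measurable (restrict_space borel ({0..} \<times> {0..})) \<and>
        (\<forall>s\<ge>0. \<forall>v\<ge>0. 0 \<le> \<mu> j k s v) \<and>
        (AE w in M. \<forall>t\<ge>0. set_integrable lborel {0..t}
           (\<lambda>s. indicator {s. left_state (\<lambda>r. Z r w) s = j} s *
                 \<mu> j k s (left_duration (\<lambda>r. Z r w) s))) \<and>
        is_compensator M (completed_natural_filtration M (count_space UNIV) Z)
          (\<lambda>t w. jump_count (\<lambda>r. Z r w) j k t)
          (\<lambda>t w. LINT s:{0..t}|lborel.
             indicator {s. left_state (\<lambda>r. Z r w) s = j} s *
             \<mu> j k s (left_duration (\<lambda>r. Z r w) s)))"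

definition semi_markov_process ::
  "'w measure \<Rightarrow> (real \<Rightarrow> 'w \<Rightarrow> 'z) \<Rightarrow> ('z \<Rightarrow> 'z \<Rightarrow> real \<Rightarrow> real \<Rightarrow> real) \<Rightarrow> bool" where
  "semi_markov_process M Z \<mu> \<longleftrightarrow>
     markov_process M (count_space UNIV \<Otimes>\<^sub>M borel)
       (\<lambda>t w. (Z t w, duration (\<lambda>r. Z r w) t)) \<and>
     has_transition_intensities M Z \<mu>"

definition censored_prob ::
  "'w measure \<Rightarrow> (real \<Rightarrow> 'w \<Rightarrow> 'z) \<Rightarrow> ('w \<Rightarrow> real) \<Rightarrow> 'z \<Rightarrow> real \<Rightarrow> real \<Rightarrow> real" where
  "censored_prob M Z R j t u =
     measure M {w \<in> space M. Z t w = j \<and> duration (\<lambda>r. Z r w) t \<le> u \<and> t \<le> R w}"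

section \<open>Independence and random paths\<close>

text \<open>The library's \<open>indep_var\<close> requires both random elements to have the same type.\<close>

definition independent_rvs ::
  "'w measure \<Rightarrow> 'a measure \<Rightarrow> ('w \<Rightarrow> 'a) \<Rightarrow> 'b measure \<Rightarrow> ('w \<Rightarrow> 'b) \<Rightarrow> bool" where
  "independent_rvs M S X T Y \<longleftrightarrow>
     X \<in> measurable M S \<and> Y \<in> measurable M T \<and>
     prob_space.indep_set M
       (sets (vimage_algebra (space M) X S)) (sets (vimage_algebra (space M) Y T))"

abbreviation path_space :: "(real \<Rightarrow> 'z) measure" where
  "path_space \<equiv> PiM {0..} (\<lambda>_. count_space UNIV)"

definition random_path :: "(real \<Rightarrow> 'w \<Rightarrow> 'z) \<Rightarrow> 'w \<Rightarrow> real \<Rightarrow> 'z" where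
  "random_path Z w = restrict (\<lambda>t. Z t w) {0..}"

definition iid_copies ::
  "'v measure \<Rightarrow> (nat \<Rightarrow> real \<Rightarrow> 'v \<Rightarrow> 'z) \<Rightarrow> (nat \<Rightarrow> 'v \<Rightarrow> real) \<Rightarrow>
   'w measure \<Rightarrow> (real \<Rightarrow> 'w \<Rightarrow> 'z) \<Rightarrow> ('w \<Rightarrow> real) \<Rightarrow> bool" where
  "iid_copies P Zs Rs M Z R \<longleftrightarrow>
     (\<forall>i\<ge>1. \<forall>w\<in>space P. jump_path (\<lambda>t. Zs i t w)) \<and>
     prob_space.indep_vars P (\<lambda>_. path_space \<Otimes>\<^sub>M borel)
       (\<lambda>i w. (random_path (Zs i) w, Rs i w)) {1..} \<and>
     (\<forall>i\<ge>1. distr P (path_space \<Otimes>\<^sub>M borel) (\<lambda>w. (random_path (Zs i) w, Rs i w)) =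
            distr M (path_space \<Otimes>\<^sub>M borel) (\<lambda>w. (random_path Z w, R w)))"

section \<open>Occurrence/exposure rates\<close>

definition axis_partition :: "(nat \<Rightarrow> real) \<Rightarrow> bool" where
  "axis_partition \<tau> \<longleftrightarrow> \<tau> 0 = 0 \<and> strict_mono \<tau> \<and> filterlim \<tau> at_top sequentially"

text \<open>
  In \<open>occurrence\<close> and \<open>exposure\<close>, \<open>\<tau>\<close> and \<open>\<upsilon>\<close> are the grids on the time and duration axes, and \<open>n\<close> is
  the sample size. The integral with respect to the counting process is the pathwise
  Lebesgue--Stieltjes integral over \<open>(0, R]\<close>.
\<close>

definition occurrence ::
  "(nat \<Rightarrow> real \<Rightarrow> 'v \<Rightarrow> 'z) \<Rightarrow> (nat \<Rightarrow> 'v \<Rightarrow> real) \<Rightarrow> 'z \<Rightarrow> 'z \<Rightarrow> nat \<Rightarrow>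
   (nat \<Rightarrow> real) \<Rightarrow> (nat \<Rightarrow> real) \<Rightarrow> nat \<Rightarrow> nat \<Rightarrow> 'v \<Rightarrow> real" where
  "occurrence Zs Rs j k n \<tau> \<upsilon> m1 m2 w =
     (\<Sum>i=1..n. LINT s:{0<..Rs i w}|interval_measure (jump_count (\<lambda>r. Zs i r w) j k).
        indicator {\<tau> (m1 - 1)..<\<tau> m1} s *
        indicator {\<upsilon> (m2 - 1)..<\<upsilon> m2} (left_duration (\<lambda>r. Zs i r w) s))"

definition exposure ::
  "(nat \<Rightarrow> real \<Rightarrow> 'v \<Rightarrow> 'z) \<Rightarrow> (nat \<Rightarrow> 'v \<Rightarrow> real) \<Rightarrow> 'z \<Rightarrow> nat \<Rightarrow>
   (nat \<Rightarrow> real) \<Rightarrow> (nat \<Rightarrow> real) \<Rightarrow> nat \<Rightarrow> nat \<Rightarrow> 'v \<Rightarrow> real" where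
  "exposure Zs Rs j n \<tau> \<upsilon> m1 m2 w =
     (\<Sum>i=1..n. LINT s:{0..Rs i w}|lborel.
        indicator {\<tau> (m1 - 1)..<\<tau> m1} s *
        indicator {\<upsilon> (m2 - 1)..<\<upsilon> m2} (left_duration (\<lambda>r. Zs i r w) s) *
        indicator {s. left_state (\<lambda>r. Zs i r w) s = j} s)"

text \<open>The rate is 0 when the exposure is 0, since \<open>x / 0 = 0\<close>.\<close>

definition oe_rate ::
  "(nat \<Rightarrow> real \<Rightarrow> 'v \<Rightarrow> 'z) \<Rightarrow> (nat \<Rightarrow> 'v \<Rightarrow> real) \<Rightarrow> 'z \<Rightarrow> 'z \<Rightarrow> nat \<Rightarrow>
   (nat \<Rightarrow> real) \<Rightarrow> (nat \<Rightarrow> real) \<Rightarrow> nat \<Rightarrow> nat \<Rightarrow> 'v \<Rightarrow> real" where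
  "oe_rate Zs Rs j k n \<tau> \<upsilon> m1 m2 w =
     occurrence Zs Rs j k n \<tau> \<upsilon> m1 m2 w / exposure Zs Rs j n \<tau> \<upsilon> m1 m2 w"

section \<open>Twice continuous differentiability\<close>

definition C2_near :: "('a::real_normed_vector \<Rightarrow> real) \<Rightarrow> 'a \<Rightarrow> bool" where
  "C2_near f x \<longleftrightarrow>
     (\<exists>S (f' :: 'a \<Rightarrow> 'a \<Rightarrow>\<^sub>L real) (f'' :: 'a \<Rightarrow> 'a \<Rightarrow>\<^sub>L ('a \<Rightarrow>\<^sub>L real)).
        open S \<and> x \<in> S \<and>
        (\<forall>y\<in>S. (f has_derivative blinfun_apply (f' y)) (at y)) \<and>
        (\<forall>y\<in>S. (f' has_derivative blinfun_apply (f'' y)) (at y)) \<and>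
        continuous_on S f'')"

end

theory Submission
  imports Defs
begin

text \<open>
  Let \<open>s\<^sub>n\<close> be the square root of \<open>n\<close> times the area of the \<open>n\<close>-th cell, let \<open>O\<^sub>i\<close> and \<open>E\<^sub>i\<close> be the
  occurrence and the exposure of the \<open>i\<close>-th observation in that cell, and let \<open>c\<close> be the intensity at
  the point of interest. Where the total exposure is positive, the scaled error of the rate is at most
  \<open>x\<close> if and only if \<open>\<Sum>\<^sub>i (O\<^sub>i - (c + x / s\<^sub>n) E\<^sub>i) \<le> 0\<close>. The distribution function of the error
  is thus a distribution function at zero of a sum of independent and identically distributed terms,
  and a central limit theorem for bounded arrays (\<open>triangular_array_clt\<close>) yields its limit without
  any separate convergence statement for the denominator. On the event of zero total
  exposure the sum does not depend on \<open>x\<close>. It can be positive there only with a probability below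
  bounds that vanish as \<open>x\<close> grows, so this event does not contribute to the limit (\<open>ratio_clt\<close>).

  The central limit theorem needs the first two moments of one term, and these rest on three facts about
  one censored path and a small cell \<open>[a1, b1) \<times> [a2, b2)\<close>.

  \<^item> A transition resets the duration to zero. When the cell is short in time and its durations are
    bounded away from zero, a path has at most one counted transition. Hence \<open>O\<close> takes values in
    \<open>{0, 1}\<close>, while \<open>0 \<le> E \<le> b1 - a1\<close>: the second moment of a term is the mean of \<open>O\<close> up to
    terms of smaller order, and the terms are uniformly bounded.
  \<^item> The mean of \<open>E\<close> is the integral over \<open>[a1, b1)\<close> of the increment of the censored occupation
    probability between the durations \<open>a2\<close> and \<open>b2\<close>. By the mean value theorem it is asymptotically
    the duration derivative times the area of the cell (\<open>expected_exposure_bounds\<close>).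
  \<^item> The at-risk indicator is a predictable integrand, so the mean of \<open>O\<close> is the mean of the integral
    of the intensity over the time at risk. It differs from \<open>c\<close> times the mean of \<open>E\<close> at most by the
    oscillation of the intensity over the cell (\<open>expected_occurrence\<close>). This oscillation is of the
    order of the side lengths, and the upper bounds on the side lengths remove the resulting bias.

  All of this is obtained by replacing the at-risk indicator by step functions on the grids of mesh
  \<open>1 / (m + 1)\<close> whose value on a grid interval is determined by the path up to its left end point and by
  the censoring time. These step functions converge at every time point of every jump path
  (\<open>grid_step_tendsto\<close>). Sums over the grid turn the compensator property into an elementary statement
  about martingale increments, the independence of censoring enters one grid interval at a time, and the
  functionals of the path become limits of finitely many evaluations, hence measurable.
\<close>

section \<open>Jump paths, durations and their behaviour near a time point\<close>

lemma left_state_eqI: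
  assumes "r0 < s" "\<And>r. r0 \<le> r \<Longrightarrow> r < s \<Longrightarrow> x r = z"
  shows "left_state x s = z"
proof -
  have ev: "eventually (\<lambda>r. x r = z) (at_left s)"
    unfolding eventually_at_left_field
    by (intro exI[of _ r0]) (use assms in auto)
  show ?thesis unfolding left_state_def
  proof (rule the_equality)
    show "eventually (\<lambda>r. x r = z) (at_left s)" by (rule ev)
  next
    fix z' assume "eventually (\<lambda>r. x r = z') (at_left s)"
    with ev have "eventually (\<lambda>r. z' = z) (at_left s)" by eventually_elim simp
    then show "z' = z" by simp
  qed
qed

lemma jump_path_const_left:
  assumes "jump_path x" "0 < s"
  obtains r0 where "0 \<le> r0" "r0 < s" "\<And>r. r0 \<le> r \<Longrightarrow> r < s \<Longrightarrow> x r = left_state x s"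
proof -
  obtain z where "eventually (\<lambda>r. x r = z) (at_left s)"
    using assms by (auto simp: jump_path_def)
  then obtain b where b: "b < s" "\<And>r. b < r \<Longrightarrow> r < s \<Longrightarrow> x r = z"
    using eventually_at_left[of "s - 1" s] by auto
  define r0 where "r0 = max 0 ((b + s) / 2)"
  have r0: "0 \<le> r0" "r0 < s" "b < r0" using b(1) assms(2) by (auto simp: r0_def max_def field_simps)
  have c: "x r = z" if "r0 \<le> r" "r < s" for r using b(2)[of r] that r0 by simp
  have "left_state x s = z" by (rule left_state_eqI[OF r0(2) c])
  with r0 c show thesis by (intro that[of r0]) auto
qed

lemma jump_path_const_right:
  assumes "jump_path x" "0 \<le> s"
  obtains e where "s < e" "\<And>r. s \<le> r \<Longrightarrow> r < e \<Longrightarrow> x r = x s"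
proof -
  have "eventually (\<lambda>r. x r = x s) (at_right s)"
    using assms by (auto simp: jump_path_def)
  then obtain b where b: "b > s" "\<And>r. s < r \<Longrightarrow> r < b \<Longrightarrow> x r = x s"
    unfolding eventually_at_right_field by blast
  have "x r = x s" if "s \<le> r" "r < b" for r
    using b(2)[of r] that by (cases "r = s") auto
  with b(1) show thesis by (intro that[of b])
qed

text \<open>The strict comparison turns the infimum into the existence of one earlier time with a different
  state. All properties of durations below are derived from this form.\<close>

lemma duration_less_iff:
  assumes "0 \<le> s"
  shows "duration x s < a \<longleftrightarrow> s < a \<or> (\<exists>q\<in>{0..<s}. s - a < q \<and> x q \<noteq> x s)"
proof (cases "\<exists>r\<in>{0<..s}. x (s - r) \<noteq> x s")
  case True
  let ?S = "{r \<in> {0<..s}. x (s - r) \<noteq> x s}"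
  have "bdd_below ?S" by (rule bdd_belowI[of _ 0]) auto
  moreover have "?S \<noteq> {}" using True by auto
  ultimately have "Inf ?S < a \<longleftrightarrow> (\<exists>r\<in>?S. r < a)" by (intro cInf_less_iff)
  also have "\<dots> \<longleftrightarrow> s < a \<or> (\<exists>q\<in>{0..<s}. s - a < q \<and> x q \<noteq> x s)" (is "?l \<longleftrightarrow> ?r")
  proof
    assume ?l
    then obtain r where "0 < r" "r \<le> s" "x (s - r) \<noteq> x s" "r < a" by auto
    then show ?r by (intro disjI2 bexI[of _ "s - r"]) auto
  next
    assume ?r
    then show ?l
    proof
      assume "s < a" then show ?l using True by force
    next
      assume "\<exists>q\<in>{0..<s}. s - a < q \<and> x q \<noteq> x s"
      then obtain q where "0 \<le> q" "q < s" "s - a < q" "x q \<noteq> x s" by auto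
      then show ?l by (intro bexI[of _ "s - q"]) auto
    qed
  qed
  finally show ?thesis using True by (simp add: duration_def)
next
  case False
  have "x q = x s" if "q \<in> {0..<s}" for q
    using False that by (auto dest!: bspec[of _ _ "s - q"])
  then have "\<not> (\<exists>q\<in>{0..<s}. s - a < q \<and> x q \<noteq> x s)" by blast
  with False show ?thesis by (auto simp: duration_def)
qed

text \<open>The infimum in the definition of the duration runs over uncountably many times. Right-continuity
  reduces it to rational ones, and this version depends measurably on the path.\<close>

definition rat_duration :: "real \<Rightarrow> (real \<Rightarrow> 'z) \<Rightarrow> real" where
  "rat_duration s x =
     s - (SUP q\<in>insert 0 (\<rat> \<inter> {0..<s}). if x q \<noteq> x s then q else 0)"

lemma rat_duration_bdd: "0 \<le> s \<Longrightarrow>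
   bdd_above ((\<lambda>q. if x q \<noteq> x s then q else 0) ` insert 0 (\<rat> \<inter> {0..<s::real}))"
  by (rule bdd_aboveI[of _ s]) auto

lemma duration_eq_rat_duration:
  assumes "jump_path x" "0 \<le> s"
  shows "duration x s = rat_duration s x"
proof -
  have "duration x s < a \<longleftrightarrow> rat_duration s x < a" for a
  proof -
    have "rat_duration s x < a \<longleftrightarrow>
        s - a < (SUP q\<in>insert 0 (\<rat> \<inter> {0..<s}). if x q \<noteq> x s then q else 0)"
      by (auto simp: rat_duration_def)
    also have "\<dots> \<longleftrightarrow> (\<exists>q\<in>insert 0 (\<rat> \<inter> {0..<s}). s - a < (if x q \<noteq> x s then q else 0))"
      by (intro less_cSUP_iff rat_duration_bdd assms) auto
    also have "\<dots> \<longleftrightarrow> s < a \<or> (\<exists>q\<in>{0..<s}. s - a < q \<and> x q \<noteq> x s)" (is "?l \<longleftrightarrow> ?r")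
    proof
      assume ?l
      then obtain q where "q = 0 \<or> q \<in> \<rat> \<inter> {0..<s}" "s - a < (if x q \<noteq> x s then q else 0)" by blast
      then show ?r using assms(2) by (cases "x q \<noteq> x s") force+
    next
      assume ?r
      then show ?l
      proof
        assume "s < a" then show ?l by (intro bexI[of _ 0]) auto
      next
        assume "\<exists>q\<in>{0..<s}. s - a < q \<and> x q \<noteq> x s"
        then obtain q where q: "0 \<le> q" "q < s" "s - a < q" "x q \<noteq> x s" by auto
        obtain e where e: "q < e" "\<And>r. q \<le> r \<Longrightarrow> r < e \<Longrightarrow> x r = x q"
          using jump_path_const_right[OF assms(1) q(1)] by blast
        obtain q' where q': "q' \<in> \<rat>" "q < q'" "q' < min e s"
        proof -
          have "q < min e s" using q(2) e(1) by simp
          from Rats_dense_in_real[OF this] show thesis by (blast intro: that)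
        qed
        have "x q' = x q" using e(2)[of q'] q' by simp
        with q q' show ?l by (intro bexI[of _ q']) auto
      qed
    qed
    finally show ?thesis using duration_less_iff[OF assms(2)] by simp
  qed
  then show ?thesis by (metis less_irrefl neq_iff)
qed

text \<open>Between jumps the duration runs with slope one. This also holds before the first jump, where the
  duration is the calendar time.\<close>

lemma duration_shift:
  assumes "0 \<le> r0" "r0 \<le> r" "\<And>q. r0 \<le> q \<Longrightarrow> q \<le> r \<Longrightarrow> x q = x r0"
  shows "duration x r = duration x r0 + (r - r0)"
proof -
  have "duration x r < a \<longleftrightarrow> duration x r0 + (r - r0) < a" for a
  proof -
    have "duration x r0 + (r - r0) < a \<longleftrightarrow> duration x r0 < a - (r - r0)" by auto
    also have "\<dots> \<longleftrightarrow> r < a \<or> (\<exists>q\<in>{0..<r0}. r - a < q \<and> x q \<noteq> x r0)"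
    proof -
      have "r0 < a - (r - r0) \<longleftrightarrow> r < a" "r0 - (a - (r - r0)) = r - a" by auto
      then show ?thesis using duration_less_iff[OF assms(1), of x "a - (r - r0)"] by simp
    qed
    also have "\<dots> \<longleftrightarrow> r < a \<or> (\<exists>q\<in>{0..<r}. r - a < q \<and> x q \<noteq> x r)"
    proof -
      have "x r = x r0" using assms(2) by (intro assms(3)) auto
      moreover have "q < r0" if "q < r" "x q \<noteq> x r0" for q
        using assms(3)[of q] that by force
      ultimately have "q \<in> {0..<r0} \<and> x q \<noteq> x r0 \<longleftrightarrow> q \<in> {0..<r} \<and> x q \<noteq> x r" for q
        using assms(2) by auto
      then show ?thesis by blast
    qed
    also have "\<dots> \<longleftrightarrow> duration x r < a"
      using assms(1,2) by (subst duration_less_iff[of r]) auto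
    finally show ?thesis by simp
  qed
  then show ?thesis by (metis less_irrefl neq_iff)
qed

lemma left_duration_eq:
  assumes "0 \<le> r0" "r0 < s" "\<And>r. r0 \<le> r \<Longrightarrow> r < s \<Longrightarrow> x r = x r0"
  shows "left_duration x s = duration x r0 + (s - r0)"
proof -
  have ev: "eventually (\<lambda>r. duration x r0 + (r - r0) = duration x r) (at_left s)"
  proof -
    have "duration x r0 + (r - r0) = duration x r" if "r0 < r" "r < s" for r
      by (rule duration_shift[symmetric]) (use assms(1) that in \<open>auto intro!: assms(3)\<close>)
    then show ?thesis using eventually_at_left[OF assms(2)] assms(2) by blast
  qed
  have "((\<lambda>r. duration x r0 + (r - r0)) \<longlongrightarrow> duration x r0 + (s - r0)) (at_left s)"
    by (intro tendsto_intros)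
  then have "(duration x \<longlongrightarrow> duration x r0 + (s - r0)) (at_left s)"
    by (rule Lim_transform_eventually[OF _ ev])
  then show ?thesis unfolding left_duration_def by (intro tendsto_Lim) auto
qed

text \<open>Without jumps the path is locally constant on the connected set \<open>[p, q]\<close>.\<close>

lemma jump_path_const_no_jump:
  assumes "jump_path x" "0 \<le> p" "p \<le> q" "\<And>s. p < s \<Longrightarrow> s \<le> q \<Longrightarrow> left_state x s = x s"
  shows "x p = x q"
proof (rule connected_local_const[where A = "{p..q}"])
  show "\<forall>a\<in>{p..q}. eventually (\<lambda>b. x a = x b) (at a within {p..q})"
  proof
    fix a assume a: "a \<in> {p..q}"
    have "0 \<le> a" using a assms(2) by auto
    from jump_path_const_right[OF assms(1) this] obtain e
      where e: "a < e" "\<And>r. a \<le> r \<Longrightarrow> r < e \<Longrightarrow> x r = x a" by blast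
    obtain d where d: "d < a" "\<And>r. d \<le> r \<Longrightarrow> r < a \<Longrightarrow> p \<le> r \<Longrightarrow> x r = x a"
    proof (cases "a = p")
      case True then show thesis by (intro that[of "p - 1"]) auto
    next
      case False
      then have "0 < a" using a assms(2) by auto
      from jump_path_const_left[OF assms(1) this] obtain r0 where
        "r0 < a" "\<And>r. r0 \<le> r \<Longrightarrow> r < a \<Longrightarrow> x r = left_state x a" by blast
      with False a assms(4)[of a] show thesis by (intro that[of r0]) auto
    qed
    have "x a = x b" if "b \<in> {p..q}" "d < b" "b < e" for b
      using d(2)[of b] e(2)[of b] that by (cases "b < a") auto
    then have "\<forall>b\<in>{d<..<e}. b \<noteq> a \<longrightarrow> b \<in> {p..q} \<longrightarrow> x a = x b" by simp
    moreover have "a \<in> {d<..<e}" using d(1) e(1) by simp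
    ultimately show "eventually (\<lambda>b. x a = x b) (at a within {p..q})"
      unfolding eventually_at_topological using open_greaterThanLessThan by blast
  qed
qed (use assms(3) in auto)

definition jump_times :: "(real \<Rightarrow> 'z) \<Rightarrow> real \<Rightarrow> real set" where
  "jump_times x T = {s \<in> {0<..T}. left_state x s \<noteq> x s}"

text \<open>An accumulation point of jump times would contradict the constancy of the path on a left and on a
  right neighbourhood of that point.\<close>

lemma finite_jump_times:
  assumes "jump_path x"
  shows "finite (jump_times x T)"
proof (rule ccontr)
  assume inf: "infinite (jump_times x T)"
  have "\<exists>l\<in>{0..T}. l islimpt jump_times x T"
    using inf compact_eq_Bolzano_Weierstrass[of "{0..T}"] by (force simp: jump_times_def)
  then obtain l where l: "0 \<le> l" "l islimpt jump_times x T" by auto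
  obtain e where e: "l < e" "\<And>r. l \<le> r \<Longrightarrow> r < e \<Longrightarrow> x r = x l"
    using jump_path_const_right[OF assms l(1)] by blast
  obtain d where d: "d < l" "\<And>r. d \<le> r \<Longrightarrow> r < l \<Longrightarrow> 0 < r \<Longrightarrow> x r = left_state x l"
  proof (cases "l = 0")
    case True then show thesis by (intro that[of "-1"]) auto
  next
    case False
    then have "0 < l" using l by auto
    from jump_path_const_left[OF assms this] obtain r0 where
        "0 \<le> r0" "r0 < l" "\<And>r. r0 \<le> r \<Longrightarrow> r < l \<Longrightarrow> x r = left_state x l" by blast
    then show thesis by (intro that[of r0]) auto
  qed
  obtain s where s: "s \<in> jump_times x T" "s \<in> {d<..<e}" "s \<noteq> l"
    using l(2) d e unfolding islimpt_def
    by (metis greaterThanLessThan_iff open_greaterThanLessThan)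
  have s0: "0 < s" using s by (auto simp: jump_times_def)
  have "left_state x s = x s"
  proof (cases "s < l")
    case True
    have "left_state x s = left_state x l"
      using s s0 True by (intro left_state_eqI[of "max d (s/2)"] d(2)) auto
    then show ?thesis using d(2)[of s] True s s0 by auto
  next
    case False
    have "left_state x s = x l"
      using s False by (intro left_state_eqI[of l] e(2)) auto
    then show ?thesis using e(2)[of s] False s by auto
  qed
  then show False using s by (auto simp: jump_times_def)
qed

definition transition_times :: "(real \<Rightarrow> 'z) \<Rightarrow> 'z \<Rightarrow> 'z \<Rightarrow> real \<Rightarrow> real set" where
  "transition_times x j k T = {s \<in> {0<..T}. left_state x s = j \<and> x s = k}"

lemma jump_count_eq_card: "jump_count x j k T = real (card (transition_times x j k T))"
  by (simp add: jump_count_def transition_times_def)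

lemma transition_times_subset: "j \<noteq> k \<Longrightarrow> transition_times x j k T \<subseteq> jump_times x T"
  by (auto simp: transition_times_def jump_times_def)

lemma finite_transition_times:
  "jump_path x \<Longrightarrow> j \<noteq> k \<Longrightarrow> finite (transition_times x j k T)"
  using finite_jump_times transition_times_subset by (metis finite_subset)

lemma jump_count_diff:
  assumes "jump_path x" "j \<noteq> k" "0 \<le> p" "p \<le> q" "q \<le> T"
  shows "jump_count x j k q - jump_count x j k p = real (card (transition_times x j k T \<inter> {p<..q}))"
proof -
  have "transition_times x j k q = transition_times x j k p \<union> (transition_times x j k T \<inter> {p<..q})"
    using assms by (auto simp: transition_times_def)
  moreover have "transition_times x j k p \<inter> (transition_times x j k T \<inter> {p<..q}) = {}"
    by (auto simp: transition_times_def)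
  ultimately have "card (transition_times x j k q) =
      card (transition_times x j k p) + card (transition_times x j k T \<inter> {p<..q})"
    using finite_transition_times[OF assms(1,2)] by (simp add: card_Un_disjoint)
  then show ?thesis by (simp add: jump_count_eq_card)
qed

text \<open>If at most one jump happens in a cell, the states at its two end points reveal it.\<close>

lemma card_transition_times_cell:
  assumes x: "jump_path x" and "j \<noteq> k" "0 \<le> p" "p < q" "q \<le> T"
    and one: "\<And>s s'. s \<in> jump_times x T \<inter> {p<..q} \<Longrightarrow> s' \<in> jump_times x T \<inter> {p<..q} \<Longrightarrow> s = s'"
  shows "real (card (transition_times x j k T \<inter> {p<..q})) = of_bool (x p = j \<and> x q = k)"
proof (cases "jump_times x T \<inter> {p<..q} = {}")
  case True
  then have "transition_times x j k T \<inter> {p<..q} = {}"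
    using transition_times_subset[OF assms(2)] by blast
  moreover have "x p = x q"
  proof (rule jump_path_const_no_jump[OF x])
    fix s assume "p < s" "s \<le> q"
    then have "s \<notin> jump_times x T" using True by auto
    then show "left_state x s = x s"
      using \<open>p < s\<close> \<open>s \<le> q\<close> assms(3,5) by (simp add: jump_times_def)
  qed (use assms(3,4) in auto)
  ultimately show ?thesis using assms(2) by auto
next
  case False
  then obtain s where s: "s \<in> jump_times x T" "p < s" "s \<le> q" by auto
  have no: "left_state x r = x r" if "p < r" "r \<le> q" "r \<noteq> s" for r
    using one[of r s] s that assms(3,5) by (auto simp: jump_times_def)
  have "left_state x s = x p"
  proof (rule left_state_eqI[OF s(2)])
    fix r assume "p \<le> r" "r < s"
    then have "x p = x r" using s assms(3,5)
      by (intro jump_path_const_no_jump[OF x]) (auto intro!: no)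
    then show "x r = x p" by simp
  qed
  moreover have "x s = x q" using s assms(3,5)
    by (intro jump_path_const_no_jump[OF x]) (auto intro!: no)
  moreover have "transition_times x j k T \<inter> {p<..q} = (if left_state x s = j \<and> x s = k then {s} else {})"
  proof -
    have sub: "transition_times x j k T \<inter> {p<..q} \<subseteq> {s}"
    proof
      fix r assume "r \<in> transition_times x j k T \<inter> {p<..q}"
      then have "r \<in> jump_times x T \<inter> {p<..q}"
        using transition_times_subset[OF assms(2), of x T] by blast
      then show "r \<in> {s}" using one[of r s] s by simp
    qed
    have mem: "s \<in> transition_times x j k T \<longleftrightarrow> left_state x s = j \<and> x s = k"
      using s by (auto simp: transition_times_def jump_times_def)
    show ?thesis
    proof (cases "s \<in> transition_times x j k T")
      case True
      then have "transition_times x j k T \<inter> {p<..q} = {s}" using s sub by auto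
      then show ?thesis using True mem by simp
    next
      case False
      then have "transition_times x j k T \<inter> {p<..q} = {}" using sub by blast
      then show ?thesis using False mem by simp
    qed
  qed
  ultimately show ?thesis by simp
qed

section \<open>The Stieltjes measure of a jump count\<close>

lemma jump_count_mono:
  assumes "jump_path x" "j \<noteq> k" "p \<le> q"
  shows "jump_count x j k p \<le> jump_count x j k q"
  unfolding jump_count_eq_card of_nat_le_iff
  by (rule card_mono[OF finite_transition_times]) (use assms in \<open>auto simp: transition_times_def\<close>)

lemma jump_count_right_cont:
  assumes x: "jump_path x" and jk: "j \<noteq> k"
  shows "continuous (at_right a) (jump_count x j k)"
proof -
  have "\<exists>e>a. \<forall>b. a < b \<longrightarrow> b < e \<longrightarrow> jump_count x j k b = jump_count x j k a"
  proof (cases "a < 0")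
    case True
    have "jump_count x j k b = jump_count x j k a" if "a < b" "b < 0" for b
      using that True by (simp add: jump_count_def)
    then show ?thesis using True by blast
  next
    case False
    then have "0 \<le> a" by simp
    from jump_path_const_right[OF x this] obtain e
      where e: "a < e" "\<And>r. a \<le> r \<Longrightarrow> r < e \<Longrightarrow> x r = x a" by blast
    have "jump_count x j k b = jump_count x j k a" if "a < b" "b < e" for b
    proof -
      have "left_state x s = x s" if "a < s" "s \<le> b" for s
      proof -
        have "left_state x s = x a"
          using that \<open>b < e\<close> by (intro left_state_eqI[of a] e(2)) auto
        then show ?thesis using e(2)[of s] that \<open>b < e\<close> by simp
      qed
      then have "s \<le> a" if "s \<in> transition_times x j k b" for s
        using that jk by (force simp: transition_times_def)
      then have "transition_times x j k b = transition_times x j k a"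
        using \<open>a < b\<close> by (force simp: transition_times_def)
      then show ?thesis by (simp add: jump_count_eq_card)
    qed
    then show ?thesis using e by blast
  qed
  then have "eventually (\<lambda>b. jump_count x j k b = jump_count x j k a) (at_right a)"
    unfolding eventually_at_right_field by blast
  then show ?thesis unfolding continuous_within by (rule tendsto_eventually)
qed

lemma emeasure_jump_count_Ioc:
  assumes "jump_path x" "j \<noteq> k" "p \<le> q"
  shows "emeasure (interval_measure (jump_count x j k)) {p<..q} =
    ennreal (jump_count x j k q - jump_count x j k p)"
  using assms by (intro emeasure_interval_measure_Ioc jump_count_mono jump_count_right_cont)

text \<open>The intervals that shrink to \<open>s\<close> start after the previous jump, so each of them has mass one.\<close>

lemma emeasure_jump_count_singleton:
  assumes x: "jump_path x" and jk: "j \<noteq> k" and s: "s \<in> transition_times x j k T"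
  shows "emeasure (interval_measure (jump_count x j k)) {s} = 1"
proof -
  let ?N = "interval_measure (jump_count x j k)"
  have s0: "0 < s" using s by (auto simp: transition_times_def)
  from jump_path_const_left[OF x s0] obtain r0 where
    r0: "0 \<le> r0" "r0 < s" "\<And>r. r0 \<le> r \<Longrightarrow> r < s \<Longrightarrow> x r = left_state x s" by blast
  have one: "emeasure ?N {s - (s - r0) / Suc n<..s} = 1" for n
  proof -
    let ?p = "s - (s - r0) / Suc n"
    have p: "r0 \<le> ?p" "?p < s"
    proof -
      have "(s - r0) / Suc n \<le> (s - r0) / 1" using r0(2) by (intro divide_left_mono) auto
      moreover have "0 < (s - r0) / Suc n" using r0(2) by simp
      ultimately show "r0 \<le> ?p" "?p < s" by simp_all
    qed
    have "transition_times x j k s \<inter> {?p<..s} = {s}"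
    proof -
      have "r = s" if "r \<in> transition_times x j k s" "?p < r" for r
      proof (rule ccontr)
        assume "r \<noteq> s"
        then have r: "r0 < r" "r < s" using that p by (auto simp: transition_times_def)
        have "left_state x r = left_state x s"
          using r by (intro left_state_eqI[of r0] r0(3)) auto
        then have "left_state x r = x r" using r0(3)[of r] r by simp
        with that jk show False by (auto simp: transition_times_def)
      qed
      moreover have "s \<in> transition_times x j k s" using s by (auto simp: transition_times_def)
      ultimately show ?thesis using p by auto
    qed
    then show ?thesis
      using jump_count_diff[OF x jk, of ?p s s] p r0(1,2)
      by (simp add: emeasure_jump_count_Ioc[OF x jk])
  qed
  have lim: "(\<lambda>n. emeasure ?N {s - (s - r0) / Suc n<..s}) \<longlonglongrightarrow>
      emeasure ?N (\<Inter>n. {s - (s - r0) / Suc n<..s})"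
  proof (rule Lim_emeasure_decseq)
    show "decseq (\<lambda>n. {s - (s - r0) / real (Suc n)<..s})"
      unfolding decseq_def using r0(2)
      by (auto elim!: le_less_trans[rotated] intro!: divide_left_mono)
    show "emeasure ?N {s - (s - r0) / real (Suc n)<..s} \<noteq> \<infinity>" for n by (simp only: one) simp
  qed auto
  moreover have "(\<Inter>n. {s - (s - r0) / Suc n<..s}) = {s}"
  proof -
    have "r = s" if r: "\<And>n. s - (s - r0) / Suc n < r" "r \<le> s" for r
    proof -
      have "(\<lambda>n. s - (s - r0) / Suc n) \<longlonglongrightarrow> s"
        using tendsto_diff[OF tendsto_const LIMSEQ_Suc[OF tendsto_divide_0[OF tendsto_const filterlim_at_top_imp_at_infinity[OF filterlim_real_sequentially]]]]
        by simp
      then have "s \<le> r" by (rule LIMSEQ_le_const2) (use r in \<open>auto intro: less_imp_le\<close>)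
      then show ?thesis using r by simp
    qed
    then show ?thesis using r0(2) by auto
  qed
  ultimately have "(\<lambda>n::nat. 1::ennreal) \<longlonglongrightarrow> emeasure ?N {s}" by (simp only: one)
  then show ?thesis by (simp add: LIMSEQ_const_iff)
qed

text \<open>The atoms at the transition times exhaust the mass of \<open>(0, T]\<close>, so the integral is a sum
  over these times.\<close>

lemma integral_jump_count:
  fixes f :: "real \<Rightarrow> real"
  assumes x: "jump_path x" and jk: "j \<noteq> k" and f[measurable]: "f \<in> borel_measurable borel" and T: "0 \<le> T"
    and supp: "\<And>s. s \<notin> {0<..T} \<Longrightarrow> f s = 0"
  shows "(LINT s|interval_measure (jump_count x j k). f s) = (\<Sum>s\<in>transition_times x j k T. f s)"
proof -
  let ?N = "interval_measure (jump_count x j k)" and ?J = "transition_times x j k T"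
  note fin = finite_transition_times[OF x jk, of T]
  have J: "?J \<subseteq> {0<..T}" by (auto simp: transition_times_def)
  have Jm: "?J \<in> sets ?N" using fin by (auto intro: finite_imp_closed borel_closed)
  have sing: "emeasure ?N {s} = 1" if "s \<in> ?J" for s
    using emeasure_jump_count_singleton[OF x jk that] .
  have "emeasure ?N ?J = (\<Sum>s\<in>?J. emeasure ?N {s})"
    by (intro emeasure_eq_sum_singleton fin) auto
  also have "\<dots> = of_nat (card ?J)" by (simp add: sing)
  finally have eJ: "emeasure ?N ?J = of_nat (card ?J)" .
  have "jump_count x j k 0 = 0" by (simp add: jump_count_def)
  then have e0: "emeasure ?N {0<..T} = of_nat (card ?J)"
    using T by (simp add: emeasure_jump_count_Ioc[OF x jk] jump_count_eq_card ennreal_of_nat_eq_real_of_nat)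
  have "emeasure ?N ({0<..T} - ?J) = emeasure ?N {0<..T} - emeasure ?N ?J"
    using J Jm eJ by (intro emeasure_Diff) (auto simp: of_nat_less_top less_top[symmetric])
  also have "\<dots> = 0" by (simp add: e0 eJ)
  finally have null: "{0<..T} - ?J \<in> null_sets ?N" using Jm by (intro null_setsI) auto
  have "(LINT s|?N. f s) = (LINT s|?N. (\<Sum>r\<in>?J. f r * indicator {r} s))"
  proof (rule integral_cong_AE)
    show "AE s in ?N. f s = (\<Sum>r\<in>?J. f r * indicator {r} s)"
      using AE_not_in[OF null]
    proof eventually_elim
      fix s assume s: "s \<notin> {0<..T} - ?J"
      have "(\<Sum>r\<in>?J. f r * indicator {r} s) = (\<Sum>r\<in>?J. if r = s then f r else 0)"
        by (intro sum.cong) (auto simp: indicator_def)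
      also have "\<dots> = (if s \<in> ?J then f s else 0)" using fin by simp
      also have "\<dots> = f s" using s supp[of s] J by auto
      finally show "f s = (\<Sum>r\<in>?J. f r * indicator {r} s)" by simp
    qed
  qed auto
  also have "\<dots> = (\<Sum>r\<in>?J. f r * measure ?N {r})"
  proof (subst Bochner_Integration.integral_sum)
    fix r assume "r \<in> ?J"
    then show "integrable ?N (\<lambda>s. f r * indicator {r} s)"
      by (intro integrable_mult_right integrable_real_indicator) (auto simp: sing)
  qed auto
  also have "\<dots> = (\<Sum>r\<in>?J. f r)"
    by (intro sum.cong) (auto simp: measure_def sing)
  finally show ?thesis .
qed

section \<open>Predictable grid approximation of the at-risk indicator\<close>

lemma pred_eq_countable [measurable (raw)]:
  fixes f g :: "'w \<Rightarrow> 'z::countable"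
  assumes "f \<in> measurable M (count_space UNIV)" "g \<in> measurable M (count_space UNIV)"
  shows "Measurable.pred M (\<lambda>w. f w = g w)"
proof -
  have "(\<lambda>w. f w = g w) = (\<lambda>w. \<exists>z. f w = z \<and> g w = z)" by auto
  then show ?thesis using assms by simp
qed

lemma borel_measurable_rat_duration:
  fixes f :: "'w \<Rightarrow> real \<Rightarrow> 'z::finite"
  assumes "\<And>q. 0 \<le> q \<Longrightarrow> q \<le> s \<Longrightarrow> (\<lambda>w. f w q) \<in> measurable M (count_space UNIV)" and s: "0 \<le> s"
  shows "(\<lambda>w. rat_duration s (f w)) \<in> borel_measurable M"
proof -
  have "(\<lambda>w. SUP q\<in>insert 0 (\<rat> \<inter> {0..<s}). if f w q \<noteq> f w s then q else 0) \<in> borel_measurable M"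
  proof (rule borel_measurable_cSUP)
    show "countable (insert 0 (\<rat> \<inter> {0..<s}))"
      using countable_rat by (auto intro: countable_subset)
  next
    fix q assume "q \<in> insert 0 (\<rat> \<inter> {0..<s})"
    then have q: "0 \<le> q" "q \<le> s" using s by auto
    have [measurable]: "(\<lambda>w. f w q) \<in> measurable M (count_space UNIV)"
      "(\<lambda>w. f w s) \<in> measurable M (count_space UNIV)"
      using assms(1) q s by auto
    show "(\<lambda>w. if f w q \<noteq> f w s then q else 0) \<in> borel_measurable M" by measurable
  next
    fix w
    show "bdd_above ((\<lambda>q. if f w q \<noteq> f w s then q else 0) ` insert 0 (\<rat> \<inter> {0..<s}))"
      by (rule rat_duration_bdd[OF s])
  qed
  then show ?thesis unfolding rat_duration_def by measurable
qed

definition grid :: "nat \<Rightarrow> nat \<Rightarrow> real" where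
  "grid n l = real l / real (Suc n)"

lemma grid_nonneg [simp]: "0 \<le> grid n l" by (simp add: grid_def)

lemma grid_Suc: "grid n (Suc l) = grid n l + 1 / real (Suc n)"
  by (simp add: grid_def add_divide_distrib)

lemma grid_less_Suc [simp]: "grid n l < grid n (Suc l)" by (simp add: grid_Suc)

lemma grid_mono: "l \<le> l' \<Longrightarrow> grid n l \<le> grid n l'"
  by (simp add: grid_def divide_right_mono)

lemma grid_cell_unique:
  assumes "s \<in> {grid n l<..grid n (Suc l)}" "s \<in> {grid n l'<..grid n (Suc l')}"
  shows "l = l'"
proof (rule ccontr)
  assume "l \<noteq> l'"
  then have "Suc l \<le> l' \<or> Suc l' \<le> l" by auto
  then have "grid n (Suc l) \<le> grid n l' \<or> grid n (Suc l') \<le> grid n l"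
    using grid_mono by blast
  then show False using assms by auto
qed

lemma grid_horizon: "grid n (H * Suc n) = real H"
  unfolding grid_def of_nat_mult by (rule nonzero_mult_div_cancel_right) simp

lemma grid_cell_exists:
  assumes "0 < s" "s \<le> real H"
  obtains l where "l < H * Suc n" "s \<in> {grid n l<..grid n (Suc l)}"
proof -
  define l where "l = nat (\<lceil>s * Suc n\<rceil> - 1)"
  have c: "0 < \<lceil>s * Suc n\<rceil>" using assms by simp
  then have l: "real l = real_of_int \<lceil>s * Suc n\<rceil> - 1" by (simp add: l_def)
  have 1: "real l < s * Suc n" "s * Suc n \<le> real (Suc l)"
    using l ceiling_correct[of "s * Suc n"] by auto
  have "s * Suc n \<le> real H * Suc n" using assms by (intro mult_right_mono) auto
  then have "real l < real (H * Suc n)" using 1 unfolding of_nat_mult by linarith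
  then have "l < H * Suc n" by linarith
  with 1 show thesis
    by (intro that[of l]) (auto simp: grid_def divide_less_eq le_divide_eq simp del: of_nat_Suc)
qed

lemma eventually_inverse_Suc_less:
  "0 < e \<Longrightarrow> eventually (\<lambda>n. 1 / real (Suc n) < e) sequentially"
  using order_tendstoD(2)[OF LIMSEQ_inverse_real_of_nat, of e] by (simp add: inverse_eq_divide)

text \<open>A cell of the Lexis diagram: calendar times in \<open>[a1, b1)\<close> and durations in \<open>[a2, b2)\<close>.\<close>

locale lexis_cell =
  fixes a1 b1 a2 b2 :: real
  assumes cell: "0 < a1" "a1 < b1" "0 < a2" "a2 < b2"
begin

text \<open>An integer end point makes every grid fill \<open>(0, horizon]\<close> exactly.\<close>

definition horizon :: nat where "horizon = nat \<lceil>b1\<rceil>"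

lemma horizon_ge: "b1 \<le> real horizon"
  using cell by (simp add: horizon_def real_nat_ceiling_ge)

definition at_risk :: "'z \<Rightarrow> (real \<Rightarrow> 'z) \<Rightarrow> real \<Rightarrow> real \<Rightarrow> real" where
  "at_risk z x r s = of_bool (s \<in> {a1..<b1} \<and> s \<le> r \<and> left_state x s = z \<and> left_duration x s \<in> {a2..<b2})"

text \<open>Apart from the deterministic restriction to \<open>[a1, b1)\<close>, only the path up to the left end point of
  the grid interval and the event that censoring has not happened before it are used.\<close>

definition grid_risk :: "'z \<Rightarrow> nat \<Rightarrow> nat \<Rightarrow> (real \<Rightarrow> 'z) \<Rightarrow> real \<Rightarrow> real" where
  "grid_risk z n l x r = of_bool (a1 \<le> grid n (Suc l) \<and> grid n (Suc l) < b1 \<and> grid n l \<le> r \<and>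
     x (grid n l) = z \<and> a2 - 2 / Suc n < rat_duration (grid n l) x \<and>
     rat_duration (grid n l) x \<le> b2 - 2 / Suc n)"

definition grid_step :: "'z \<Rightarrow> nat \<Rightarrow> (real \<Rightarrow> 'z) \<Rightarrow> real \<Rightarrow> real \<Rightarrow> real" where
  "grid_step z n x r s =
     (\<Sum>l<horizon * Suc n. grid_risk z n l x r * indicator {grid n l<..grid n (Suc l)} s)"

lemma at_risk_bounds: "0 \<le> at_risk z x r s" "at_risk z x r s \<le> 1"
  by (auto simp: at_risk_def)

lemma at_risk_outside: "s \<notin> {a1..<b1} \<Longrightarrow> at_risk z x r s = 0"
  by (auto simp: at_risk_def)

lemma grid_step_eq:
  assumes "l < horizon * Suc n" "s \<in> {grid n l<..grid n (Suc l)}"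
  shows "grid_step z n x r s = grid_risk z n l x r"
proof -
  have ind: "indicator {grid n l'<..grid n (Suc l')} s = (if l' = l then 1 else 0 :: real)" for l'
  proof (cases "l' = l")
    case True
    then show ?thesis using assms(2) by simp
  next
    case False
    then have "s \<notin> {grid n l'<..grid n (Suc l')}" using grid_cell_unique[OF assms(2)] by metis
    then show ?thesis using False by simp
  qed
  have "grid_step z n x r s = (\<Sum>l'<horizon * Suc n. if l' = l then grid_risk z n l x r else 0)"
    unfolding grid_step_def ind by (intro sum.cong) auto
  then show ?thesis using assms(1) by simp
qed

lemma grid_step_outside: "s \<notin> {0<..real horizon} \<Longrightarrow> grid_step z n x r s = 0"
proof -
  assume s: "s \<notin> {0<..real horizon}"
  have "s \<notin> {grid n l<..grid n (Suc l)}" if "l < horizon * Suc n" for l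
  proof -
    have "grid n (Suc l) \<le> real horizon" using grid_mono[of "Suc l" "horizon * Suc n" n] that
      by (simp only: grid_horizon Suc_le_eq)
    moreover have "0 \<le> grid n l" by simp
    ultimately show ?thesis using s unfolding greaterThanAtMost_iff by linarith
  qed
  then show ?thesis unfolding grid_step_def by (intro sum.neutral) auto
qed

lemma grid_step_bounds: "0 \<le> grid_step z n x r s" "grid_step z n x r s \<le> 1"
proof -
  have "0 \<le> grid_step z n x r s \<and> grid_step z n x r s \<le> 1"
  proof (cases "s \<in> {0<..real horizon}")
    case True
    then have "0 < s" "s \<le> real horizon" by auto
    from grid_cell_exists[OF this, of n] obtain l
      where l: "l < horizon * Suc n" "s \<in> {grid n l<..grid n (Suc l)}" by blast
    show ?thesis unfolding grid_step_eq[OF l] grid_risk_def by simp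
  qed (simp add: grid_step_outside)
  then show "0 \<le> grid_step z n x r s" "grid_step z n x r s \<le> 1" by auto
qed

text \<open>Just before \<open>s\<close> the path is constant and its duration grows with slope one. With mesh \<open>h\<close>, the
  duration at the left grid point is therefore smaller than the left limit \<open>D\<close>, but not by more than
  \<open>h\<close>. Hence it eventually lies in \<open>(a2 - 2 h, b2 - 2 h]\<close> if and only if \<open>D\<close> lies in \<open>[a2, b2)\<close>.
  Intervals that are open on the left and closed on the right are the ones whose probabilities are
  differences of distribution functions.\<close>

lemma grid_step_tendsto:
  assumes x: "jump_path x"
  shows "(\<lambda>n. grid_step z n x r s) \<longlonglongrightarrow> at_risk z x r s"
proof (cases "s \<in> {0<..real horizon}")
  case False
  moreover have "at_risk z x r s = 0"
    using False horizon_ge cell by (intro at_risk_outside) auto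
  ultimately show ?thesis by (simp add: grid_step_outside)
next
  case True
  then have s: "0 < s" "s \<le> real horizon" by auto
  from jump_path_const_left[OF x s(1)] obtain r0 where
    r0: "0 \<le> r0" "r0 < s" "\<And>q. r0 \<le> q \<Longrightarrow> q < s \<Longrightarrow> x q = left_state x s" by blast
  define D where "D = left_duration x s"
  have xr0: "x q = x r0" if "r0 \<le> q" "q < s" for q
    using r0(3)[of q] r0(3)[of r0] r0(2) that by simp
  have D: "D = duration x r0 + (s - r0)"
    unfolding D_def by (rule left_duration_eq[OF r0(1,2)], rule xr0)
  have dur: "rat_duration p x = D - (s - p)" if "r0 \<le> p" "p < s" for p
  proof -
    have "duration x p = duration x r0 + (p - r0)"
      using that by (intro duration_shift r0(1) xr0) auto
    then show ?thesis using D duration_eq_rat_duration[OF x, of p] that r0(1) by simp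
  qed
  \<comment> \<open>with a mesh below \<open>e\<close>, every condition at the left grid point has the same truth value as its
    counterpart at \<open>s\<close>\<close>
  define e where "e = Min {s - r0, if s < a1 then a1 - s else 1, if s < b1 then b1 - s else 1,
    if r < s then s - r else 1, if D < a2 then (a2 - D) / 2 else 1, if D < b2 then (b2 - D) / 2 else 1}"
  have e0: "0 < e" unfolding e_def using r0 by (subst Min_gr_iff) auto
  have "e \<le> s - r0" "e \<le> (if s < a1 then a1 - s else 1)" "e \<le> (if s < b1 then b1 - s else 1)"
    "e \<le> (if r < s then s - r else 1)" "e \<le> (if D < a2 then (a2 - D) / 2 else 1)"
    "e \<le> (if D < b2 then (b2 - D) / 2 else 1)"
    unfolding e_def by (intro Min_le; simp)+
  then have e: "e \<le> s - r0" "s < a1 \<Longrightarrow> e \<le> a1 - s" "s < b1 \<Longrightarrow> e \<le> b1 - s"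
    "r < s \<Longrightarrow> e \<le> s - r" "D < a2 \<Longrightarrow> 2 * e \<le> a2 - D" "D < b2 \<Longrightarrow> 2 * e \<le> b2 - D"
    by (auto split: if_splits)
  have "eventually (\<lambda>n. grid_step z n x r s = at_risk z x r s) sequentially"
    using eventually_inverse_Suc_less[OF e0]
  proof eventually_elim
    fix n :: nat assume n: "1 / real (Suc n) < e"
    define h where "h = 1 / real (Suc n)"
    obtain l where l: "l < horizon * Suc n" "s \<in> {grid n l<..grid n (Suc l)}"
      using grid_cell_exists[OF s] by blast
    define p where "p = grid n l"
    have p: "p < s" "s \<le> p + h" "h < e" "0 < h" using l(2) n by (auto simp: p_def grid_Suc h_def)
    have rp: "r0 \<le> p" using p e(1) by simp
    have "(a1 \<le> p + h) = (a1 \<le> s)" using p e(2) by linarith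
    moreover have "(p + h < b1) = (s < b1)" using p e(3) by linarith
    moreover have "(p \<le> r) = (s \<le> r)" using p e(4) by linarith
    moreover have "x p = left_state x s" using r0(3) rp p by simp
    moreover have "(a2 - 2 * h < rat_duration p x) = (a2 \<le> D)"
      unfolding dur[OF rp p(1)] using p e(5) by linarith
    moreover have "(rat_duration p x \<le> b2 - 2 * h) = (D < b2)"
      unfolding dur[OF rp p(1)] using p e(6) by linarith
    moreover have "2 / real (Suc n) = 2 * h" by (simp add: h_def)
    ultimately show "grid_step z n x r s = at_risk z x r s"
      unfolding grid_step_eq[OF l] grid_risk_def at_risk_def grid_Suc
      by (simp only: p_def[symmetric] h_def[symmetric] D_def[symmetric]) (auto simp: conj_commute)
  qed
  then show ?thesis by (rule tendsto_eventually)
qed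

lemma grid_step_measurable [measurable]: "grid_step z n x r \<in> borel_measurable borel"
  unfolding grid_step_def by measurable

lemma at_risk_measurable:
  assumes "jump_path x" shows "at_risk z x r \<in> borel_measurable borel"
  by (rule borel_measurable_LIMSEQ_metric[OF grid_step_measurable grid_step_tendsto[OF assms]])

lemma borel_measurable_grid_risk:
  fixes f :: "'w \<Rightarrow> real \<Rightarrow> 'z::finite"
  assumes "\<And>q. 0 \<le> q \<Longrightarrow> q \<le> grid n l \<Longrightarrow> (\<lambda>w. f w q) \<in> measurable M (count_space UNIV)"
    and [measurable]: "g \<in> borel_measurable M"
  shows "(\<lambda>w. grid_risk z n l (f w) (g w)) \<in> borel_measurable M"
proof -
  have [measurable]: "(\<lambda>w. f w (grid n l)) \<in> measurable M (count_space UNIV)" by (rule assms(1)) auto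
  have [measurable]: "(\<lambda>w. rat_duration (grid n l) (f w)) \<in> borel_measurable M"
    by (rule borel_measurable_rat_duration) (auto intro: assms(1))
  show ?thesis unfolding grid_risk_def by measurable
qed

section \<open>Occurrence and exposure of one path as measurable functionals\<close>

text \<open>The product \<open>\<sigma>\<close>-algebra on paths does not contain the set of jump paths. Limits along the grid
  give functionals that are measurable for it and have the intended values at every jump path.\<close>

definition exposure_fun :: "'z \<Rightarrow> (real \<Rightarrow> 'z) \<Rightarrow> real \<Rightarrow> real" where
  "exposure_fun z x r = (LINT s|lborel. lim (\<lambda>n. grid_step z n x r s))"

definition occurrence_fun :: "'z \<Rightarrow> 'z \<Rightarrow> (real \<Rightarrow> 'z) \<Rightarrow> real \<Rightarrow> real" where
  "occurrence_fun z z' x r =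
     lim (\<lambda>n. \<Sum>l<horizon * Suc n. grid_risk z n l x r * of_bool (x (grid n (Suc l)) = z'))"

lemma path_space_eval:
  "0 \<le> q \<Longrightarrow> (\<lambda>w. fst w q) \<in> measurable (path_space \<Otimes>\<^sub>M borel) (count_space UNIV)"
  by (rule measurable_compose[OF measurable_fst]) (auto intro: measurable_component_singleton)

lemma grid_step_pair_measurable:
  fixes f :: "'w \<Rightarrow> real \<Rightarrow> 'z::finite"
  assumes "\<And>q. 0 \<le> q \<Longrightarrow> (\<lambda>w. f w q) \<in> measurable M (count_space UNIV)"
    and "g \<in> borel_measurable M"
  shows "(\<lambda>(w, s). grid_step z n (f w) (g w) s) \<in> borel_measurable (M \<Otimes>\<^sub>M borel)"
proof -
  have [measurable]: "(\<lambda>w. grid_risk z n l (f w) (g w)) \<in> borel_measurable M" for l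
    using assms by (intro borel_measurable_grid_risk) auto
  show ?thesis unfolding grid_step_def by measurable
qed

lemma exposure_fun_measurable:
  "(\<lambda>(x, r). exposure_fun (z::'z::finite) x r) \<in> borel_measurable (path_space \<Otimes>\<^sub>M borel)"
proof -
  have "(\<lambda>(w, s). grid_step z n (fst w) (snd w) s) \<in> borel_measurable ((path_space \<Otimes>\<^sub>M borel) \<Otimes>\<^sub>M borel)" for n
    by (intro grid_step_pair_measurable path_space_eval) auto
  then have [measurable]: "(\<lambda>v. grid_step z n (fst (fst v)) (snd (fst v)) (snd v)) \<in>
      borel_measurable ((path_space \<Otimes>\<^sub>M borel) \<Otimes>\<^sub>M lborel)" for n
    by (simp add: case_prod_unfold)
  have "(\<lambda>(w, s). lim (\<lambda>n. grid_step z n (fst w) (snd w) s)) \<in>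
      borel_measurable ((path_space \<Otimes>\<^sub>M borel) \<Otimes>\<^sub>M lborel)"
    unfolding case_prod_unfold by (rule borel_measurable_lim_metric) measurable
  from lborel.borel_measurable_lebesgue_integral[OF this]
  show ?thesis unfolding exposure_fun_def by (simp add: case_prod_unfold)
qed

lemma occurrence_fun_measurable:
  "(\<lambda>(x, r). occurrence_fun (z::'z::finite) z' x r) \<in> borel_measurable (path_space \<Otimes>\<^sub>M borel)"
proof -
  have [measurable]: "(\<lambda>w. grid_risk z n l (fst w) (snd w)) \<in> borel_measurable (path_space \<Otimes>\<^sub>M borel)" for n l
    by (intro borel_measurable_grid_risk path_space_eval) auto
  have [measurable]: "(\<lambda>w. fst w (grid n l)) \<in> measurable (path_space \<Otimes>\<^sub>M borel) (count_space UNIV)" for n l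
    by (rule path_space_eval) simp
  show ?thesis unfolding occurrence_fun_def case_prod_unfold
    by (rule borel_measurable_lim_metric) measurable
qed

lemma grid_risk_restrict: "grid_risk z n l (restrict x {0..}) r = grid_risk z n l x r"
proof -
  have "rat_duration p (restrict x {0..}) = rat_duration p x" if "0 \<le> p" for p
  proof -
    have "(SUP q\<in>insert 0 (\<rat> \<inter> {0..<p}). if restrict x {0..} q \<noteq> restrict x {0..} p then q else 0) =
      (SUP q\<in>insert 0 (\<rat> \<inter> {0..<p}). if x q \<noteq> x p then q else 0)"
      using that by (intro SUP_cong) auto
    then show ?thesis by (simp add: rat_duration_def)
  qed
  then show ?thesis by (simp add: grid_risk_def)
qed

lemma grid_step_restrict: "grid_step z n (restrict x {0..}) r s = grid_step z n x r s"
  by (simp add: grid_step_def grid_risk_restrict)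

lemma exposure_fun_eq:
  "jump_path x \<Longrightarrow> exposure_fun z (restrict x {0..}) r = (LINT s|lborel. at_risk z x r s)"
  unfolding exposure_fun_def grid_step_restrict
  by (intro Bochner_Integration.integral_cong refl limI grid_step_tendsto)

text \<open>The Stieltjes sum of the step function against the jump count is exact on every grid, because both
  sides count the transition times cell by cell.\<close>

lemma grid_sum_transition_times:
  assumes x: "jump_path x" and zz: "z \<noteq> z'"
  shows "(\<Sum>l<horizon * Suc n. grid_risk y n l x r *
      (jump_count x z z' (grid n (Suc l)) - jump_count x z z' (grid n l))) =
    (\<Sum>s\<in>transition_times x z z' (real horizon). grid_step y n x r s)"
proof -
  let ?J = "transition_times x z z' (real horizon)"
  note fin = finite_transition_times[OF x zz, of "real horizon"]
  have "jump_count x z z' (grid n (Suc l)) - jump_count x z z' (grid n l) =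
      (\<Sum>s\<in>?J. indicator {grid n l<..grid n (Suc l)} s)" if "l < horizon * Suc n" for l
  proof -
    have "grid n (Suc l) \<le> real horizon" using grid_mono[of "Suc l" "horizon * Suc n" n] that
      by (simp only: grid_horizon Suc_le_eq)
    then have "jump_count x z z' (grid n (Suc l)) - jump_count x z z' (grid n l) =
        real (card (?J \<inter> {grid n l<..grid n (Suc l)}))"
      by (intro jump_count_diff x zz) (auto intro: less_imp_le)
    then show ?thesis using fin by (simp add: indicator_def Int_def)
  qed
  then have "(\<Sum>l<horizon * Suc n. grid_risk y n l x r *
      (jump_count x z z' (grid n (Suc l)) - jump_count x z z' (grid n l))) =
      (\<Sum>l<horizon * Suc n. \<Sum>s\<in>?J. grid_risk y n l x r * indicator {grid n l<..grid n (Suc l)} s)"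
    by (intro sum.cong) (auto simp: sum_distrib_left)
  also have "\<dots> = (\<Sum>s\<in>?J. grid_step y n x r s)"
    unfolding grid_step_def by (rule sum.swap)
  finally show ?thesis .
qed

lemma grid_sum_transition_times_tendsto:
  assumes x: "jump_path x" and zz: "z \<noteq> z'"
  shows "(\<lambda>n. \<Sum>l<horizon * Suc n. grid_risk y n l x r *
      (jump_count x z z' (grid n (Suc l)) - jump_count x z z' (grid n l)))
    \<longlonglongrightarrow> (\<Sum>s\<in>transition_times x z z' (real horizon). at_risk y x r s)"
  unfolding grid_sum_transition_times[OF assms]
  by (intro tendsto_sum grid_step_tendsto x)

text \<open>As soon as the mesh is below the smallest gap between jumps, the increments of the jump count can
  be read off from the states at the grid points.\<close>

lemma occurrence_fun_eq:
  assumes x: "jump_path x" and zz: "z \<noteq> z'"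
  shows "occurrence_fun z z' (restrict x {0..}) r =
    (\<Sum>s\<in>transition_times x z z' (real horizon). at_risk z x r s)"
proof -
  let ?J = "jump_times x (real horizon)"
  have fin: "finite ?J" by (rule finite_jump_times[OF x])
  have "eventually (\<lambda>n. \<forall>s\<in>?J. \<forall>s'\<in>?J. s \<noteq> s' \<longrightarrow> 1 / real (Suc n) < \<bar>s - s'\<bar>) sequentially"
  proof (intro eventually_ball_finite fin ballI)
    fix s s' :: real
    show "eventually (\<lambda>n. s \<noteq> s' \<longrightarrow> 1 / real (Suc n) < \<bar>s - s'\<bar>) sequentially"
      using eventually_inverse_Suc_less[of "\<bar>s - s'\<bar>"] by (cases "s = s'") auto
  qed
  then have ev: "eventually (\<lambda>n. (\<Sum>l<horizon * Suc n. grid_risk z n l x r *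
      (jump_count x z z' (grid n (Suc l)) - jump_count x z z' (grid n l))) =
     (\<Sum>l<horizon * Suc n. grid_risk z n l x r * of_bool (x (grid n (Suc l)) = z'))) sequentially"
  proof eventually_elim
    fix n assume gap: "\<forall>s\<in>?J. \<forall>s'\<in>?J. s \<noteq> s' \<longrightarrow> 1 / real (Suc n) < \<bar>s - s'\<bar>"
    show "(\<Sum>l<horizon * Suc n. grid_risk z n l x r *
      (jump_count x z z' (grid n (Suc l)) - jump_count x z z' (grid n l))) =
     (\<Sum>l<horizon * Suc n. grid_risk z n l x r * of_bool (x (grid n (Suc l)) = z'))"
    proof (intro sum.cong refl)
      fix l assume "l \<in> {..<horizon * Suc n}"
      then have le: "grid n (Suc l) \<le> real horizon"
        using grid_mono[of "Suc l" "horizon * Suc n" n]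
        by (simp only: grid_horizon Suc_le_eq lessThan_iff)
      have "jump_count x z z' (grid n (Suc l)) - jump_count x z z' (grid n l) =
          of_bool (x (grid n l) = z \<and> x (grid n (Suc l)) = z')"
      proof (subst jump_count_diff[OF x zz _ _ le])
        show "real (card (transition_times x z z' (real horizon) \<inter> {grid n l<..grid n (Suc l)})) =
            of_bool (x (grid n l) = z \<and> x (grid n (Suc l)) = z')"
        proof (rule card_transition_times_cell[OF x zz _ _ le])
          fix s s' assume s: "s \<in> ?J \<inter> {grid n l<..grid n (Suc l)}" "s' \<in> ?J \<inter> {grid n l<..grid n (Suc l)}"
          then have "\<bar>s - s'\<bar> \<le> 1 / real (Suc n)" by (auto simp: grid_Suc)
          with s gap show "s = s'" by (meson IntD1 not_le)
        qed auto
      qed (auto intro: less_imp_le)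
      then show "grid_risk z n l x r *
         (jump_count x z z' (grid n (Suc l)) - jump_count x z z' (grid n l)) =
         grid_risk z n l x r * of_bool (x (grid n (Suc l)) = z')"
        by (simp add: grid_risk_def)
    qed
  qed
  have "(\<lambda>n. \<Sum>l<horizon * Suc n. grid_risk z n l x r * of_bool (x (grid n (Suc l)) = z'))
      \<longlonglongrightarrow> (\<Sum>s\<in>transition_times x z z' (real horizon). at_risk z x r s)"
    by (rule Lim_transform_eventually[OF grid_sum_transition_times_tendsto[OF assms] ev])
  then show ?thesis
    by (simp add: occurrence_fun_def grid_risk_restrict limI)
qed

lemma exposure_integral_eq:
  "(LINT s:{0..r}|lborel. indicator {a1..<b1} s * indicator {a2..<b2} (left_duration x s) *
     indicator {s. left_state x s = z} s) = (LINT s|lborel. at_risk z x r s)"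
  unfolding set_lebesgue_integral_def
  using cell by (intro Bochner_Integration.integral_cong) (auto simp: at_risk_def indicator_def)

text \<open>Summing the at-risk indicators over all states removes the condition on the state and shows that
  the integrand is measurable in time. At the transition times the condition on the state holds anyway.\<close>

lemma occurrence_integral_eq:
  fixes z z' :: "'z::finite"
  assumes x: "jump_path x" and zz: "z \<noteq> z'"
  shows "(LINT s:{0<..r}|interval_measure (jump_count x z z').
      indicator {a1..<b1} s * indicator {a2..<b2} (left_duration x s)) =
    (\<Sum>s\<in>transition_times x z z' (real horizon). at_risk z x r s)"
proof -
  let ?f = "\<lambda>s. indicator {0<..r} s *\<^sub>R (indicator {a1..<b1} s * indicator {a2..<b2} (left_duration x s)) :: real"
  have f: "?f s = (\<Sum>y\<in>UNIV. at_risk y x r s)" for s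
  proof -
    have "(\<Sum>y\<in>UNIV. at_risk y x r s) =
      (\<Sum>y\<in>UNIV. if y = left_state x s then of_bool (s \<in> {a1..<b1} \<and> s \<le> r \<and> left_duration x s \<in> {a2..<b2}) else 0)"
      by (intro sum.cong) (auto simp: at_risk_def)
    also have "\<dots> = of_bool (s \<in> {a1..<b1} \<and> s \<le> r \<and> left_duration x s \<in> {a2..<b2})" by simp
    also have "\<dots> = ?f s" using cell by (auto simp: indicator_def)
    finally show ?thesis by simp
  qed
  have "(LINT s|interval_measure (jump_count x z z'). ?f s) =
      (\<Sum>s\<in>transition_times x z z' (real horizon). ?f s)"
  proof (rule integral_jump_count[OF x zz])
    show "?f \<in> borel_measurable borel"
      unfolding f using at_risk_measurable[OF x] by (intro borel_measurable_sum) auto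
    show "?f s = 0" if "s \<notin> {0<..real horizon}" for s
      using that horizon_ge by (auto simp: indicator_def)
  qed simp
  also have "\<dots> = (\<Sum>s\<in>transition_times x z z' (real horizon). at_risk z x r s)"
    using cell by (intro sum.cong) (auto simp: transition_times_def at_risk_def indicator_def)
  finally show ?thesis unfolding set_lebesgue_integral_def .
qed

text \<open>A transition out of \<open>z\<close> resets the duration. A second transition out of \<open>z\<close> within the same
  short time interval has a duration below \<open>a2\<close> and is not counted.\<close>

lemma sum_transition_times_le_1:
  assumes x: "jump_path x" and zz: "z \<noteq> z'" and short: "b1 - a1 \<le> a2"
  shows "(\<Sum>s\<in>transition_times x z z' T. at_risk z x r s) \<in> {0, 1}"
proof -
  let ?J = "transition_times x z z' T"
  let ?K = "{s \<in> ?J. at_risk z x r s = 1}"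
  have fin: "finite ?J" by (rule finite_transition_times[OF x zz])
  have ne: "\<not> s < s'" if s: "s \<in> ?K" "s' \<in> ?K" for s s'
  proof
    assume ss: "s < s'"
    have sI: "0 < s" "x s = z'" "a1 \<le> s" using s(1) by (auto simp: transition_times_def at_risk_def)
    have s': "left_state x s' = z" "s' < b1" "a2 \<le> left_duration x s'" using s(2) by (auto simp: at_risk_def)
    have "0 < s'" using ss sI by simp
    from jump_path_const_left[OF x this] obtain r0 where
      r0: "0 \<le> r0" "r0 < s'" "\<And>q. r0 \<le> q \<Longrightarrow> q < s' \<Longrightarrow> x q = left_state x s'" by blast
    have "s < r0"
    proof (rule ccontr)
      assume "\<not> s < r0"
      then have "x s = z" using r0(3)[of s] ss s'(1) by simp
      then show False using sI(2) zz by simp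
    qed
    have "duration x r0 \<le> r0 - s"
    proof (rule ccontr)
      assume "\<not> duration x r0 \<le> r0 - s"
      then have *: "r0 - s < duration x r0" by simp
      have "\<not> duration x r0 < duration x r0" by simp
      then have "\<forall>q\<in>{0..<r0}. r0 - duration x r0 < q \<longrightarrow> x q = x r0"
        using duration_less_iff[OF r0(1), of x "duration x r0"] by blast
      then have "x s = x r0" using \<open>s < r0\<close> sI * by auto
      moreover have "x r0 = z" using r0(3)[of r0] r0(2) s' by simp
      ultimately show False using sI zz by simp
    qed
    moreover have "x q = x r0" if "r0 \<le> q" "q < s'" for q
      using r0(3)[of q] r0(3)[of r0] r0(2) that by simp
    then have "left_duration x s' = duration x r0 + (s' - r0)"
      by (intro left_duration_eq[OF r0(1,2)])
    ultimately show False using s' sI short by simp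
  qed
  have "(\<Sum>s\<in>?J. at_risk z x r s) = (\<Sum>s\<in>?K. 1)"
    by (rule sum.mono_neutral_cong_right[OF fin]) (auto simp: at_risk_def)
  also have "\<dots> = real (card ?K)" by simp
  finally have eq: "(\<Sum>s\<in>?J. at_risk z x r s) = real (card ?K)" .
  have "finite ?K" using fin by simp
  moreover have "\<forall>s\<in>?K. \<forall>s'\<in>?K. s = s'"
  proof (intro ballI)
    fix s s' assume "s \<in> ?K" "s' \<in> ?K"
    from ne[OF this] ne[OF this(2,1)] show "s = s'" by linarith
  qed
  ultimately have "card ?K \<le> Suc 0" by (rule card_le_Suc0_iff_eq[THEN iffD2])
  then have "card ?K = 0 \<or> card ?K = 1" by linarith
  then show ?thesis using eq by auto
qed

lemma integral_at_risk_bounds: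
  assumes "jump_path x"
  shows "0 \<le> (LINT s|lborel. at_risk z x r s)" "(LINT s|lborel. at_risk z x r s) \<le> b1 - a1"
    and "integrable lborel (at_risk z x r)"
proof -
  show "0 \<le> (LINT s|lborel. at_risk z x r s)" by (simp add: at_risk_bounds)
  have int: "integrable lborel (indicator {a1..<b1} :: real \<Rightarrow> real)" using cell by simp
  show i: "integrable lborel (at_risk z x r)"
  proof (rule Bochner_Integration.integrable_bound[OF int])
    show "at_risk z x r \<in> borel_measurable lborel" using at_risk_measurable[OF assms] by simp
  qed (auto simp: at_risk_def)
  have "(LINT s|lborel. at_risk z x r s) \<le> (LINT s|lborel. indicator {a1..<b1} s)"
    by (rule integral_mono[OF i int]) (auto simp: at_risk_def)
  then show "(LINT s|lborel. at_risk z x r s) \<le> b1 - a1" using cell by simp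
qed

end

section \<open>Occurrence and exposure of one censored semi-Markov process\<close>

locale censored_semi_markov = prob_space M
  for M :: "'w measure" +
  fixes Z :: "real \<Rightarrow> 'w \<Rightarrow> 'z::finite" and R :: "'w \<Rightarrow> real"
    and \<mu> :: "'z \<Rightarrow> 'z \<Rightarrow> real \<Rightarrow> real \<Rightarrow> real"
  assumes paths: "\<And>w. w \<in> space M \<Longrightarrow> jump_path (\<lambda>s. Z s w)"
    and int_count: "\<And>y z s. y \<noteq> z \<Longrightarrow> 0 \<le> s \<Longrightarrow> integrable M (\<lambda>w. jump_count (\<lambda>s. Z s w) y z s)"
    and intens: "has_transition_intensities M Z \<mu>"
    and indep: "independent_rvs M path_space (random_path Z) borel R"
begin

abbreviation history :: "real \<Rightarrow> 'w measure" where
  "history \<equiv> completed_natural_filtration M (count_space UNIV) Z"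

lemma path_measurable [measurable]: "random_path Z \<in> measurable M path_space"
  and R_measurable [measurable]: "R \<in> borel_measurable M"
  using indep by (auto simp: independent_rvs_def)

lemma Z_measurable: "0 \<le> q \<Longrightarrow> Z q \<in> measurable M (count_space UNIV)"
proof -
  assume q: "0 \<le> q"
  have "(\<lambda>w. random_path Z w q) \<in> measurable M (count_space UNIV)"
    by (rule measurable_compose[OF path_measurable measurable_component_singleton]) (use q in auto)
  then show ?thesis using q by (simp add: random_path_def)
qed

lemma space_G [simp]: "space (history s) = space M"
  unfolding completed_natural_filtration_def
  by (rule space_measure_of) (auto dest: null_setsD2 sets.sets_into_space)

lemma sets_G: "sets (history s) = sigma_sets (space M)
    ({Z q -` A \<inter> space M | q A. 0 \<le> q \<and> q \<le> s \<and> A \<in> sets (count_space UNIV)} \<union> null_sets M)"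
  unfolding completed_natural_filtration_def
  by (rule sets_measure_of) (auto dest: null_setsD2 sets.sets_into_space)

lemma subalgebra_G: "subalgebra M (history s)"
proof -
  have "sets (history s) \<subseteq> sets M"
    unfolding sets_G
    by (rule sets.sigma_sets_subset) (auto intro: measurable_sets[OF Z_measurable])
  then show ?thesis by (simp add: subalgebra_def)
qed

lemma sets_G_mono: "s \<le> s' \<Longrightarrow> sets (history s) \<subseteq> sets (history s')"
  unfolding sets_G by (rule sigma_sets_mono') fastforce

lemma measurable_G_mono: "s \<le> s' \<Longrightarrow> f \<in> borel_measurable (history s) \<Longrightarrow> f \<in> borel_measurable (history s')"
  using sets_G_mono by (auto simp: measurable_def)

lemma Z_measurable_G: "0 \<le> q \<Longrightarrow> q \<le> s \<Longrightarrow> Z q \<in> measurable (history s) (count_space UNIV)"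
  by (rule measurableI) (auto simp: sets_G intro!: sigma_sets.Basic)

text \<open>Completing by null sets preserves independence: every event of the completed filtration agrees
  almost surely with an event determined by the path.\<close>

lemma completed_set_AE_eq_path_event:
  assumes "S \<in> sets (history s)"
  shows "\<exists>S'\<in>sets (vimage_algebra (space M) (random_path Z) path_space). AE w in M. w \<in> S \<longleftrightarrow> w \<in> S'"
proof -
  let ?V = "vimage_algebra (space M) (random_path Z) path_space"
  have sp: "random_path Z \<in> space M \<rightarrow> space path_space" using path_measurable by (rule measurable_space[THEN funcsetI])
  from assms show ?thesis unfolding sets_G
  proof induction
    case (Basic S)
    then show ?case
    proof
      assume "S \<in> {Z q -` A \<inter> space M | q A. 0 \<le> q \<and> q \<le> s \<and> A \<in> sets (count_space UNIV)}"
      then obtain q A where q: "0 \<le> q" and S: "S = Z q -` A \<inter> space M" by auto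
      have "(\<lambda>y. y q) -` A \<inter> space path_space \<in> sets (path_space :: (real \<Rightarrow> 'z) measure)"
        by (rule measurable_sets[OF measurable_component_singleton]) (use q in auto)
      then have "random_path Z -` ((\<lambda>y. y q) -` A \<inter> space path_space) \<inter> space M \<in> sets ?V"
        by (rule in_vimage_algebra)
      moreover have "random_path Z -` ((\<lambda>y. y q) -` A \<inter> space path_space) \<inter> space M = S"
        using sp q unfolding S by (auto simp: random_path_def)
      ultimately show ?case by auto
    next
      assume "S \<in> null_sets M"
      then show ?case by (intro bexI[of _ "{}"]) (auto dest: AE_not_in)
    qed
  next
    case Empty
    show ?case by (intro bexI[of _ "{}"]) auto
  next
    case (Compl S)
    then obtain S' where S': "S' \<in> sets ?V" "AE w in M. w \<in> S \<longleftrightarrow> w \<in> S'" by blast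
    show ?case
    proof (intro bexI)
      show "space ?V - S' \<in> sets ?V" using S' by blast
      show "AE w in M. w \<in> space M - S \<longleftrightarrow> w \<in> space ?V - S'"
        using S'(2) by eventually_elim (auto simp: space_vimage_algebra)
    qed
  next
    case (Union S)
    then have "\<forall>i. \<exists>S'. S' \<in> sets ?V \<and> (AE w in M. w \<in> S i \<longleftrightarrow> w \<in> S')" by blast
    then obtain S' where S': "\<And>i. S' i \<in> sets ?V" "\<And>i. AE w in M. w \<in> S i \<longleftrightarrow> w \<in> S' i" by metis
    have "AE w in M. \<forall>i. w \<in> S i \<longleftrightarrow> w \<in> S' i" using S'(2) by (simp add: AE_all_countable)
    then have "AE w in M. w \<in> (\<Union>i. S i) \<longleftrightarrow> w \<in> (\<Union>i. S' i)" by eventually_elim auto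
    then show ?case using S'(1) by (intro bexI[of _ "\<Union>i. S' i"]) auto
  qed
qed

lemma completed_filtration_indep_R:
  assumes S: "S \<in> sets (history s)" and B: "B \<in> sets (vimage_algebra (space M) R borel)"
  shows "prob (S \<inter> B) = prob S * prob B"
proof -
  let ?V = "vimage_algebra (space M) (random_path Z) path_space"
  obtain S' where S': "S' \<in> sets ?V" "AE w in M. w \<in> S \<longleftrightarrow> w \<in> S'"
    using completed_set_AE_eq_path_event[OF S] by blast
  have ind: "indep_set (sets ?V) (sets (vimage_algebra (space M) R borel))"
    using indep by (simp add: independent_rvs_def)
  note ev = indep_setD_ev1[OF ind] indep_setD_ev2[OF ind]
  have [measurable]: "S \<in> sets M" using S subalgebra_G by (auto simp: subalgebra_def)
  have [measurable]: "S' \<in> sets M" "B \<in> sets M" using S' B ev by auto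
  have "prob (S \<inter> B) = prob (S' \<inter> B)"
    using S'(2) by (intro finite_measure_eq_AE) (auto elim: eventually_mono)
  also have "\<dots> = prob S' * prob B" by (rule indep_setD[OF ind S'(1) B])
  also have "prob S' = prob S"
    using S'(2) by (intro finite_measure_eq_AE) (auto elim: eventually_mono)
  finally show ?thesis .
qed

lemma expectation_completed_filtration_times_R:
  fixes f :: "'w \<Rightarrow> real" and g :: "real \<Rightarrow> real"
  assumes f: "f \<in> borel_measurable (history s)" "integrable M f"
    and g: "g \<in> borel_measurable borel" "integrable M (\<lambda>w. g (R w))"
  shows "expectation (\<lambda>w. f w * g (R w)) = expectation f * expectation (\<lambda>w. g (R w))"
proof (rule indep_var_lebesgue_integral)
  have fM: "f \<in> borel_measurable M" using f(2) by auto
  have gM: "(\<lambda>w. g (R w)) \<in> borel_measurable M" using g(2) by auto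
  show "indep_var borel f borel (\<lambda>w. g (R w))"
    unfolding indep_var_eq
  proof (intro conjI fM gM indep_setI)
    let ?F = "sigma_sets (space M) {f -` A \<inter> space M | A. A \<in> sets borel}"
    let ?R = "sigma_sets (space M) {(\<lambda>w. g (R w)) -` A \<inter> space M | A. A \<in> sets borel}"
    have F: "?F \<subseteq> sets (history s)"
      using sets.sigma_sets_subset[of "{f -` A \<inter> space M | A. A \<in> sets borel}" "history s"]
        measurable_sets[OF f(1)] by auto
    have R: "?R \<subseteq> sets (vimage_algebra (space M) R borel)"
    proof -
      have "(\<lambda>w. g (R w)) -` A \<inter> space M \<in> sets (vimage_algebra (space M) R borel)"
        if "A \<in> sets borel" for A
      proof -
        have "g -` A \<in> sets borel" using measurable_sets[OF g(1) that] by simp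
        from in_vimage_algebra[OF this, of R "space M"] show ?thesis by (simp add: vimage_def)
      qed
      then show ?thesis
        using sets.sigma_sets_subset[of "{(\<lambda>w. g (R w)) -` A \<inter> space M | A. A \<in> sets borel}"
          "vimage_algebra (space M) R borel"] by (auto simp: space_vimage_algebra)
    qed
    show "?F \<subseteq> events" using F subalgebra_G by (auto simp: subalgebra_def)
    show "?R \<subseteq> events"
      by (rule sets.sigma_sets_subset) (auto intro: measurable_sets[OF gM])
    show "prob (a \<inter> b) = prob a * prob b" if "a \<in> ?F" "b \<in> ?R" for a b
      using completed_filtration_indep_R[of a s b] that F R by blast
  qed
qed (use f g in auto)

text \<open>The stochastic intensity of the transitions from \<open>y\<close> to \<open>z\<close> along one trajectory.\<close>

definition path_intensity :: "'z \<Rightarrow> 'z \<Rightarrow> 'w \<Rightarrow> real \<Rightarrow> real" where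
  "path_intensity y z w s = indicator {s. left_state (\<lambda>r. Z r w) s = y} s * \<mu> y z s (left_duration (\<lambda>r. Z r w) s)"

definition cumulative :: "'z \<Rightarrow> 'z \<Rightarrow> real \<Rightarrow> 'w \<Rightarrow> real" where
  "cumulative y z t w = (LINT s:{0..t}|lborel. path_intensity y z w s)"

definition mart :: "'z \<Rightarrow> 'z \<Rightarrow> real \<Rightarrow> 'w \<Rightarrow> real" where
  "mart y z t w = jump_count (\<lambda>r. Z r w) y z t - cumulative y z t w"

context
  fixes y z :: 'z assumes yz: "y \<noteq> z"
begin

lemma intensity_nonneg: "0 \<le> s \<Longrightarrow> 0 \<le> v \<Longrightarrow> 0 \<le> \<mu> y z s v"
  using intens yz by (auto simp: has_transition_intensities_def)

lemma intensity_integrable: "AE w in M. \<forall>t\<ge>0. set_integrable lborel {0..t} (path_intensity y z w)"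
proof -
  have "AE w in M. \<forall>t\<ge>0. set_integrable lborel {0..t}
           (\<lambda>s. indicator {s. left_state (\<lambda>r. Z r w) s = y} s * \<mu> y z s (left_duration (\<lambda>r. Z r w) s))"
    using intens yz unfolding has_transition_intensities_def by blast
  then show ?thesis by (simp add: path_intensity_def[abs_def])
qed

lemma martingale_mart: "martingale_process M history (mart y z)"
proof -
  have "is_compensator M history (\<lambda>t w. jump_count (\<lambda>r. Z r w) y z t) (cumulative y z)"
    using intens yz unfolding has_transition_intensities_def cumulative_def[abs_def] path_intensity_def[abs_def] by blast
  then show ?thesis unfolding is_compensator_def mart_def[abs_def] by blast
qed

lemma mart_measurable: "0 \<le> s \<Longrightarrow> mart y z s \<in> borel_measurable (history s)"
  and mart_integrable: "0 \<le> s \<Longrightarrow> integrable M (mart y z s)"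
  using martingale_mart by (auto simp: martingale_process_def adapted_process_def)

lemma cumulative_integrable: "0 \<le> s \<Longrightarrow> integrable M (cumulative y z s)"
proof -
  assume s: "0 \<le> s"
  have "integrable M (\<lambda>w. jump_count (\<lambda>r. Z r w) y z s - mart y z s w)"
    using int_count[OF yz s] mart_integrable[OF s] by (rule Bochner_Integration.integrable_diff)
  then show ?thesis by (simp add: mart_def)
qed

lemma mart_increment_orthogonal:
  assumes s: "0 \<le> s" "s \<le> s'" and S: "S \<in> sets (history s)"
  shows "expectation (\<lambda>w. indicator S w * (mart y z s' w - mart y z s w)) = 0"
proof -
  interpret sub: finite_measure_subalgebra M "history s"
    by unfold_locales (rule subalgebra_G)
  have s': "0 \<le> s'" using s by simp
  have [measurable]: "S \<in> sets M" using S subalgebra_G by (auto simp: subalgebra_def)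
  have int: "integrable M (\<lambda>w. indicator S w * mart y z r w)" if "0 \<le> r" for r
    using integrable_mult_indicator[OF \<open>S \<in> sets M\<close> mart_integrable[OF that]] by simp
  have "expectation (\<lambda>w. indicator S w * mart y z s' w) =
      (LINT w:S|M. real_cond_exp M (history s) (mart y z s') w)"
    using sub.real_cond_exp_intA[OF mart_integrable[OF s'] S] by (simp add: set_lebesgue_integral_def)
  also have "\<dots> = (LINT w:S|M. mart y z s w)"
  proof (rule set_lebesgue_integral_cong_AE)
    have "AE w in M. real_cond_exp M (history s) (mart y z s') w = mart y z s w"
      using martingale_mart s by (auto simp: martingale_process_def)
    then show "AE w\<in>S in M. real_cond_exp M (history s) (mart y z s') w = mart y z s w"
      by eventually_elim simp
    show "mart y z s \<in> borel_measurable M" using mart_integrable[OF s(1)] by auto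
  qed auto
  finally show ?thesis
    using int[OF s(1)] int[OF s'] by (simp add: right_diff_distrib set_lebesgue_integral_def)
qed

end

end

locale observed_cell = censored_semi_markov M Z R \<mu> + lexis_cell a1 b1 a2 b2
  for M :: "'w measure" and Z :: "real \<Rightarrow> 'w \<Rightarrow> 'z::finite" and R \<mu> and a1 b1 a2 b2 :: real +
  fixes j k :: 'z
  assumes jk: "j \<noteq> k" and short: "b1 - a1 \<le> a2"
begin

definition occ :: "'w \<Rightarrow> real" where "occ w = occurrence_fun j k (random_path Z w) (R w)"

definition expo :: "'w \<Rightarrow> real" where "expo w = exposure_fun j (random_path Z w) (R w)"

abbreviation "risk w \<equiv> at_risk j (\<lambda>r. Z r w) (R w)"

abbreviation "gstep n w \<equiv> grid_step j n (\<lambda>r. Z r w) (R w)"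

abbreviation "grisk n l w \<equiv> grid_risk j n l (\<lambda>r. Z r w) (R w)"

lemma occ_measurable [measurable]: "occ \<in> borel_measurable M"
proof -
  have "(\<lambda>w. (random_path Z w, R w)) \<in> measurable M (path_space \<Otimes>\<^sub>M borel)" by measurable
  from measurable_compose[OF this occurrence_fun_measurable[of j k]]
  show ?thesis by (simp add: occ_def[abs_def])
qed

lemma expo_measurable [measurable]: "expo \<in> borel_measurable M"
proof -
  have "(\<lambda>w. (random_path Z w, R w)) \<in> measurable M (path_space \<Otimes>\<^sub>M borel)" by measurable
  from measurable_compose[OF this exposure_fun_measurable[of j]]
  show ?thesis by (simp add: expo_def[abs_def])
qed

lemma occ_eq: "w \<in> space M \<Longrightarrow>
    occ w = (\<Sum>s\<in>transition_times (\<lambda>r. Z r w) j k (real horizon). risk w s)"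
  unfolding occ_def random_path_def by (rule occurrence_fun_eq[OF paths jk])

lemma expo_eq: "w \<in> space M \<Longrightarrow> expo w = (LINT s|lborel. risk w s)"
  unfolding expo_def random_path_def by (rule exposure_fun_eq[OF paths])

lemma occ_01: "w \<in> space M \<Longrightarrow> occ w \<in> {0, 1}"
  unfolding occ_eq by (rule sum_transition_times_le_1[OF paths jk short])

lemma expo_bounds: "w \<in> space M \<Longrightarrow> 0 \<le> expo w" "w \<in> space M \<Longrightarrow> expo w \<le> b1 - a1"
  unfolding expo_eq by (intro integral_at_risk_bounds paths; assumption)+

lemma occ_integrable: "integrable M occ"
  by (rule integrable_const_bound[of _ 1]) (use occ_01 in \<open>force intro!: AE_I2\<close>)+

lemma expo_integrable: "integrable M expo"
  by (rule integrable_const_bound[of _ "b1 - a1"]) (use expo_bounds in \<open>auto intro!: AE_I2\<close>)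

lemma grisk_measurable: "grisk n l \<in> borel_measurable M"
  by (rule borel_measurable_grid_risk) (auto intro: Z_measurable)

text \<open>The indicator is a product of an event of the past of the path and an event of the censoring time.
  Independence splits off the second factor, and the martingale property annihilates the rest.\<close>

lemma grisk_orthogonal:
  "integrable M (\<lambda>w. grisk n l w * (mart j k (grid n (Suc l)) w - mart j k (grid n l) w))"
  "expectation (\<lambda>w. grisk n l w * (mart j k (grid n (Suc l)) w - mart j k (grid n l) w)) = 0"
proof -
  let ?p = "grid n l" and ?q = "grid n (Suc l)"
  define S where "S = {w \<in> space M. grid_risk j n l (\<lambda>r. Z r w) ?p = 1}"
  have pq: "?p \<le> ?q" by (intro less_imp_le) simp
  have "(\<lambda>w. grid_risk j n l (\<lambda>r. Z r w) ?p) \<in> borel_measurable (history ?p)"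
    by (rule borel_measurable_grid_risk) (auto intro: Z_measurable_G)
  then have "(\<lambda>w. grid_risk j n l (\<lambda>r. Z r w) ?p) -` {1} \<inter> space (history ?p) \<in> sets (history ?p)"
    by (rule measurable_sets) auto
  then have S: "S \<in> sets (history ?p)" by (simp add: S_def vimage_def Int_def conj_commute)
  have grisk: "grisk n l w = indicator S w * indicator {?p..} (R w)" if "w \<in> space M" for w
    using that by (auto simp: S_def grid_risk_def indicator_def)
  let ?f = "\<lambda>w. indicator S w * (mart j k ?q w - mart j k ?p w)"
  have Sq: "S \<in> sets (history ?q)" using S sets_G_mono[OF pq] by blast
  have SM: "S \<in> sets M" using S subalgebra_G by (auto simp: subalgebra_def)
  have fint: "integrable M ?f"
    using integrable_mult_indicator[OF SM Bochner_Integration.integrable_diff[OF mart_integrable[OF jk, of ?q] mart_integrable[OF jk, of ?p]]]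
    by simp
  have fG: "?f \<in> borel_measurable (history ?q)"
    using Sq mart_measurable[OF jk, of ?q] measurable_G_mono[OF pq mart_measurable[OF jk, of ?p]]
    by (intro borel_measurable_times borel_measurable_diff borel_measurable_indicator) auto
  have eq: "grisk n l w * (mart j k ?q w - mart j k ?p w) = ?f w * indicator {?p..} (R w)"
    if "w \<in> space M" for w using grisk[OF that] by simp
  have gint: "integrable M (\<lambda>w. indicator {?p..} (R w) :: real)"
    by (rule integrable_const_bound[of _ 1]) auto
  have "integrable M (\<lambda>w. ?f w * indicator {?p..} (R w))"
    by (rule Bochner_Integration.integrable_bound[OF fint]) (use fint in \<open>auto simp: indicator_def\<close>)
  then show "integrable M (\<lambda>w. grisk n l w * (mart j k ?q w - mart j k ?p w))"
    by (subst Bochner_Integration.integrable_cong[OF refl eq])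
  have "expectation (\<lambda>w. grisk n l w * (mart j k ?q w - mart j k ?p w)) =
      expectation (\<lambda>w. ?f w * indicator {?p..} (R w))"
    by (rule Bochner_Integration.integral_cong[OF refl eq])
  also have "\<dots> = expectation ?f * expectation (\<lambda>w. indicator {?p..} (R w))"
    by (rule expectation_completed_filtration_times_R[OF fG fint _ gint]) auto
  also have "expectation ?f = 0" by (rule mart_increment_orthogonal[OF jk _ pq S]) simp
  finally show "expectation (\<lambda>w. grisk n l w * (mart j k ?q w - mart j k ?p w)) = 0" by simp
qed

text \<open>The counterpart of \<open>grid_sum_transition_times\<close> for the compensator.\<close>

lemma grid_sum_cumulative:
  assumes int: "set_integrable lborel {0..real horizon} (path_intensity j k w)"
  shows "(\<Sum>l<horizon * Suc n. grisk n l w * (cumulative j k (grid n (Suc l)) w - cumulative j k (grid n l) w)) =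
    (LINT s|lborel. gstep n w s * path_intensity j k w s)"
    and "integrable lborel (\<lambda>s. gstep n w s * path_intensity j k w s)"
proof -
  let ?c = "\<lambda>l. {grid n l<..grid n (Suc l)}"
  have le: "grid n (Suc l) \<le> real horizon" if "l < horizon * Suc n" for l
    using grid_mono[of "Suc l" "horizon * Suc n" n] that by (simp only: grid_horizon Suc_le_eq)
  have si: "set_integrable lborel A (path_intensity j k w)" if "A \<in> sets lborel" "A \<subseteq> {0..real horizon}" for A
    using set_integrable_subset[OF int that] .
  have c: "set_integrable lborel (?c l) (path_intensity j k w)" if "l < horizon * Suc n" for l
    using le[OF that] grid_nonneg[of n l] by (intro si) (auto simp del: grid_nonneg)
  have inc: "cumulative j k (grid n (Suc l)) w - cumulative j k (grid n l) w = (LINT s:?c l|lborel. path_intensity j k w s)"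
    if l: "l < horizon * Suc n" for l
  proof -
    have "{0..grid n (Suc l)} = {0..grid n l} \<union> ?c l"
      using grid_nonneg[of n l] grid_less_Suc[of n l] by (auto simp del: grid_nonneg grid_less_Suc)
    moreover have "(LINT s:{0..grid n l} \<union> ?c l|lborel. path_intensity j k w s) =
        (LINT s:{0..grid n l}|lborel. path_intensity j k w s) + (LINT s:?c l|lborel. path_intensity j k w s)"
      using le[OF l] grid_less_Suc[of n l]
      by (intro set_integral_Un c[OF l] si) (auto simp del: grid_less_Suc)
    ultimately show ?thesis by (simp add: cumulative_def)
  qed
  have step: "gstep n w s * path_intensity j k w s =
      (\<Sum>l<horizon * Suc n. grisk n l w * (indicator (?c l) s * path_intensity j k w s))" for s
    unfolding grid_step_def sum_distrib_right by (simp only: mult.assoc)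
  have i: "integrable lborel (\<lambda>s. grisk n l w * (indicator (?c l) s * path_intensity j k w s))" if "l < horizon * Suc n" for l
    using c[OF that] by (intro integrable_mult_right) (simp add: set_integrable_def)
  show "integrable lborel (\<lambda>s. gstep n w s * path_intensity j k w s)"
    unfolding step using i by (intro Bochner_Integration.integrable_sum) auto
  have "(LINT s|lborel. gstep n w s * path_intensity j k w s) =
      (\<Sum>l<horizon * Suc n. LINT s|lborel. grisk n l w * (indicator (?c l) s * path_intensity j k w s))"
    unfolding step using i by (intro Bochner_Integration.integral_sum) auto
  also have "\<dots> = (\<Sum>l<horizon * Suc n. grisk n l w * (cumulative j k (grid n (Suc l)) w - cumulative j k (grid n l) w))"
    by (intro sum.cong) (auto simp: inc set_lebesgue_integral_def)
  finally show "(\<Sum>l<horizon * Suc n. grisk n l w * (cumulative j k (grid n (Suc l)) w - cumulative j k (grid n l) w)) =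
    (LINT s|lborel. gstep n w s * path_intensity j k w s)" by simp
qed

lemma left_duration_nonneg:
  assumes "w \<in> space M" "0 < s" shows "0 \<le> left_duration (\<lambda>r. Z r w) s"
proof -
  from jump_path_const_left[OF paths[OF assms(1)] assms(2)] obtain r0 where
    r0: "0 \<le> r0" "r0 < s" "\<And>q. r0 \<le> q \<Longrightarrow> q < s \<Longrightarrow> Z q w = left_state (\<lambda>r. Z r w) s" by blast
  have "Z q w = Z r0 w" if "r0 \<le> q" "q < s" for q
    using r0(3)[of q] r0(3)[of r0] r0(2) that by simp
  then have "left_duration (\<lambda>r. Z r w) s = duration (\<lambda>r. Z r w) r0 + (s - r0)"
    by (intro left_duration_eq[OF r0(1,2)])
  moreover have "\<not> duration (\<lambda>r. Z r w) r0 < 0"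
    using r0(1) by (subst duration_less_iff) auto
  ultimately show ?thesis using r0(2) by simp
qed

lemma path_intensity_nonneg: "w \<in> space M \<Longrightarrow> 0 < s \<Longrightarrow> 0 \<le> path_intensity j k w s"
  unfolding path_intensity_def by (intro mult_nonneg_nonneg intensity_nonneg[OF jk] left_duration_nonneg) auto

text \<open>The discrete stochastic integral of the step function against the compensated jump count.\<close>

definition grid_mart :: "nat \<Rightarrow> 'w \<Rightarrow> real" where
  "grid_mart n w = (\<Sum>l<horizon * Suc n. grisk n l w * (mart j k (grid n (Suc l)) w - mart j k (grid n l) w))"

lemma grid_mart_integrable: "integrable M (grid_mart n)"
  and grid_mart_expectation: "expectation (grid_mart n) = 0"
  unfolding grid_mart_def using grisk_orthogonal
  by (simp_all add: Bochner_Integration.integral_sum)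

lemma grid_mart_eq:
  assumes w: "w \<in> space M" and int: "set_integrable lborel {0..real horizon} (path_intensity j k w)"
  shows "grid_mart n w = (\<Sum>s\<in>transition_times (\<lambda>r. Z r w) j k (real horizon). gstep n w s) -
    (LINT s|lborel. gstep n w s * path_intensity j k w s)"
  unfolding grid_sum_cumulative(1)[OF int, symmetric] grid_sum_transition_times[OF paths[OF w] jk, symmetric]
  by (simp add: grid_mart_def mart_def sum_subtractf[symmetric] algebra_simps)

lemma step_times_path_intensity_bound:
  assumes w: "w \<in> space M"
  shows "AE s in lborel. \<bar>gstep n w s * path_intensity j k w s\<bar> \<le> indicator {0..real horizon} s * path_intensity j k w s"
proof -
  have "AE s in lborel. s \<noteq> (0::real)" by (rule AE_lborel_singleton)
  then show ?thesis
  proof eventually_elim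
    fix s :: real assume "s \<noteq> 0"
    show "\<bar>gstep n w s * path_intensity j k w s\<bar> \<le> indicator {0..real horizon} s * path_intensity j k w s"
    proof (cases "s \<in> {0<..real horizon}")
      case True
      then have "0 \<le> path_intensity j k w s" using path_intensity_nonneg[OF w] by auto
      then show ?thesis using True grid_step_bounds[of j n "\<lambda>r. Z r w" "R w" s]
        by (simp add: abs_mult mult_left_le_one_le)
    next
      case False
      then show ?thesis using \<open>s \<noteq> 0\<close> by (auto simp: grid_step_outside indicator_def)
    qed
  qed
qed

lemma grid_mart_bound:
  assumes w: "w \<in> space M" and int: "set_integrable lborel {0..real horizon} (path_intensity j k w)"
  shows "\<bar>grid_mart n w\<bar> \<le> jump_count (\<lambda>r. Z r w) j k (real horizon) + cumulative j k (real horizon) w"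
proof -
  let ?J = "transition_times (\<lambda>r. Z r w) j k (real horizon)"
  have "\<bar>\<Sum>s\<in>?J. gstep n w s\<bar> \<le> (\<Sum>s\<in>?J. 1)"
    using grid_step_bounds[of j n "\<lambda>r. Z r w" "R w"]
    by (intro order.trans[OF sum_abs] sum_mono) (auto simp: abs_le_iff intro: order.trans[of _ 0])
  then have 1: "\<bar>\<Sum>s\<in>?J. gstep n w s\<bar> \<le> jump_count (\<lambda>r. Z r w) j k (real horizon)"
    by (simp add: jump_count_eq_card)
  have "\<bar>LINT s|lborel. gstep n w s * path_intensity j k w s\<bar> \<le> (LINT s|lborel. \<bar>gstep n w s * path_intensity j k w s\<bar>)"
    by (rule integral_abs_bound)
  also have "\<dots> \<le> (LINT s|lborel. indicator {0..real horizon} s * path_intensity j k w s)"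
    using int grid_sum_cumulative(2)[OF int] step_times_path_intensity_bound[OF w]
    by (intro integral_mono_AE) (auto simp: set_integrable_def)
  also have "\<dots> = cumulative j k (real horizon) w" by (simp add: cumulative_def set_lebesgue_integral_def)
  finally show ?thesis unfolding grid_mart_eq[OF assms] using 1 by linarith
qed

lemma grid_mart_tendsto:
  assumes w: "w \<in> space M" and int: "set_integrable lborel {0..real horizon} (path_intensity j k w)"
  shows "(\<lambda>n. grid_mart n w) \<longlonglongrightarrow> occ w - (LINT s|lborel. risk w s * path_intensity j k w s)"
    and "integrable lborel (\<lambda>s. risk w s * path_intensity j k w s)"
proof -
  have dom: "integrable lborel (\<lambda>s. indicator {0..real horizon} s * path_intensity j k w s)"
    using int by (simp add: set_integrable_def)
  have lim: "AE s in lborel. (\<lambda>n. gstep n w s * path_intensity j k w s) \<longlonglongrightarrow> risk w s * path_intensity j k w s"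
    by (intro AE_I2 tendsto_mult tendsto_const grid_step_tendsto paths w)
  have ms: "(\<lambda>s. gstep n w s * path_intensity j k w s) \<in> borel_measurable lborel" for n
    using grid_sum_cumulative(2)[OF int] by (rule borel_measurable_integrable)
  have ml: "(\<lambda>s. risk w s * path_intensity j k w s) \<in> borel_measurable lborel"
  proof (rule borel_measurable_LIMSEQ_metric)
    show "(\<lambda>s. gstep n w s * path_intensity j k w s) \<in> borel_measurable lborel" for n by (rule ms)
    show "(\<lambda>n. gstep n w s * path_intensity j k w s) \<longlonglongrightarrow> risk w s * path_intensity j k w s" for s
      by (intro tendsto_mult tendsto_const grid_step_tendsto paths w)
  qed
  have bd: "AE s in lborel. norm (gstep n w s * path_intensity j k w s) \<le> indicator {0..real horizon} s * path_intensity j k w s" for n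
    using step_times_path_intensity_bound[OF w, of n] by simp
  have "(\<lambda>n. LINT s|lborel. gstep n w s * path_intensity j k w s) \<longlonglongrightarrow> (LINT s|lborel. risk w s * path_intensity j k w s)"
    by (rule integral_dominated_convergence[OF ml ms dom lim bd])
  moreover have "(\<lambda>n. \<Sum>s\<in>transition_times (\<lambda>r. Z r w) j k (real horizon). gstep n w s) \<longlonglongrightarrow> occ w"
    unfolding occ_eq[OF w] by (intro tendsto_sum grid_step_tendsto paths w)
  ultimately show "(\<lambda>n. grid_mart n w) \<longlonglongrightarrow> occ w - (LINT s|lborel. risk w s * path_intensity j k w s)"
    unfolding grid_mart_eq[OF assms] by (intro tendsto_diff)
  show "integrable lborel (\<lambda>s. risk w s * path_intensity j k w s)"
    by (rule integrable_dominated_convergence[OF ml ms dom lim bd])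
qed

text \<open>The limit of the martingale transforms has mean zero. It equals the occurrence minus the integral
  of the intensity over the time at risk.\<close>

lemma expected_occurrence:
  assumes \<delta>: "\<And>s v. s \<in> {a1..<b1} \<Longrightarrow> v \<in> {a2..<b2} \<Longrightarrow> \<bar>\<mu> j k s v - c\<bar> \<le> \<delta>"
  shows "\<bar>expectation occ - c * expectation expo\<bar> \<le> \<delta> * expectation expo"
proof -
  let ?T = "real horizon"
  have T: "0 \<le> ?T" by simp
  have AEint: "AE w in M. w \<in> space M \<and> set_integrable lborel {0..?T} (path_intensity j k w)"
    using intensity_integrable[OF jk] AE_space by eventually_elim auto
  \<comment> \<open>the limit is known explicitly only almost surely; \<open>lim\<close> is measurable by construction\<close>
  define L where "L w = lim (\<lambda>n. grid_mart n w)" for w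
  have meas: "grid_mart n \<in> borel_measurable M" for n
    using grid_mart_integrable by (rule borel_measurable_integrable)
  have Lm: "L \<in> borel_measurable M" unfolding L_def by (rule borel_measurable_lim_metric[OF meas])
  have dom: "integrable M (\<lambda>w. jump_count (\<lambda>r. Z r w) j k ?T + cumulative j k ?T w)"
    by (intro Bochner_Integration.integrable_add int_count cumulative_integrable jk) auto
  have lim: "AE w in M. (\<lambda>n. grid_mart n w) \<longlonglongrightarrow> L w"
    using AEint by eventually_elim (auto simp: L_def dest: grid_mart_tendsto(1) simp: limI)
  have bd: "AE w in M. norm (grid_mart n w) \<le> jump_count (\<lambda>r. Z r w) j k ?T + cumulative j k ?T w" for n
    using AEint by eventually_elim (auto simp: grid_mart_bound)
  have "(\<lambda>n. expectation (grid_mart n)) \<longlonglongrightarrow> expectation L"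
    by (rule integral_dominated_convergence[OF Lm meas dom lim bd])
  then have L0: "expectation L = 0" by (simp add: grid_mart_expectation LIMSEQ_const_iff)
  have Li: "integrable M L" by (rule integrable_dominated_convergence[OF Lm meas dom lim bd])
  have close: "AE w in M. \<bar>occ w - c * expo w - L w\<bar> \<le> \<delta> * expo w"
    using AEint
  proof eventually_elim
    fix w assume "w \<in> space M \<and> set_integrable lborel {0..?T} (path_intensity j k w)"
    then have w: "w \<in> space M" and int: "set_integrable lborel {0..?T} (path_intensity j k w)" by auto
    note ri = integral_at_risk_bounds(3)[OF paths[OF w], of j "R w"]
    note ai = grid_mart_tendsto(2)[OF w int]
    have L: "L w = occ w - (LINT s|lborel. risk w s * path_intensity j k w s)"
      unfolding L_def by (rule limI[OF grid_mart_tendsto(1)[OF w int]])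
    have "occ w - c * expo w - L w = (LINT s|lborel. risk w s * path_intensity j k w s) - c * (LINT s|lborel. risk w s)"
      unfolding L expo_eq[OF w] by simp
    also have "\<dots> = (LINT s|lborel. risk w s * path_intensity j k w s - c * risk w s)"
      using ri ai by simp
    finally have eq: "occ w - c * expo w - L w = (LINT s|lborel. risk w s * path_intensity j k w s - c * risk w s)" .
    have "\<bar>occ w - c * expo w - L w\<bar> \<le> (LINT s|lborel. \<bar>risk w s * path_intensity j k w s - c * risk w s\<bar>)"
      unfolding eq by (rule integral_abs_bound)
    also have "\<dots> \<le> (LINT s|lborel. \<delta> * risk w s)"
    proof (rule integral_mono)
      show "integrable lborel (\<lambda>s. \<bar>risk w s * path_intensity j k w s - c * risk w s\<bar>)" using ri ai by simp
      show "integrable lborel (\<lambda>s. \<delta> * risk w s)" using ri by simp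
      fix s
      show "\<bar>risk w s * path_intensity j k w s - c * risk w s\<bar> \<le> \<delta> * risk w s"
        using \<delta>[of s "left_duration (\<lambda>r. Z r w) s"] by (auto simp: at_risk_def path_intensity_def)
    qed
    also have "\<dots> = \<delta> * expo w" by (simp add: expo_eq[OF w])
    finally show "\<bar>occ w - c * expo w - L w\<bar> \<le> \<delta> * expo w" .
  qed
  have eq: "expectation occ - c * expectation expo = expectation (\<lambda>w. occ w - c * expo w - L w)"
    using L0 Li occ_integrable expo_integrable by simp
  have "\<bar>expectation occ - c * expectation expo\<bar> \<le> expectation (\<lambda>w. \<bar>occ w - c * expo w - L w\<bar>)"
    unfolding eq by (rule integral_abs_bound)
  also have "\<dots> \<le> expectation (\<lambda>w. \<delta> * expo w)"
    using close Li occ_integrable expo_integrable by (intro integral_mono_AE) auto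
  finally show ?thesis by simp
qed

abbreviation "p \<equiv> censored_prob M Z R j"

lemma expectation_grisk:
  assumes "a1 \<le> grid n (Suc l)" "grid n (Suc l) < b1"
  shows "expectation (grisk n l) = p (grid n l) (b2 - 2 / Suc n) - p (grid n l) (a2 - 2 / Suc n)"
proof -
  let ?E = "\<lambda>v. {w \<in> space M. Z (grid n l) w = j \<and> duration (\<lambda>r. Z r w) (grid n l) \<le> v \<and> grid n l \<le> R w}"
  have [measurable]: "Z (grid n l) \<in> measurable M (count_space UNIV)" by (rule Z_measurable) simp
  have [measurable]: "(\<lambda>w. rat_duration (grid n l) (\<lambda>r. Z r w)) \<in> borel_measurable M"
    by (rule borel_measurable_rat_duration) (auto intro: Z_measurable)
  have E: "?E v = {w \<in> space M. Z (grid n l) w = j \<and> rat_duration (grid n l) (\<lambda>r. Z r w) \<le> v \<and> grid n l \<le> R w}" for v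
    using duration_eq_rat_duration[OF paths] by auto
  have Em: "?E v \<in> events" for v unfolding E by measurable
  have "expectation (grisk n l) = expectation (\<lambda>w. indicator (?E (b2 - 2 / Suc n) - ?E (a2 - 2 / Suc n)) w)"
    unfolding E using assms
    by (intro Bochner_Integration.integral_cong) (auto simp: grid_risk_def indicator_def)
  also have "\<dots> = prob (?E (b2 - 2 / Suc n) - ?E (a2 - 2 / Suc n))"
    by (simp add: Int_absorb2 subset_iff)
  also have "\<dots> = prob (?E (b2 - 2 / Suc n)) - prob (?E (a2 - 2 / Suc n))"
    using cell Em by (intro finite_measure_Diff) auto
  finally show ?thesis by (simp add: censored_prob_def)
qed

lemma gstep_pair_measurable:
  "(\<lambda>(w, s). gstep n w s) \<in> borel_measurable (M \<Otimes>\<^sub>M borel)"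
  by (rule grid_step_pair_measurable) (auto intro: Z_measurable)

text \<open>At a fixed time the left limits of state and duration have the law given by the censored
  occupation probability, by continuity of the latter at the two corners.\<close>

lemma expectation_risk:
  assumes s: "s \<in> {a1..<b1}"
    and cont: "isCont (\<lambda>(s, v). p s v) (s, a2)" "isCont (\<lambda>(s, v). p s v) (s, b2)"
  shows "expectation (\<lambda>w. risk w s) = p s b2 - p s a2"
proof -
  have s0: "0 < s" "s \<le> real horizon" using s cell horizon_ge by auto
  have "\<forall>n. \<exists>l. l < horizon * Suc n \<and> s \<in> {grid n l<..grid n (Suc l)}"
    using grid_cell_exists[OF s0] by metis
  then obtain l where l: "\<And>n. l n < horizon * Suc n" "\<And>n. s \<in> {grid n (l n)<..grid n (Suc (l n))}"
    by metis
  have gm: "(\<lambda>w. gstep n w s) \<in> borel_measurable M" for n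
    unfolding grid_step_eq[OF l(1,2)] by (rule grisk_measurable)
  have lim: "AE w in M. (\<lambda>n. gstep n w s) \<longlonglongrightarrow> risk w s"
    by (intro AE_I2 grid_step_tendsto paths)
  have rm: "(\<lambda>w. risk w s) \<in> borel_measurable M"
    by (rule borel_measurable_LIMSEQ_metric[OF gm grid_step_tendsto[OF paths]])
  have "(\<lambda>n. expectation (\<lambda>w. gstep n w s)) \<longlonglongrightarrow> expectation (\<lambda>w. risk w s)"
    by (rule integral_dominated_convergence[OF rm gm _ lim, of "\<lambda>_. 1"]) (auto simp: grid_step_bounds)
  moreover have "(\<lambda>n. expectation (\<lambda>w. gstep n w s)) \<longlonglongrightarrow> p s b2 - p s a2"
  proof -
    have h: "(\<lambda>n. 1 / real (Suc n)) \<longlonglongrightarrow> 0"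
      using LIMSEQ_inverse_real_of_nat by (simp add: inverse_eq_divide)
    have h2: "(\<lambda>n. b - 2 / real (Suc n)) \<longlonglongrightarrow> b" for b :: real
      using tendsto_diff[OF tendsto_const[of b] tendsto_mult[OF tendsto_const[of 2] h]] by simp
    have gl: "(\<lambda>n. grid n (l n)) \<longlonglongrightarrow> s"
    proof (rule tendsto_sandwich)
      show "eventually (\<lambda>n. s - 1 / real (Suc n) \<le> grid n (l n)) sequentially"
      proof (intro always_eventually allI)
        fix n show "s - 1 / real (Suc n) \<le> grid n (l n)" using l(2)[of n] by (auto simp: grid_Suc)
      qed
      show "eventually (\<lambda>n. grid n (l n) \<le> s) sequentially"
      proof (intro always_eventually allI)
        fix n show "grid n (l n) \<le> s" using l(2)[of n] by auto
      qed
      show "(\<lambda>n. s - 1 / real (Suc n)) \<longlonglongrightarrow> s" using tendsto_diff[OF tendsto_const[of s] h] by simp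
    qed auto
    have pc: "(\<lambda>n. p (grid n (l n)) (b - 2 / real (Suc n))) \<longlonglongrightarrow> p s b"
      if "isCont (\<lambda>(s, v). p s v) (s, b)" for b
      using isCont_tendsto_compose[OF that tendsto_Pair[OF gl h2[of b]]] by simp
    have "eventually (\<lambda>n. p (grid n (l n)) (b2 - 2 / real (Suc n)) - p (grid n (l n)) (a2 - 2 / real (Suc n)) =
        expectation (\<lambda>w. gstep n w s)) sequentially"
    proof -
      have "0 < b1 - s" using s by simp
      from eventually_inverse_Suc_less[OF this] show ?thesis
      proof eventually_elim
        fix n assume n: "1 / real (Suc n) < b1 - s"
        have "a1 \<le> grid n (Suc (l n))" using l(2)[of n] s by auto
        moreover have "grid n (Suc (l n)) < b1" using l(2)[of n] n by (auto simp: grid_Suc)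
        ultimately show "p (grid n (l n)) (b2 - 2 / real (Suc n)) - p (grid n (l n)) (a2 - 2 / real (Suc n)) =
            expectation (\<lambda>w. gstep n w s)"
          unfolding grid_step_eq[OF l(1,2)] by (rule expectation_grisk[symmetric])
      qed
    qed
    then show ?thesis
      by (rule Lim_transform_eventually[OF tendsto_diff[OF pc[OF cont(2)] pc[OF cont(1)]]])
  qed
  ultimately show ?thesis by (rule LIMSEQ_unique)
qed

lemma expected_exposure_bounds:
  assumes cont: "\<And>s v. s \<in> {a1..<b1} \<Longrightarrow> v \<in> {a2, b2} \<Longrightarrow> isCont (\<lambda>(s, v). p s v) (s, v)"
    and lo: "\<And>s. s \<in> {a1..<b1} \<Longrightarrow> lo \<le> p s b2 - p s a2"
    and hi: "\<And>s. s \<in> {a1..<b1} \<Longrightarrow> p s b2 - p s a2 \<le> hi"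
  shows "lo * (b1 - a1) \<le> expectation expo" "expectation expo \<le> hi * (b1 - a1)"
proof -
  interpret PS: pair_sigma_finite M lborel ..
  have rm: "(\<lambda>(w, s). risk w s) \<in> borel_measurable (M \<Otimes>\<^sub>M lborel)"
  proof (rule borel_measurable_LIMSEQ_metric)
    show "(\<lambda>(w, s). gstep n w s) \<in> borel_measurable (M \<Otimes>\<^sub>M lborel)" for n
      using gstep_pair_measurable[of n] by simp
    show "(\<lambda>n. case x of (w, s) \<Rightarrow> gstep n w s) \<longlonglongrightarrow> (case x of (w, s) \<Rightarrow> risk w s)"
      if "x \<in> space (M \<Otimes>\<^sub>M lborel)" for x
      using that by (auto simp: space_pair_measure intro!: grid_step_tendsto paths)
  qed
  have int: "integrable (M \<Otimes>\<^sub>M lborel) (\<lambda>(w, s). risk w s)"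
  proof (rule integrableI_bounded_set[where A = "space M \<times> {a1..<b1}" and B = 1])
    show "emeasure (M \<Otimes>\<^sub>M lborel) (space M \<times> {a1..<b1}) < \<infinity>"
      using cell by (subst lborel.emeasure_pair_measure_Times) (auto simp: emeasure_space_1)
    show "AE x in M \<Otimes>\<^sub>M lborel. x \<in> space M \<times> {a1..<b1} \<longrightarrow> norm (case x of (w, s) \<Rightarrow> risk w s) \<le> 1"
      by (auto simp: at_risk_def)
    show "AE x in M \<Otimes>\<^sub>M lborel. x \<notin> space M \<times> {a1..<b1} \<longrightarrow> (case x of (w, s) \<Rightarrow> risk w s) = 0"
      by (rule AE_I2) (auto simp: space_pair_measure at_risk_def)
  qed (use rm in auto)
  have "expectation expo = (LINT w|M. LINT s|lborel. risk w s)"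
    by (intro Bochner_Integration.integral_cong refl expo_eq)
  also have "\<dots> = (LINT s|lborel. LINT w|M. risk w s)"
    using PS.Fubini_integral[OF int] by simp
  finally have eq: "expectation expo = (LINT s|lborel. expectation (\<lambda>w. risk w s))" .
  have ii: "integrable lborel (\<lambda>s. expectation (\<lambda>w. risk w s))"
    using PS.integrable_snd[OF int] by simp
  have E: "expectation (\<lambda>w. risk w s) = (if s \<in> {a1..<b1} then p s b2 - p s a2 else 0)" for s
  proof (cases "s \<in> {a1..<b1}")
    case True
    then show ?thesis using expectation_risk[OF True cont cont] by simp
  next
    case False
    then show ?thesis by (auto simp: at_risk_outside)
  qed
  have ci: "integrable lborel (\<lambda>s. c * indicator {a1..<b1} s :: real)"
    "(LINT s|lborel. c * indicator {a1..<b1} s) = c * (b1 - a1)" for c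
    using cell by auto
  have "(LINT s|lborel. lo * indicator {a1..<b1} s) \<le> (LINT s|lborel. expectation (\<lambda>w. risk w s))"
    using lo by (intro integral_mono ci ii) (auto simp: E)
  then show "lo * (b1 - a1) \<le> expectation expo" by (simp only: ci eq)
  have "(LINT s|lborel. expectation (\<lambda>w. risk w s)) \<le> (LINT s|lborel. hi * indicator {a1..<b1} s)"
    using hi by (intro integral_mono ci ii) (auto simp: E)
  then show "expectation expo \<le> hi * (b1 - a1)" by (simp only: ci eq)
qed

end

section \<open>A central limit theorem for row-wise iid bounded arrays\<close>

lemma tendsto_of_nat_mult_exp_minus_1:
  fixes L :: complex
  assumes "filterlim N at_top sequentially"
  shows "(\<lambda>n. of_nat (N n) * (exp (L / of_nat (N n)) - 1)) \<longlonglongrightarrow> L"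
proof (cases "L = 0")
  case False
  have pos: "eventually (\<lambda>n. 0 < N n) sequentially"
    using assms eventually_gt_at_top[of 0] by (rule filterlim_iff[THEN iffD1, rule_format])
  have "filterlim (\<lambda>n. of_nat (N n) :: complex) at_infinity sequentially"
    using filterlim_compose[OF tendsto_of_nat assms] by simp
  then have "(\<lambda>n. L / of_nat (N n)) \<longlonglongrightarrow> 0"
    by (rule tendsto_divide_0[OF tendsto_const])
  then have h: "filterlim (\<lambda>n. L / of_nat (N n)) (at 0) sequentially"
    unfolding filterlim_at using pos False by (auto elim!: eventually_mono)
  have "((\<lambda>h::complex. (exp (0 + h) - exp 0) / h) \<longlongrightarrow> exp 0) (at 0)"
    using DERIV_exp[of "0::complex"] unfolding DERIV_def .
  from filterlim_compose[OF this h]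
  have "(\<lambda>n. (exp (L / of_nat (N n)) - 1) / (L / of_nat (N n))) \<longlonglongrightarrow> 1" by simp
  from tendsto_mult[OF tendsto_const[of L] this]
  have "(\<lambda>n. L * ((exp (L / of_nat (N n)) - 1) / (L / of_nat (N n)))) \<longlonglongrightarrow> L" by simp
  moreover have "L * ((exp (L / of_nat (N n)) - 1) / (L / of_nat (N n))) =
      of_nat (N n) * (exp (L / of_nat (N n)) - 1)" for n
    using False by (simp add: mult.commute)
  ultimately show ?thesis by simp
qed simp

text \<open>The second-order expansion of the characteristic function has an error of third order, and the
  shrinking bound \<open>c n\<close> controls the third moment by the second. The powers are compared with those of
  \<open>exp (L / N n)\<close>, where \<open>L\<close> is the exponent of the limit; this number also lies in the unit disc.\<close>

lemma char_power_tendsto: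
  fixes \<L> :: "nat \<Rightarrow> real measure" and s m v :: real
  assumes L: "\<And>n. real_distribution (\<L> n)" and N: "filterlim N at_top sequentially"
    and bnd: "\<And>n. AE x in \<L> n. \<bar>x\<bar> \<le> c n" and c: "c \<longlonglongrightarrow> 0"
    and mean: "(\<lambda>n. real (N n) * (LINT x|\<L> n. x)) \<longlonglongrightarrow> m"
    and var: "(\<lambda>n. real (N n) * (LINT x|\<L> n. x\<^sup>2)) \<longlonglongrightarrow> v" and v: "0 < v"
  shows "(\<lambda>n. char (\<L> n) s ^ N n) \<longlonglongrightarrow> exp (\<i> * s * m - s\<^sup>2 * v / 2)"
proof -
  define L where "L = \<i> * complex_of_real s * complex_of_real m - (complex_of_real s)\<^sup>2 * complex_of_real v / 2"
  have approx: "cmod (char (\<L> n) s - (1 + \<i> * s * (LINT x|\<L> n. x) - s\<^sup>2 / 2 * (LINT x|\<L> n. x\<^sup>2)))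
      \<le> \<bar>s\<bar> ^ 3 / 6 * (c n * (LINT x|\<L> n. x\<^sup>2))" for n
  proof -
    interpret real_distribution "\<L> n" by (rule L)
    have int: "integrable (\<L> n) (\<lambda>x. x ^ i)" for i :: nat
    proof (rule integrable_const_bound[of _ "\<bar>c n\<bar> ^ i"])
      show "AE x in \<L> n. norm (x ^ i) \<le> \<bar>c n\<bar> ^ i"
        using bnd[of n] by eventually_elim (auto simp: power_abs intro!: power_mono)
    qed simp
    have approx2: "cmod (char (\<L> n) s - (\<Sum>i\<le>2. (\<i> * s) ^ i / fact i * expectation (\<lambda>x. x ^ i)))
      \<le> \<bar>s\<bar>\<^sup>2 / fact (Suc 2) * expectation (\<lambda>x. min (2 * \<bar>x\<bar>\<^sup>2 * real (Suc 2)) (\<bar>s\<bar> * \<bar>x\<bar> ^ Suc 2))"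
      by (rule char_approx2[OF int])
    have taylor: "(\<Sum>i\<le>2. (\<i> * s) ^ i / fact i * expectation (\<lambda>x. x ^ i)) =
      1 + \<i> * s * expectation (\<lambda>x. x) - s\<^sup>2 / 2 * expectation (\<lambda>x. x\<^sup>2)"
      using prob_space by (simp add: numeral_2_eq_2 power_mult_distrib)
    have "expectation (\<lambda>x. min (2 * \<bar>x\<bar>\<^sup>2 * real (Suc 2)) (\<bar>s\<bar> * \<bar>x\<bar> ^ Suc 2)) \<le>
      expectation (\<lambda>x. \<bar>s\<bar> * (c n * x\<^sup>2))" (is "?Em \<le> _")
    proof (rule integral_mono_AE)
      have "integrable (\<L> n) (\<lambda>x. \<bar>s\<bar> * \<bar>x ^ 3\<bar>)" by (intro integrable_mult_right integrable_abs int)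
      then show "integrable (\<L> n) (\<lambda>x. min (2 * \<bar>x\<bar>\<^sup>2 * real (Suc 2)) (\<bar>s\<bar> * \<bar>x\<bar> ^ Suc 2))"
      proof (rule Bochner_Integration.integrable_bound)
        have "norm (min (2 * \<bar>x\<bar>\<^sup>2 * real (Suc 2)) (\<bar>s\<bar> * \<bar>x\<bar> ^ Suc 2)) \<le> norm (\<bar>s\<bar> * \<bar>x ^ 3\<bar>)" for x
        proof -
          have "0 \<le> min (2 * \<bar>x\<bar>\<^sup>2 * real (Suc 2)) (\<bar>s\<bar> * \<bar>x\<bar> ^ Suc 2)" by simp
          moreover have "\<bar>s\<bar> * \<bar>x\<bar> ^ Suc 2 = norm (\<bar>s\<bar> * \<bar>x ^ 3\<bar>)"
            by (simp add: abs_mult power_abs eval_nat_numeral)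
          ultimately show ?thesis by (metis abs_of_nonneg min.cobounded2 real_norm_def)
        qed
        then show "AE x in \<L> n. norm (min (2 * \<bar>x\<bar>\<^sup>2 * real (Suc 2)) (\<bar>s\<bar> * \<bar>x\<bar> ^ Suc 2)) \<le>
            norm (\<bar>s\<bar> * \<bar>x ^ 3\<bar>)" by simp
      qed simp
      show "integrable (\<L> n) (\<lambda>x. \<bar>s\<bar> * (c n * x\<^sup>2))"
        by (intro integrable_mult_right int)
      show "AE x in \<L> n. min (2 * \<bar>x\<bar>\<^sup>2 * real (Suc 2)) (\<bar>s\<bar> * \<bar>x\<bar> ^ Suc 2) \<le> \<bar>s\<bar> * (c n * x\<^sup>2)"
        using bnd[of n]
      proof eventually_elim
        fix x assume "\<bar>x\<bar> \<le> c n"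
        then have "\<bar>x\<bar> * x\<^sup>2 \<le> c n * x\<^sup>2" by (intro mult_right_mono) auto
        then have "\<bar>s\<bar> * (\<bar>x\<bar> * x\<^sup>2) \<le> \<bar>s\<bar> * (c n * x\<^sup>2)" by (intro mult_left_mono) auto
        moreover have "\<bar>x\<bar> ^ Suc 2 = \<bar>x\<bar> * x\<^sup>2" by (simp add: eval_nat_numeral)
        ultimately show "min (2 * \<bar>x\<bar>\<^sup>2 * real (Suc 2)) (\<bar>s\<bar> * \<bar>x\<bar> ^ Suc 2) \<le> \<bar>s\<bar> * (c n * x\<^sup>2)"
          by (metis min.coboundedI2)
      qed
    qed
    then have rest: "\<bar>s\<bar>\<^sup>2 / fact (Suc 2) * ?Em \<le> \<bar>s\<bar>\<^sup>2 / fact (Suc 2) * (\<bar>s\<bar> * (c n * expectation (\<lambda>x. x\<^sup>2)))"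
      by (intro mult_left_mono) auto
    have rest_eq: "\<bar>s\<bar>\<^sup>2 / fact (Suc 2) * (\<bar>s\<bar> * (c n * expectation (\<lambda>x. x\<^sup>2))) =
        \<bar>s\<bar> ^ 3 / 6 * (c n * expectation (\<lambda>x. x\<^sup>2))"
      by (simp add: fact_numeral eval_nat_numeral)
    show ?thesis
      using order.trans[OF approx2[unfolded taylor] rest] unfolding rest_eq .
  qed
  let ?r = "\<lambda>n. char (\<L> n) s - (1 + \<i> * s * (LINT x|\<L> n. x) - s\<^sup>2 / 2 * (LINT x|\<L> n. x\<^sup>2))"
  have "(\<lambda>n. of_nat (N n) * ?r n) \<longlonglongrightarrow> 0"
  proof (rule Lim_null_comparison)
    show "eventually (\<lambda>n. norm (of_nat (N n) * ?r n) \<le>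
        \<bar>s\<bar> ^ 3 / 6 * (c n * (real (N n) * (LINT x|\<L> n. x\<^sup>2)))) sequentially"
    proof (intro always_eventually allI)
      fix n
      have "norm (of_nat (N n) * ?r n) = real (N n) * cmod (?r n)" by (simp add: norm_mult)
      also have "\<dots> \<le> real (N n) * (\<bar>s\<bar> ^ 3 / 6 * (c n * (LINT x|\<L> n. x\<^sup>2)))"
        by (intro mult_left_mono approx) auto
      finally show "norm (of_nat (N n) * ?r n) \<le>
        \<bar>s\<bar> ^ 3 / 6 * (c n * (real (N n) * (LINT x|\<L> n. x\<^sup>2)))" by (simp add: mult_ac)
    qed
    have "(\<lambda>n. \<bar>s\<bar> ^ 3 / 6 * (c n * (real (N n) * (LINT x|\<L> n. x\<^sup>2)))) \<longlonglongrightarrow> \<bar>s\<bar> ^ 3 / 6 * (0 * v)"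
      by (intro tendsto_intros c var)
    then show "(\<lambda>n. \<bar>s\<bar> ^ 3 / 6 * (c n * (real (N n) * (LINT x|\<L> n. x\<^sup>2)))) \<longlonglongrightarrow> 0" by simp
  qed
  moreover have "(\<lambda>n. \<i> * s * of_real (real (N n) * (LINT x|\<L> n. x)) -
      s\<^sup>2 / 2 * of_real (real (N n) * (LINT x|\<L> n. x\<^sup>2))) \<longlonglongrightarrow> \<i> * s * of_real m - s\<^sup>2 / 2 * of_real v"
    by (intro tendsto_intros mean var)
  ultimately have "(\<lambda>n. of_nat (N n) * ?r n + (\<i> * s * of_real (real (N n) * (LINT x|\<L> n. x)) -
      s\<^sup>2 / 2 * of_real (real (N n) * (LINT x|\<L> n. x\<^sup>2)))) \<longlonglongrightarrow> 0 + (\<i> * s * of_real m - s\<^sup>2 / 2 * of_real v)"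
    by (rule tendsto_add)
  moreover have "of_nat (N n) * ?r n + (\<i> * s * of_real (real (N n) * (LINT x|\<L> n. x)) -
      s\<^sup>2 / 2 * of_real (real (N n) * (LINT x|\<L> n. x\<^sup>2))) = of_nat (N n) * (char (\<L> n) s - 1)" for n
    by (simp add: algebra_simps)
  ultimately have "(\<lambda>n. of_nat (N n) * (char (\<L> n) s - 1)) \<longlonglongrightarrow> L" by (simp add: L_def)
  from tendsto_diff[OF this tendsto_of_nat_mult_exp_minus_1[OF N, of L]]
  have diff: "(\<lambda>n. of_nat (N n) * (char (\<L> n) s - exp (L / of_nat (N n)))) \<longlonglongrightarrow> 0"
    by (simp add: algebra_simps)
  have "(\<lambda>n. char (\<L> n) s ^ N n - exp (L / of_nat (N n)) ^ N n) \<longlonglongrightarrow> 0"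
  proof (rule Lim_null_comparison[OF always_eventually tendsto_norm_zero[OF diff]], rule allI)
    fix n
    have "cmod (exp (L / of_nat (N n))) \<le> 1"
      using v by (simp add: norm_exp_eq_Re L_def Re_divide_of_nat mult_nonneg_nonneg)
    moreover have "cmod (char (\<L> n) s) \<le> 1"
      by (rule real_distribution.cmod_char_le_1[OF L])
    ultimately show "norm (char (\<L> n) s ^ N n - exp (L / of_nat (N n)) ^ N n) \<le>
        norm (of_nat (N n) * (char (\<L> n) s - exp (L / of_nat (N n))))"
      unfolding norm_mult norm_of_nat by (intro norm_power_diff)
  qed
  moreover have "eventually (\<lambda>n. exp (L / of_nat (N n)) ^ N n = exp L) sequentially"
  proof -
    have "eventually (\<lambda>n. 0 < N n) sequentially" using N eventually_gt_at_top[of 0] by (rule filterlim_iff[THEN iffD1, rule_format])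
    then show ?thesis by eventually_elim (simp add: exp_of_nat_mult[symmetric])
  qed
  then have "(\<lambda>n. exp (L / of_nat (N n)) ^ N n) \<longlonglongrightarrow> exp L" by (rule tendsto_eventually)
  ultimately have "(\<lambda>n. (char (\<L> n) s ^ N n - exp (L / of_nat (N n)) ^ N n) + exp (L / of_nat (N n)) ^ N n)
      \<longlonglongrightarrow> 0 + exp L" by (rule tendsto_add)
  then show ?thesis by (simp add: L_def)
qed

lemma isCont_cdf_std_normal: "isCont (cdf std_normal_distribution) x"
proof -
  interpret real_distribution std_normal_distribution by (rule real_dist_normal_dist)
  have "emeasure std_normal_distribution {x} = 0"
    by (subst emeasure_density) (auto intro!: nn_integral_null_set)
  then show ?thesis by (simp add: isCont_cdf measure_def)
qed

text \<open>The means need not vanish; their total \<open>m\<close> shifts the limit. A bound that tends to zero replaces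
  the Lindeberg condition.\<close>

lemma triangular_array_clt:
  fixes X :: "nat \<Rightarrow> nat \<Rightarrow> 'v \<Rightarrow> real" and \<L> :: "nat \<Rightarrow> real measure"
  assumes P: "prob_space P"
    and indep: "\<And>n. prob_space.indep_vars P (\<lambda>_. borel) (X n) {1..N n}"
    and law: "\<And>n i. i \<in> {1..N n} \<Longrightarrow> distr P borel (X n i) = \<L> n"
    and L: "\<And>n. real_distribution (\<L> n)" and N: "filterlim N at_top sequentially"
    and bnd: "\<And>n. AE x in \<L> n. \<bar>x\<bar> \<le> c n" and c: "c \<longlonglongrightarrow> 0"
    and mean: "(\<lambda>n. real (N n) * (LINT x|\<L> n. x)) \<longlonglongrightarrow> m"
    and var: "(\<lambda>n. real (N n) * (LINT x|\<L> n. x\<^sup>2)) \<longlonglongrightarrow> v" and v: "0 < v"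
  shows "(\<lambda>n. measure P {w \<in> space P. (\<Sum>i=1..N n. X n i w) \<le> y})
    \<longlonglongrightarrow> cdf std_normal_distribution ((y - m) / sqrt v)"
proof -
  interpret prob_space P by (rule P)
  have Xm: "X n i \<in> borel_measurable P" if "i \<in> {1..N n}" for n i
    using indep[of n] that unfolding indep_vars_def by auto
  define S where "S n w = (\<Sum>i=1..N n. X n i w)" for n w
  have [measurable]: "S n \<in> borel_measurable P" for n
    unfolding S_def using Xm by (intro borel_measurable_sum) auto
  define T where "T n w = (S n w - m) / sqrt v" for n w
  have [measurable]: "T n \<in> borel_measurable P" for n unfolding T_def by measurable
  have sq: "sqrt v \<noteq> 0" "0 < sqrt v" using v by auto
  have "weak_conv_m (\<lambda>n. distr P borel (T n)) std_normal_distribution"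
  proof (rule levy_continuity)
    show "real_distribution (distr P borel (T n))" for n by (rule real_distribution_distr) measurable
    show "real_distribution std_normal_distribution" by (rule real_dist_normal_dist)
    fix \<theta> :: real
    define s where "s = \<theta> / sqrt v"
    have ch: "char (distr P borel (T n)) \<theta> = iexp (- s * m) * char (\<L> n) s ^ N n" for n
    proof -
      have "char (distr P borel (T n)) \<theta> = (CLINT w|P. iexp (\<theta> * T n w))"
        unfolding char_def by (rule integral_distr) auto
      also have "\<dots> = (CLINT w|P. iexp (- s * m) * iexp (s * S n w))"
      proof (intro Bochner_Integration.integral_cong refl)
        fix w
        have "\<theta> * T n w = - s * m + s * S n w" by (simp add: T_def s_def diff_divide_distrib right_diff_distrib)
        then show "iexp (\<theta> * T n w) = iexp (- s * m) * iexp (s * S n w)"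
          by (simp only: exp_add[symmetric] of_real_add distrib_left)
      qed
      also have "\<dots> = iexp (- s * m) * (CLINT w|P. iexp (s * S n w))"
        by (rule integral_mult_right_zero)
      also have "(CLINT w|P. iexp (s * S n w)) = char (distr P borel (S n)) s"
        unfolding char_def by (rule integral_distr[symmetric]) auto
      also have "\<dots> = (\<Prod>i\<in>{1..N n}. char (distr P borel (X n i)) s)"
        using char_distr_sum[OF indep[of n], of s] by (simp add: S_def[abs_def])
      also have "\<dots> = char (\<L> n) s ^ N n" by (simp add: law)
      finally show ?thesis .
    qed
    have "(\<lambda>n. iexp (- s * m) * char (\<L> n) s ^ N n) \<longlonglongrightarrow> iexp (- s * m) * exp (\<i> * s * m - s\<^sup>2 * v / 2)"
      by (intro tendsto_mult tendsto_const char_power_tendsto[OF L N bnd c mean var v])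
    also have "iexp (- s * m) * exp (\<i> * s * m - s\<^sup>2 * v / 2) = exp (- (s\<^sup>2 * v / 2))"
      by (simp add: exp_add[symmetric] flip: exp_of_real)
    also have "exp (- (s\<^sup>2 * v / 2)) = char std_normal_distribution \<theta>"
    proof -
      have "s\<^sup>2 * v = \<theta>\<^sup>2" using v by (simp add: s_def power_divide)
      then have "complex_of_real s ^ 2 * complex_of_real v = complex_of_real (\<theta>\<^sup>2)"
        by (metis of_real_mult of_real_power)
      then show ?thesis by (simp add: char_std_normal_distribution exp_of_real[symmetric])
    qed
    finally show "(\<lambda>n. char (distr P borel (T n)) \<theta>) \<longlonglongrightarrow> char std_normal_distribution \<theta>"
      unfolding ch .
  qed
  then have "(\<lambda>n. cdf (distr P borel (T n)) ((y - m) / sqrt v)) \<longlonglongrightarrow>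
      cdf std_normal_distribution ((y - m) / sqrt v)"
    unfolding weak_conv_m_def weak_conv_def using isCont_cdf_std_normal by blast
  moreover have "cdf (distr P borel (T n)) ((y - m) / sqrt v) = measure P {w \<in> space P. S n w \<le> y}" for n
  proof -
    have "cdf (distr P borel (T n)) ((y - m) / sqrt v) = measure P (T n -` {..(y - m) / sqrt v} \<inter> space P)"
      unfolding cdf_def by (rule measure_distr) auto
    also have "T n -` {..(y - m) / sqrt v} \<inter> space P = {w \<in> space P. S n w \<le> y}"
      using sq by (auto simp: T_def divide_le_cancel)
    finally show ?thesis .
  qed
  ultimately show ?thesis by (simp add: S_def)
qed

lemma cdf_normal_density:
  assumes "0 < \<sigma>"
  shows "cdf (density lborel (normal_density 0 \<sigma>)) x = cdf std_normal_distribution (x / \<sigma>)"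
proof -
  let ?D = "density lborel (normal_density 0 \<sigma>)"
  interpret prob_space ?D by (rule prob_space_normal_density[OF assms])
  have "distributed ?D lborel (\<lambda>x. x) (normal_density 0 \<sigma>)"
    unfolding distributed_def by (auto simp: distr_id2)
  then have "distributed ?D lborel (\<lambda>x. (x - 0) / \<sigma>) std_normal_density"
    by (rule normal_standard_normal_convert[OF assms, THEN iffD1])
  then have eq: "distr ?D lborel (\<lambda>x. x / \<sigma>) = std_normal_distribution"
    unfolding distributed_def by simp
  have "cdf std_normal_distribution (x / \<sigma>) = measure (distr ?D lborel (\<lambda>x. x / \<sigma>)) {..x / \<sigma>}"
    by (simp add: cdf_def eq)
  also have "\<dots> = measure ?D ((\<lambda>x. x / \<sigma>) -` {..x / \<sigma>} \<inter> space ?D)"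
    by (rule measure_distr) auto
  also have "(\<lambda>x. x / \<sigma>) -` {..x / \<sigma>} \<inter> space ?D = {..x}"
    using assms by (auto simp: divide_le_cancel)
  finally show ?thesis by (simp add: cdf_def)
qed

section \<open>Ratios of iid sums\<close>

text \<open>The numerators have values in \<open>{0, 1}\<close> and the denominators are small, so that the sum of
  \<open>num - (c + y / s n) * den\<close>, divided by \<open>s n\<close>, has asymptotic mean \<open>- y * q\<close> and asymptotic variance
  \<open>c * q\<close>. The events \<open>A n y\<close> that this sum is not positive have limiting probability \<open>F y\<close>. They
  contain the event of interest for \<open>y = x\<close>, and conversely, except where the sum of the denominators
  vanishes. If it vanishes and \<open>A n x\<close> fails, then the sum of the numerators is positive, and \<open>A n y\<close>
  fails for every \<open>y\<close>. Since \<open>F y\<close> tends to one, this exceptional event is negligible.\<close>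

lemma ratio_clt:
  fixes Y :: "nat \<Rightarrow> 'v \<Rightarrow> 'a" and S :: "'a measure" and W :: "'w \<Rightarrow> 'a"
    and num den :: "nat \<Rightarrow> 'a \<Rightarrow> real" and N :: "nat \<Rightarrow> nat" and d r s :: "nat \<Rightarrow> real" and c q x :: real
  assumes P: "prob_space P" and M: "prob_space M"
    and indep: "prob_space.indep_vars P (\<lambda>_. S) Y {1..}"
    and law: "\<And>i. 1 \<le> i \<Longrightarrow> distr P S (Y i) = distr M S W" and W[measurable]: "W \<in> measurable M S"
    and om[measurable]: "\<And>n. num n \<in> borel_measurable S" and em[measurable]: "\<And>n. den n \<in> borel_measurable S"
    and o01: "\<And>n w. w \<in> space M \<Longrightarrow> num n (W w) \<in> {0, 1}"
    and e0: "\<And>n w. w \<in> space M \<Longrightarrow> 0 \<le> den n (W w)" and ed: "\<And>n w. w \<in> space M \<Longrightarrow> den n (W w) \<le> d n"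
    and eP: "\<And>n i w. 1 \<le> i \<Longrightarrow> w \<in> space P \<Longrightarrow> 0 \<le> den n (Y i w)"
    and d: "d \<longlonglongrightarrow> 0" and N: "filterlim N at_top sequentially" and r: "\<And>n. 0 < r n"
    and s: "\<And>n. s n = sqrt (real (N n) * r n)" and s_top: "filterlim s at_top sequentially"
    and mean_e: "(\<lambda>n. (LINT w|M. den n (W w)) / r n) \<longlonglongrightarrow> q" and q: "0 < q" and c: "0 < c"
    and bias: "(\<lambda>n. s n * (((LINT w|M. num n (W w)) - c * (LINT w|M. den n (W w))) / r n)) \<longlonglongrightarrow> 0"
  shows "(\<lambda>n. measure P {w \<in> space P. s n * ((\<Sum>i=1..N n. num n (Y i w)) / (\<Sum>i=1..N n. den n (Y i w)) - c) \<le> x})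
    \<longlonglongrightarrow> cdf std_normal_distribution (x * sqrt (q / c))"
proof -
  interpret P: prob_space P by (rule P)
  interpret M: prob_space M by (rule M)
  define eo where "eo n = (LINT w|M. num n (W w))" for n
  define ee where "ee n = (LINT w|M. den n (W w))" for n
  define A where "A n y = {w \<in> space P. (\<Sum>i=1..N n. num n (Y i w)) - (c + y / s n) * (\<Sum>i=1..N n. den n (Y i w)) \<le> 0}" for n y
  define F where "F y = cdf std_normal_distribution (y * sqrt (q / c))" for y
  have Ym: "Y i \<in> measurable P S" if "1 \<le> i" for i
    using indep that unfolding P.indep_vars_def by auto
  have s_pos: "eventually (\<lambda>n. 0 < s n) sequentially"
    using s_top eventually_gt_at_top[of 0] by (rule filterlim_iff[THEN iffD1, rule_format])
  have inv_s: "(\<lambda>n. y / s n) \<longlonglongrightarrow> 0" for y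
    by (rule tendsto_divide_0[OF tendsto_const filterlim_at_top_imp_at_infinity[OF s_top]])
  have mean_ee: "(\<lambda>n. ee n / r n) \<longlonglongrightarrow> q" using mean_e by (simp add: ee_def)
  have bias': "(\<lambda>n. s n * ((eo n - c * ee n) / r n)) \<longlonglongrightarrow> 0" using bias by (simp add: eo_def ee_def)
  have mean_eo: "(\<lambda>n. eo n / r n) \<longlonglongrightarrow> c * q"
  proof -
    have "(\<lambda>n. 1 / s n * (s n * ((eo n - c * ee n) / r n)) + c * (ee n / r n)) \<longlonglongrightarrow> 0 * 0 + c * q"
      by (intro tendsto_intros inv_s bias' mean_ee)
    moreover have "eventually (\<lambda>n. 1 / s n * (s n * ((eo n - c * ee n) / r n)) + c * (ee n / r n) = eo n / r n) sequentially"
      using s_pos by eventually_elim (simp add: diff_divide_distrib)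
    ultimately show ?thesis by (auto elim: Lim_transform_eventually)
  qed
  have A: "(\<lambda>n. measure P (A n y)) \<longlonglongrightarrow> F y" for y
  proof -
    define c' where "c' n = c + y / s n" for n
    have c': "c' \<longlonglongrightarrow> c" using tendsto_add[OF tendsto_const[of c] inv_s[of y]] by (simp add: c'_def[abs_def])
    define \<xi> where "\<xi> n a = (num n a - c' n * den n a) / s n" for n a
    have \<xi>m[measurable]: "\<xi> n \<in> borel_measurable S" for n unfolding \<xi>_def by measurable
    define L where "L n = distr M borel (\<lambda>w. \<xi> n (W w))" for n
    have L: "real_distribution (L n)" for n unfolding L_def by (rule M.real_distribution_distr) measurable
    have intL: "(LINT x|L n. g x) = (LINT w|M. g (\<xi> n (W w)))" if "g \<in> borel_measurable borel" for n and g :: "real \<Rightarrow> real"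
      unfolding L_def by (rule integral_distr) (use that in measurable)
    have oi: "integrable M (\<lambda>w. num n (W w))" for n
      by (rule M.integrable_const_bound[of _ 1]) (use o01[of _ n] in \<open>force intro!: AE_I2\<close>)+
    have ei: "integrable M (\<lambda>w. den n (W w))" for n
      by (rule M.integrable_const_bound[of _ "d n"]) (use e0[of _ n] ed[of _ n] in \<open>auto intro!: AE_I2\<close>)
    have oei: "integrable M (\<lambda>w. num n (W w) * den n (W w))" for n
      by (rule Bochner_Integration.integrable_bound[OF ei[of n]])
         (use o01[of _ n] e0[of _ n] in \<open>force intro!: AE_I2\<close>)+
    have d0: "0 \<le> d n" for n
    proof -
      obtain w where "w \<in> space M" using M.not_empty by blast
      then show ?thesis using e0[of w n] ed[of w n] by simp
    qed
    have eei: "integrable M (\<lambda>w. (den n (W w))\<^sup>2)" for n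
      by (rule M.integrable_const_bound[of _ "(d n)\<^sup>2"])
         (use e0[of _ n] ed[of _ n] in \<open>auto intro!: AE_I2 power_mono\<close>)
    have oe: "0 \<le> (LINT w|M. num n (W w) * den n (W w))" "(LINT w|M. num n (W w) * den n (W w)) \<le> d n * eo n" for n
    proof -
      have *: "0 \<le> num n (W w) * den n (W w)" "num n (W w) * den n (W w) \<le> d n * num n (W w)" if "w \<in> space M" for w
        using o01[OF that, of n] e0[OF that, of n] ed[OF that, of n] by auto
      show "0 \<le> (LINT w|M. num n (W w) * den n (W w))"
        using * by (intro integral_nonneg_AE AE_I2)
      have "(LINT w|M. num n (W w) * den n (W w)) \<le> (LINT w|M. d n * num n (W w))"
        using * oi oei by (intro integral_mono) auto
      then show "(LINT w|M. num n (W w) * den n (W w)) \<le> d n * eo n" by (simp add: eo_def)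
    qed
    have e2: "0 \<le> (LINT w|M. (den n (W w))\<^sup>2)" "(LINT w|M. (den n (W w))\<^sup>2) \<le> d n * ee n" for n
    proof -
      have "(LINT w|M. (den n (W w))\<^sup>2) \<le> (LINT w|M. d n * den n (W w))"
        using e0 ed ei eei by (intro integral_mono) (auto simp: power2_eq_square intro!: mult_right_mono)
      then show "(LINT w|M. (den n (W w))\<^sup>2) \<le> d n * ee n" by (simp add: ee_def)
    qed simp
    have m1: "(LINT x|L n. x) = (eo n - c' n * ee n) / s n" for n
      using oi[of n] ei[of n] by (subst intL) (auto simp: \<xi>_def eo_def ee_def)
    have m2: "(LINT x|L n. x\<^sup>2) = (eo n - 2 * c' n * (LINT w|M. num n (W w) * den n (W w)) +
        (c' n)\<^sup>2 * (LINT w|M. (den n (W w))\<^sup>2)) / (s n)\<^sup>2" for n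
    proof -
      have "(LINT x|L n. x\<^sup>2) = (LINT w|M. (\<xi> n (W w))\<^sup>2)" by (rule intL) measurable
      also have "\<dots> = (LINT w|M. (num n (W w) - 2 * c' n * (num n (W w) * den n (W w)) + (c' n)\<^sup>2 * (den n (W w))\<^sup>2) / (s n)\<^sup>2)"
      proof (intro Bochner_Integration.integral_cong refl)
        fix w assume "w \<in> space M"
        then have "(num n (W w))\<^sup>2 = num n (W w)" using o01[of w n] by auto
        then show "(\<xi> n (W w))\<^sup>2 = (num n (W w) - 2 * c' n * (num n (W w) * den n (W w)) + (c' n)\<^sup>2 * (den n (W w))\<^sup>2) / (s n)\<^sup>2"
          by (simp add: \<xi>_def power_divide power2_diff power_mult_distrib)
      qed
      also have "\<dots> = (eo n - 2 * c' n * (LINT w|M. num n (W w) * den n (W w)) +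
        (c' n)\<^sup>2 * (LINT w|M. (den n (W w))\<^sup>2)) / (s n)\<^sup>2"
        using oi[of n] oei[of n] eei[of n] by (simp add: eo_def)
      finally show ?thesis .
    qed
    have Ns: "real (N n) = (s n)\<^sup>2 / r n" for n using r[of n] by (simp add: s)
    have "(\<lambda>n. measure P {w \<in> space P. (\<Sum>i=1..N n. \<xi> n (Y i w)) \<le> 0}) \<longlonglongrightarrow>
        cdf std_normal_distribution ((0 - (- y * q)) / sqrt (c * q))"
    proof (rule triangular_array_clt[OF P])
      show "P.indep_vars (\<lambda>_. borel) (\<lambda>i w. \<xi> n (Y i w)) {1..N n}" for n
        by (rule P.indep_vars_compose2[OF P.indep_vars_subset[OF indep]]) (auto simp: \<xi>m)
      show "distr P borel (\<lambda>w. \<xi> n (Y i w)) = L n" if "i \<in> {1..N n}" for n i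
      proof -
        have i: "1 \<le> i" using that by simp
        have "distr P borel (\<lambda>w. \<xi> n (Y i w)) = distr (distr P S (Y i)) borel (\<xi> n)"
          using Ym[OF i] by (simp add: distr_distr comp_def)
        also have "\<dots> = L n" unfolding law[OF i] L_def by (simp add: distr_distr comp_def)
        finally show ?thesis .
      qed
      show "real_distribution (L n)" for n by (rule L)
      show "filterlim N at_top sequentially" by (rule N)
      show "AE x in L n. \<bar>x\<bar> \<le> (1 + \<bar>c' n\<bar> * d n) / s n" for n
      proof -
        have "AE w in M. \<bar>\<xi> n (W w)\<bar> \<le> (1 + \<bar>c' n\<bar> * d n) / s n"
        proof (rule AE_I2)
          fix w assume w: "w \<in> space M"
          have "\<bar>num n (W w) - c' n * den n (W w)\<bar> \<le> \<bar>num n (W w)\<bar> + \<bar>c' n * den n (W w)\<bar>" by (rule abs_triangle_ineq4)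
          also have "\<dots> \<le> 1 + \<bar>c' n\<bar> * d n"
            using o01[OF w, of n] e0[OF w, of n] ed[OF w, of n] unfolding abs_mult
            by (intro add_mono mult_left_mono) auto
          finally show "\<bar>\<xi> n (W w)\<bar> \<le> (1 + \<bar>c' n\<bar> * d n) / s n"
            using r[of n] by (auto simp: \<xi>_def s intro!: divide_right_mono)
        qed
        then show ?thesis unfolding L_def by (subst AE_distr_iff) auto
      qed
      show "(\<lambda>n. (1 + \<bar>c' n\<bar> * d n) / s n) \<longlonglongrightarrow> 0"
      proof -
        have "(\<lambda>n. (1 + \<bar>c' n\<bar> * d n) * (1 / s n)) \<longlonglongrightarrow> (1 + \<bar>c\<bar> * 0) * 0"
          by (intro tendsto_intros c' d inv_s)
        then show ?thesis by simp
      qed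
      show "(\<lambda>n. real (N n) * (LINT x|L n. x)) \<longlonglongrightarrow> - y * q"
      proof -
        have "(\<lambda>n. s n * ((eo n - c * ee n) / r n) - y * (ee n / r n)) \<longlonglongrightarrow> 0 - y * q"
          by (intro tendsto_intros bias' mean_ee)
        moreover have "eventually (\<lambda>n. s n * ((eo n - c * ee n) / r n) - y * (ee n / r n) =
            real (N n) * (LINT x|L n. x)) sequentially"
          using s_pos
        proof eventually_elim
          fix n assume "0 < s n"
          then show "s n * ((eo n - c * ee n) / r n) - y * (ee n / r n) = real (N n) * (LINT x|L n. x)"
            using r[of n] unfolding Ns m1 c'_def by (simp add: field_simps power2_eq_square)
        qed
        ultimately show ?thesis by (auto elim: Lim_transform_eventually)
      qed
      show "(\<lambda>n. real (N n) * (LINT x|L n. x\<^sup>2)) \<longlonglongrightarrow> c * q"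
      proof -
        define u1 where "u1 n = (LINT w|M. num n (W w) * den n (W w)) / r n" for n
        define u2 where "u2 n = (LINT w|M. (den n (W w))\<^sup>2) / r n" for n
        have "u1 \<longlonglongrightarrow> 0"
        proof (rule tendsto_sandwich)
          show "eventually (\<lambda>n. 0 \<le> u1 n) sequentially" using oe(1) r by (simp add: u1_def less_imp_le)
          show "eventually (\<lambda>n. u1 n \<le> d n * (eo n / r n)) sequentially"
            using oe(2) r by (simp add: u1_def divide_right_mono less_imp_le)
          show "(\<lambda>n. d n * (eo n / r n)) \<longlonglongrightarrow> 0" using tendsto_mult[OF d mean_eo] by simp
        qed simp
        moreover have "u2 \<longlonglongrightarrow> 0"
        proof (rule tendsto_sandwich)
          show "eventually (\<lambda>n. 0 \<le> u2 n) sequentially" using e2(1) r by (simp add: u2_def less_imp_le)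
          show "eventually (\<lambda>n. u2 n \<le> d n * (ee n / r n)) sequentially"
            using e2(2) r by (simp add: u2_def divide_right_mono less_imp_le)
          show "(\<lambda>n. d n * (ee n / r n)) \<longlonglongrightarrow> 0" using tendsto_mult[OF d mean_ee] by simp
        qed simp
        ultimately have "(\<lambda>n. eo n / r n - 2 * c' n * u1 n + (c' n)\<^sup>2 * u2 n) \<longlonglongrightarrow> c * q - 2 * c * 0 + c\<^sup>2 * 0"
          by (intro tendsto_intros mean_eo c')
        moreover have "eventually (\<lambda>n. eo n / r n - 2 * c' n * u1 n + (c' n)\<^sup>2 * u2 n =
            real (N n) * (LINT x|L n. x\<^sup>2)) sequentially"
          using s_pos
        proof eventually_elim
          fix n assume sn: "0 < s n"
          have cancel: "(s n)\<^sup>2 / r n * (a / (s n)\<^sup>2) = a / r n" for a using sn by simp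
          show "eo n / r n - 2 * c' n * u1 n + (c' n)\<^sup>2 * u2 n = real (N n) * (LINT x|L n. x\<^sup>2)"
            unfolding Ns m2 cancel u1_def u2_def by (simp add: add_divide_distrib diff_divide_distrib)
        qed
        ultimately show ?thesis by (auto elim: Lim_transform_eventually)
      qed
      show "0 < c * q" using c q by simp
    qed
    moreover have "(0 - (- y * q)) / sqrt (c * q) = y * sqrt (q / c)"
    proof -
      have "q = sqrt q * sqrt q" using q by simp
      then have *: "q / sqrt (c * q) = sqrt q / sqrt c"
        using q c by (simp add: real_sqrt_mult field_simps)
      have "(0 - (- y * q)) / sqrt (c * q) = y * (q / sqrt (c * q))" by simp
      then show ?thesis unfolding * by (simp add: real_sqrt_divide)
    qed
    moreover have "eventually (\<lambda>n. measure P {w \<in> space P. (\<Sum>i=1..N n. \<xi> n (Y i w)) \<le> 0} = measure P (A n y)) sequentially"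
      using s_pos
    proof eventually_elim
      fix n assume sn: "0 < s n"
      have "(\<Sum>i=1..N n. \<xi> n (Y i w)) = ((\<Sum>i=1..N n. num n (Y i w)) - c' n * (\<Sum>i=1..N n. den n (Y i w))) / s n" for w
        by (simp add: \<xi>_def sum_divide_distrib[symmetric] sum_subtractf sum_distrib_left)
      then show "measure P {w \<in> space P. (\<Sum>i=1..N n. \<xi> n (Y i w)) \<le> 0} = measure P (A n y)"
        using sn by (simp add: A_def c'_def divide_le_0_iff)
    qed
    ultimately show ?thesis unfolding F_def by (auto elim: Lim_transform_eventually)
  qed
  have Om: "(\<lambda>w. \<Sum>i=1..N n. num n (Y i w)) \<in> borel_measurable P" for n
    by (intro borel_measurable_sum measurable_compose[OF Ym om]) auto
  have Em: "(\<lambda>w. \<Sum>i=1..N n. den n (Y i w)) \<in> borel_measurable P" for n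
    by (intro borel_measurable_sum measurable_compose[OF Ym em]) auto
  have Am: "A n y \<in> P.events" for n y
    using Om[of n] Em[of n] unfolding A_def by measurable
  let ?B = "\<lambda>n. {w \<in> space P. s n * ((\<Sum>i=1..N n. num n (Y i w)) / (\<Sum>i=1..N n. den n (Y i w)) - c) \<le> x}"
  have Bm: "?B n \<in> P.events" for n
    using Om[of n] Em[of n] by measurable
  have E0: "0 \<le> (\<Sum>i=1..N n. den n (Y i w))" if "w \<in> space P" for n w
    using that by (intro sum_nonneg eP) auto
  have iff: "w \<in> ?B n \<longleftrightarrow> w \<in> A n x"
    if "0 < s n" "w \<in> space P" "0 < (\<Sum>i=1..N n. den n (Y i w))" for n w
  proof -
    have "s n * (o' / e' - c) \<le> x \<longleftrightarrow> o' - (c + x / s n) * e' \<le> 0" if "0 < e'" for o' e'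
    proof -
      have "s n * (o' / e' - c) \<le> x \<longleftrightarrow> o' / e' - c \<le> x / s n"
        using \<open>0 < s n\<close> by (simp add: le_divide_eq mult.commute)
      also have "\<dots> \<longleftrightarrow> o' / e' \<le> c + x / s n" by auto
      also have "\<dots> \<longleftrightarrow> o' \<le> (c + x / s n) * e'" using that by (simp add: divide_le_eq)
      finally show ?thesis by simp
    qed
    then show ?thesis using that unfolding A_def by simp
  qed
  \<comment> \<open>a vanishing denominator gives the quotient 0 and the deviation \<open>- s n * c\<close>, which lies below \<open>x\<close>\<close>
  have large: "eventually (\<lambda>n. - x \<le> s n * c) sequentially"
  proof -
    have "eventually (\<lambda>n. - x / c \<le> s n) sequentially"
      using s_top by (simp add: filterlim_at_top)
    then show ?thesis by eventually_elim (simp only: pos_divide_le_eq[OF c])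
  qed
  have lower: "eventually (\<lambda>n. measure P (A n x) \<le> measure P (?B n)) sequentially"
    using s_pos large
  proof eventually_elim
    fix n assume n: "0 < s n" "- x \<le> s n * c"
    have "A n x \<subseteq> ?B n"
    proof
      fix w assume w: "w \<in> A n x"
      then have wP: "w \<in> space P" by (simp add: A_def)
      show "w \<in> ?B n"
      proof (cases "0 < (\<Sum>i=1..N n. den n (Y i w))")
        case True
        then show ?thesis using iff[OF n(1) wP] w by blast
      next
        case False
        then have "(\<Sum>i=1..N n. den n (Y i w)) = 0" using E0[OF wP, of n] by linarith
        then show ?thesis using wP n by simp
      qed
    qed
    then show "measure P (A n x) \<le> measure P (?B n)" by (intro P.finite_measure_mono Bm)
  qed
  have upper: "eventually (\<lambda>n. measure P (?B n) \<le> measure P (A n x) + (1 - measure P (A n y))) sequentially" for y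
    using s_pos
  proof eventually_elim
    fix n assume n: "0 < s n"
    have "?B n \<subseteq> A n x \<union> (space P - A n y)"
    proof
      fix w assume w: "w \<in> ?B n"
      then have wP: "w \<in> space P" by simp
      show "w \<in> A n x \<union> (space P - A n y)"
      proof (cases "0 < (\<Sum>i=1..N n. den n (Y i w))")
        case True
        then show ?thesis using iff[OF n wP] w by blast
      next
        case False
        then have "(\<Sum>i=1..N n. den n (Y i w)) = 0" using E0[OF wP, of n] by linarith
        then show ?thesis using wP by (auto simp: A_def)
      qed
    qed
    then have "measure P (?B n) \<le> measure P (A n x \<union> (space P - A n y))"
      using Am by (intro P.finite_measure_mono) auto
    also have "\<dots> \<le> measure P (A n x) + measure P (space P - A n y)"
      using Am by (intro measure_Un_le) auto
    also have "measure P (space P - A n y) = 1 - measure P (A n y)" using Am by (rule P.prob_compl)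
    finally show "measure P (?B n) \<le> measure P (A n x) + (1 - measure P (A n y))" .
  qed
  have F1: "(F \<longlongrightarrow> 1) at_top"
  proof -
    have "filterlim (\<lambda>y. y * sqrt (q / c)) at_top at_top"
      using q c by (intro filterlim_at_top_mult_tendsto_pos[OF tendsto_const _ filterlim_ident]) auto
    from filterlim_compose[OF real_distribution.cdf_lim_at_top_prob[OF real_dist_normal_dist] this]
    show ?thesis by (simp add: F_def[abs_def])
  qed
  have "(\<lambda>n. measure P (?B n)) \<longlonglongrightarrow> F x"
  proof (rule order_tendstoI)
    fix a assume "a < F x"
    then have "eventually (\<lambda>n. a < measure P (A n x)) sequentially" by (rule order_tendstoD(1)[OF A])
    with lower show "eventually (\<lambda>n. a < measure P (?B n)) sequentially"
      by eventually_elim linarith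
  next
    fix a assume a: "F x < a"
    then have "1 - (a - F x) < 1" by simp
    from order_tendstoD(1)[OF F1 this] obtain y where "1 - (a - F x) < F y"
      by (metis eventually_happens' trivial_limit_at_top_linorder)
    then have "F x + (1 - F y) < a" by simp
    moreover have "(\<lambda>n. measure P (A n x) + (1 - measure P (A n y))) \<longlonglongrightarrow> F x + (1 - F y)"
      by (intro tendsto_intros A)
    ultimately have "eventually (\<lambda>n. measure P (A n x) + (1 - measure P (A n y)) < a) sequentially"
      using order_tendstoD(2) by blast
    with upper[of y] show "eventually (\<lambda>n. measure P (?B n) < a) sequentially"
      by eventually_elim linarith
  qed
  then show ?thesis by (simp add: F_def)
qed

section \<open>Local consequences of differentiability\<close>

lemma dist_Pair_le: "dist (s, v) (t, u) \<le> \<bar>s - t\<bar> + \<bar>v - u\<bar>" for s v t u :: real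
  using sqrt_sum_squares_le_sum_abs[of "s - t" "v - u"] by (simp add: dist_Pair_Pair dist_real_def)

lemma C2_near_local_lipschitz:
  fixes f :: "real \<Rightarrow> real \<Rightarrow> real"
  assumes "C2_near (\<lambda>(s, v). f s v) (t, u)"
  obtains \<rho> K where "0 < \<rho>" "0 < K"
    "\<And>s v. \<bar>s - t\<bar> < \<rho> \<Longrightarrow> \<bar>v - u\<bar> < \<rho> \<Longrightarrow> \<bar>f s v - f t u\<bar> \<le> K * (\<bar>s - t\<bar> + \<bar>v - u\<bar>)"
proof -
  obtain D :: "(real \<times> real) \<Rightarrow>\<^sub>L real" where D: "((\<lambda>(s, v). f s v) has_derivative blinfun_apply D) (at (t, u))"
    using assms unfolding C2_near_def by blast
  then obtain e where e: "0 < e" "\<And>y. norm (y - (t, u)) < e \<Longrightarrow>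
      norm ((case y of (s, v) \<Rightarrow> f s v) - f t u - D (y - (t, u))) \<le> 1 * norm (y - (t, u))"
    unfolding has_derivative_at_alt by (force dest: spec[of _ "1::real"])
  show thesis
  proof (rule that[of "e / 2" "norm D + 1"])
    fix s v assume sv: "\<bar>s - t\<bar> < e / 2" "\<bar>v - u\<bar> < e / 2"
    have le: "norm ((s, v) - (t, u)) \<le> \<bar>s - t\<bar> + \<bar>v - u\<bar>"
      using dist_Pair_le[of s v t u] by (simp add: dist_norm)
    then have "norm ((s, v) - (t, u)) < e" using sv by linarith
    from e(2)[OF this] have "\<bar>f s v - f t u - D ((s, v) - (t, u))\<bar> \<le> norm ((s, v) - (t, u))" by simp
    moreover have "\<bar>D ((s, v) - (t, u))\<bar> \<le> norm D * norm ((s, v) - (t, u))"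
      using norm_blinfun[of D "(s, v) - (t, u)"] by simp
    ultimately have "\<bar>f s v - f t u\<bar> \<le> (norm D + 1) * norm ((s, v) - (t, u))"
      unfolding distrib_right by linarith
    also have "\<dots> \<le> (norm D + 1) * (\<bar>s - t\<bar> + \<bar>v - u\<bar>)" by (intro mult_left_mono le) auto
    finally show "\<bar>f s v - f t u\<bar> \<le> (norm D + 1) * (\<bar>s - t\<bar> + \<bar>v - u\<bar>)" .
  qed (use e(1) in \<open>auto intro: add_nonneg_pos\<close>)
qed

text \<open>The mean value theorem in the second variable, with a derivative that is close to its value at
  \<open>(t, u)\<close> by continuity.\<close>

lemma C2_near_partial_increments:
  fixes f :: "real \<Rightarrow> real \<Rightarrow> real"
  assumes "C2_near (\<lambda>(s, v). f s v) (t, u)" and \<epsilon>: "0 < \<epsilon>"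
  obtains \<rho> where "0 < \<rho>"
    "\<And>s v. \<bar>s - t\<bar> < \<rho> \<Longrightarrow> \<bar>v - u\<bar> < \<rho> \<Longrightarrow> isCont (\<lambda>(s, v). f s v) (s, v)"
    "\<And>s v v'. \<bar>s - t\<bar> < \<rho> \<Longrightarrow> \<bar>v - u\<bar> < \<rho> \<Longrightarrow> \<bar>v' - u\<bar> < \<rho> \<Longrightarrow> v < v' \<Longrightarrow>
      \<bar>f s v' - f s v - deriv (f t) u * (v' - v)\<bar> \<le> \<epsilon> * (v' - v)"
proof -
  obtain S and D :: "real \<times> real \<Rightarrow> ((real \<times> real) \<Rightarrow>\<^sub>L real)" and D2 where S: "open S" "(t, u) \<in> S"
    and D: "\<And>y. y \<in> S \<Longrightarrow> ((\<lambda>(s, v). f s v) has_derivative blinfun_apply (D y)) (at y)"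
    and D2: "\<And>y. y \<in> S \<Longrightarrow> (D has_derivative blinfun_apply (D2 y)) (at y)"
    using assms(1) unfolding C2_near_def by blast
  have der: "((f s) has_real_derivative D (s, v) (0, 1)) (at v)" if "(s, v) \<in> S" for s v
  proof -
    have "((\<lambda>v. (s, v)) has_derivative (\<lambda>h. (0, h))) (at v)"
      by (intro has_derivative_Pair has_derivative_const has_derivative_ident)
    from has_derivative_compose[OF this D[OF that]]
    have "(f s has_derivative (\<lambda>h. D (s, v) (0, h))) (at v)" by simp
    moreover have "(\<lambda>h. D (s, v) (0, h)) = (*) (D (s, v) (0, 1))"
    proof
      fix h :: real
      have "D (s, v) (h *\<^sub>R (0, 1)) = h *\<^sub>R D (s, v) (0, 1)" by (rule blinfun.scaleR_right)
      then show "D (s, v) (0, h) = D (s, v) (0, 1) * h" by simp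
    qed
    ultimately show ?thesis by (simp add: has_field_derivative_def)
  qed
  have q: "deriv (f t) u = D (t, u) (0, 1)" by (rule DERIV_imp_deriv[OF der[OF S(2)]])
  have "isCont D (t, u)" using D2[OF S(2)] by (rule has_derivative_continuous)
  then have "isCont (\<lambda>y. D y (0, 1)) (t, u)" by (intro continuous_intros)
  then obtain e1 where e1: "0 < e1" "\<And>y. dist y (t, u) < e1 \<Longrightarrow> dist (D y (0, 1)) (D (t, u) (0, 1)) < \<epsilon>"
    unfolding continuous_at_eps_delta using \<epsilon> by (metis dist_commute)
  obtain e2 where e2: "0 < e2" "ball (t, u) e2 \<subseteq> S" using S by (meson open_contains_ball)
  define \<rho> where "\<rho> = min e1 e2 / 2"
  have \<rho>: "0 < \<rho>" using e1 e2 by (simp add: \<rho>_def)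
  have near: "dist (s, v) (t, u) < e1" "(s, v) \<in> S" if "\<bar>s - t\<bar> < \<rho>" "\<bar>v - u\<bar> < \<rho>" for s v
  proof -
    have "dist (s, v) (t, u) < min e1 e2"
      using dist_Pair_le[of s v t u] that unfolding \<rho>_def by linarith
    then show "dist (s, v) (t, u) < e1" "(s, v) \<in> S" using e2(2) by (auto simp: dist_commute)
  qed
  show thesis
  proof (rule that[OF \<rho>])
    fix s v assume "\<bar>s - t\<bar> < \<rho>" "\<bar>v - u\<bar> < \<rho>"
    then show "isCont (\<lambda>(s, v). f s v) (s, v)"
      using D[OF near(2)] by (intro has_derivative_continuous)
  next
    fix s v v' assume h: "\<bar>s - t\<bar> < \<rho>" "\<bar>v - u\<bar> < \<rho>" "\<bar>v' - u\<bar> < \<rho>" "v < v'"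
    have btw: "\<bar>z - u\<bar> < \<rho>" if "v \<le> z" "z \<le> v'" for z using h that by linarith
    obtain z where z: "v < z" "z < v'" "f s v' - f s v = (v' - v) * D (s, z) (0, 1)"
      using MVT2[OF h(4), of "f s" "\<lambda>z. D (s, z) (0, 1)"] der near(2)[OF h(1) btw] by blast
    have "\<bar>D (s, z) (0, 1) - deriv (f t) u\<bar> \<le> \<epsilon>"
      using e1(2)[OF near(1)[OF h(1) btw[of z]]] z unfolding q by (simp add: dist_real_def)
    then have "\<bar>D (s, z) (0, 1) - deriv (f t) u\<bar> * (v' - v) \<le> \<epsilon> * (v' - v)"
      using h(4) by (intro mult_right_mono) auto
    moreover have "f s v' - f s v - deriv (f t) u * (v' - v) = (D (s, z) (0, 1) - deriv (f t) u) * (v' - v)"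
      unfolding z(3) by (simp add: algebra_simps)
    ultimately show "\<bar>f s v' - f s v - deriv (f t) u * (v' - v)\<bar> \<le> \<epsilon> * (v' - v)"
      using h(4) by (simp add: abs_mult)
  qed
qed

lemma censored_prob_negative_duration: "0 \<le> s \<Longrightarrow> v < 0 \<Longrightarrow> censored_prob M Z R j s v = 0"
proof -
  assume s: "0 \<le> s" and v: "v < 0"
  have "\<not> duration (\<lambda>r. Z r w) s \<le> v" for w
  proof -
    have "\<not> duration (\<lambda>r. Z r w) s < 0" using s by (subst duration_less_iff) auto
    then show ?thesis using v by linarith
  qed
  then have "{w \<in> space M. Z s w = j \<and> duration (\<lambda>r. Z r w) s \<le> v \<and> s \<le> R w} = {}"
    by simp
  then show ?thesis by (simp only: censored_prob_def measure_empty)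
qed

section \<open>Asymptotic normality of the occurrence/exposure rate\<close>

lemma (in observed_cell) occurrence_eq_fun:
  assumes "jump_path x"
  shows "(LINT s:{0<..r}|interval_measure (jump_count x j k).
      indicator {a1..<b1} s * indicator {a2..<b2} (left_duration x s)) =
    occurrence_fun j k (restrict x {0..}) r"
  using occurrence_integral_eq[OF assms jk] occurrence_fun_eq[OF assms jk] by simp

lemma (in observed_cell) exposure_eq_fun:
  assumes "jump_path x"
  shows "(LINT s:{0..r}|lborel. indicator {a1..<b1} s * indicator {a2..<b2} (left_duration x s) *
     indicator {s. left_state x s = j} s) = exposure_fun j (restrict x {0..}) r"
  using exposure_integral_eq[of r x j] exposure_fun_eq[OF assms, of j r] by simp

lemma (in observed_cell) exposure_fun_nonneg:
  "jump_path x \<Longrightarrow> 0 \<le> exposure_fun j (restrict x {0..}) r"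
  using exposure_fun_eq[of x j r] integral_at_risk_bounds(1)[of x j r] by simp

theorem theorem3p1:
  fixes M :: "'w measure" and F :: "real \<Rightarrow> 'w measure"
    and Z :: "real \<Rightarrow> 'w \<Rightarrow> 'z::finite" and R :: "'w \<Rightarrow> real"
    and \<mu> :: "'z \<Rightarrow> 'z \<Rightarrow> real \<Rightarrow> real \<Rightarrow> real"
    and P :: "'v measure" and Zs :: "nat \<Rightarrow> real \<Rightarrow> 'v \<Rightarrow> 'z" and Rs :: "nat \<Rightarrow> 'v \<Rightarrow> real"
    and \<tau> \<upsilon> :: "nat \<Rightarrow> nat \<Rightarrow> real" and m1 m2 :: "nat \<Rightarrow> nat" and \<Delta>1 \<Delta>2 :: "nat \<Rightarrow> real"
    and j k :: 'z and t u :: real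
  assumes "prob_space M" and "usual_filtration M F"
    and "adapted_process F (count_space UNIV) Z"
    and "\<And>w. w \<in> space M \<Longrightarrow> jump_path (\<lambda>s. Z s w)"
    and "\<And>a b r. a \<noteq> b \<Longrightarrow> 0 \<le> r \<Longrightarrow> integrable M (\<lambda>w. jump_count (\<lambda>s. Z s w) a b r)"
    and "semi_markov_process M Z \<mu>"
    and "\<And>w. w \<in> space M \<Longrightarrow> 0 \<le> R w"
    and "independent_rvs M path_space (random_path Z) borel R"
    and "prob_space P" and "iid_copies P Zs Rs M Z R"
    and "\<And>n. axis_partition (\<tau> n)" and "\<And>n. axis_partition (\<upsilon> n)"
    and "j \<noteq> k" and "0 \<le> u" and "u < t"
    and "0 < \<mu> j k t u"
    and "\<And>r. 0 \<le> r \<Longrightarrow> integrable M (\<lambda>w. jump_count (\<lambda>s. Z s w) j k r ^ 4)"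
    and "\<And>n. 1 \<le> m1 n" and "\<And>n. 1 \<le> m2 n"
    and "\<And>n. t \<in> {\<tau> n (m1 n - 1)..<\<tau> n (m1 n)}"
    and "\<And>n. u \<in> {\<upsilon> n (m2 n - 1)..<\<upsilon> n (m2 n)}"
    and "\<And>n. \<Delta>1 n = \<tau> n (m1 n) - \<tau> n (m1 n - 1)"
    and "\<And>n. \<Delta>2 n = \<upsilon> n (m2 n) - \<upsilon> n (m2 n - 1)"
    and "C2_near (\<lambda>(s, v). censored_prob M Z R j s v) (t, u)"
    and "C2_near (\<lambda>(s, v). \<mu> j k s v) (t, u)"
    and "0 < deriv (\<lambda>v. censored_prob M Z R j t v) u"
    and "\<Delta>1 \<longlonglongrightarrow> 0" and "\<Delta>2 \<longlonglongrightarrow> 0"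
    and "filterlim (\<lambda>n. real n * \<Delta>1 n * \<Delta>2 n) at_top sequentially"
    and "(\<lambda>n. real n * \<Delta>1 n * \<Delta>2 n ^ 3) \<longlonglongrightarrow> 0"
    and "(\<lambda>n. real n * \<Delta>1 n ^ 3 * \<Delta>2 n) \<longlonglongrightarrow> 0"
  shows "weak_conv_m
    (\<lambda>n. distr P borel (\<lambda>w. sqrt (real n * \<Delta>1 n * \<Delta>2 n) *
       (oe_rate Zs Rs j k n (\<tau> n) (\<upsilon> n) (m1 n) (m2 n) w - \<mu> j k t u)))
    (density lborel (normal_density 0
       (sqrt (\<mu> j k t u / deriv (\<lambda>v. censored_prob M Z R j t v) u))))"
proof -
  define p where "p = censored_prob M Z R j"
  define q where "q = deriv (\<lambda>v. censored_prob M Z R j t v) u"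
  define c where "c = \<mu> j k t u"
  define a1 where "a1 n = \<tau> n (m1 n - 1)" for n
  define b1 where "b1 n = \<tau> n (m1 n)" for n
  define a2 where "a2 n = \<upsilon> n (m2 n - 1)" for n
  define b2 where "b2 n = \<upsilon> n (m2 n)" for n
  have c: "0 < c" and q: "0 < q" using assms(16,26) by (auto simp: c_def q_def)
  have q_eq: "q = deriv (p t) u" by (simp add: q_def p_def)
  have C2p: "C2_near (\<lambda>(s, v). p s v) (t, u)" using assms(24) by (simp add: p_def)
  have ab: "a1 n \<le> t" "t < b1 n" "a2 n \<le> u" "u < b2 n" "\<Delta>1 n = b1 n - a1 n" "\<Delta>2 n = b2 n - a2 n" for n
    using assms(20)[of n] assms(21)[of n] assms(22)[of n] assms(23)[of n]
    by (auto simp: a1_def b1_def a2_def b2_def)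
  have t0: "0 < t" using assms(14,15) by simp
  have csm: "censored_semi_markov M Z R \<mu>"
    using assms(1,4,5,6,8)
    by (auto simp: censored_semi_markov_def censored_semi_markov_axioms_def semi_markov_process_def)
  \<comment> \<open>at \<open>u = 0\<close> the occupation probability vanishes to the left, against its positive derivative\<close>
  have u0: "0 < u"
  proof (rule ccontr)
    assume "\<not> 0 < u"
    then have u: "u = 0" using assms(14) by simp
    have "0 < q / 2" using q by simp
    from C2_near_partial_increments[OF C2p this] obtain \<rho> where \<rho>: "0 < \<rho>"
      "\<And>s v v'. \<bar>s - t\<bar> < \<rho> \<Longrightarrow> \<bar>v - u\<bar> < \<rho> \<Longrightarrow> \<bar>v' - u\<bar> < \<rho> \<Longrightarrow> v < v' \<Longrightarrow>
        \<bar>p s v' - p s v - deriv (p t) u * (v' - v)\<bar> \<le> q / 2 * (v' - v)" by metis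
    have "p t (- \<rho> / 2) = 0" "p t (- \<rho> / 4) = 0"
      using \<rho>(1) t0 by (auto simp: p_def intro!: censored_prob_negative_duration)
    moreover have "\<bar>p t (- \<rho> / 4) - p t (- \<rho> / 2) - deriv (p t) u * (- \<rho> / 4 - - \<rho> / 2)\<bar>
        \<le> q / 2 * (- \<rho> / 4 - - \<rho> / 2)"
      using \<rho>(1) u by (intro \<rho>(2)) auto
    ultimately have "q * (\<rho> / 4) \<le> q / 2 * (\<rho> / 4)" using q \<rho>(1) by (simp add: q_eq[symmetric] abs_mult)
    then show False using q \<rho>(1) by simp
  qed
  obtain \<rho> K where \<rho>: "0 < \<rho>" and K: "0 < K"
    and lip: "\<And>s v. \<bar>s - t\<bar> < \<rho> \<Longrightarrow> \<bar>v - u\<bar> < \<rho> \<Longrightarrow> \<bar>\<mu> j k s v - c\<bar> \<le> K * (\<bar>s - t\<bar> + \<bar>v - u\<bar>)"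
    using C2_near_local_lipschitz[OF assms(25)] unfolding c_def by metis
  \<comment> \<open>side lengths below \<open>\<eta>\<close> keep the cell away from the axes, make it shorter in time than its smallest
    duration, and keep it within reach of the Lipschitz bound\<close>
  define \<eta> where "\<eta> = Min {t, u / 2, \<rho>}"
  have \<eta>: "0 < \<eta>" "\<eta> \<le> t" "\<eta> \<le> u / 2" "\<eta> \<le> \<rho>"
    using t0 u0 \<rho> by (auto simp: \<eta>_def)
  have "eventually (\<lambda>n. \<Delta>1 n < \<eta> \<and> \<Delta>2 n < \<eta>) sequentially"
    using order_tendstoD(2)[OF assms(27) \<eta>(1)] order_tendstoD(2)[OF assms(28) \<eta>(1)]
    by eventually_elim simp
  then obtain n0 where n0: "\<And>n. n0 \<le> n \<Longrightarrow> \<Delta>1 n < \<eta>" "\<And>n. n0 \<le> n \<Longrightarrow> \<Delta>2 n < \<eta>"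
    by (auto simp: eventually_sequentially)
  have oc: "observed_cell M Z R \<mu> (a1 n) (b1 n) (a2 n) (b2 n) j k" if "n0 \<le> n" for n
  proof -
    have "lexis_cell (a1 n) (b1 n) (a2 n) (b2 n)"
      using n0[OF that] \<eta> ab[of n] u0 by unfold_locales linarith+
    moreover have "b1 n - a1 n \<le> a2 n" using n0[OF that] \<eta> ab[of n] by linarith
    ultimately show ?thesis
      using csm assms(13) by (simp add: observed_cell_def observed_cell_axioms_def)
  qed
  define W where "W w = (random_path Z w, R w)" for w
  define Y where "Y i w = (random_path (Zs i) w, Rs i w)" for i w
  define num where "num n = (\<lambda>(x, r). lexis_cell.occurrence_fun (a1 n) (b1 n) (a2 n) (b2 n) j k x r)" for n
  define den where "den n = (\<lambda>(x, r). lexis_cell.exposure_fun (a1 n) (b1 n) (a2 n) (b2 n) j x r)" for n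
  let ?S = "path_space \<Otimes>\<^sub>M borel :: ((real \<Rightarrow> 'z) \<times> real) measure"
  have Wm: "W \<in> measurable M ?S"
  proof -
    interpret C: censored_semi_markov M Z R \<mu> by (rule csm)
    show ?thesis unfolding W_def by measurable
  qed
  have Om: "num n \<in> borel_measurable ?S" and Em: "den n \<in> borel_measurable ?S"
    and o01: "w \<in> space M \<Longrightarrow> num n (W w) \<in> {0, 1}"
    and e0: "w \<in> space M \<Longrightarrow> 0 \<le> den n (W w)" and ed: "w \<in> space M \<Longrightarrow> den n (W w) \<le> \<Delta>1 n"
    and bias: "\<bar>(LINT w|M. num n (W w)) - c * (LINT w|M. den n (W w))\<bar> \<le> K * (\<Delta>1 n + \<Delta>2 n) * (LINT w|M. den n (W w))"
    if n: "n0 \<le> n" for n w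
  proof -
    interpret C: observed_cell M Z R \<mu> "a1 n" "b1 n" "a2 n" "b2 n" j k by (rule oc[OF n])
    show "num n \<in> borel_measurable ?S" unfolding num_def by (rule C.occurrence_fun_measurable)
    show "den n \<in> borel_measurable ?S" unfolding den_def by (rule C.exposure_fun_measurable)
    have OW: "num n (W w) = C.occ w" and EW: "den n (W w) = C.expo w" for w
      by (simp_all add: num_def den_def W_def C.occ_def C.expo_def)
    show "w \<in> space M \<Longrightarrow> num n (W w) \<in> {0, 1}" unfolding OW by (rule C.occ_01)
    show "w \<in> space M \<Longrightarrow> 0 \<le> den n (W w)" unfolding EW by (rule C.expo_bounds)
    show "w \<in> space M \<Longrightarrow> den n (W w) \<le> \<Delta>1 n" unfolding EW ab by (rule C.expo_bounds)
    show "\<bar>(LINT w|M. num n (W w)) - c * (LINT w|M. den n (W w))\<bar> \<le> K * (\<Delta>1 n + \<Delta>2 n) * (LINT w|M. den n (W w))"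
      unfolding OW EW
    proof (rule C.expected_occurrence)
      fix s v assume "s \<in> {a1 n..<b1 n}" "v \<in> {a2 n..<b2 n}"
      then have sv: "\<bar>s - t\<bar> \<le> \<Delta>1 n" "\<bar>v - u\<bar> \<le> \<Delta>2 n" using ab[of n] by auto
      then have "\<bar>\<mu> j k s v - c\<bar> \<le> K * (\<bar>s - t\<bar> + \<bar>v - u\<bar>)"
        using n0[OF n] \<eta> by (intro lip) linarith+
      also have "\<dots> \<le> K * (\<Delta>1 n + \<Delta>2 n)" using sv K by (intro mult_left_mono) auto
      finally show "\<bar>\<mu> j k s v - c\<bar> \<le> K * (\<Delta>1 n + \<Delta>2 n)" .
    qed
  qed
  have \<Delta>: "0 < \<Delta>1 n" "0 < \<Delta>2 n" for n using ab[of n] by auto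
  have mean_e: "(\<lambda>n. (LINT w|M. den n (W w)) / (\<Delta>1 n * \<Delta>2 n)) \<longlonglongrightarrow> q"
  proof (rule tendstoI)
    fix e :: real assume "0 < e"
    then have "0 < e / 2" by simp
    from C2_near_partial_increments[OF C2p this] obtain \<rho>' where \<rho>': "0 < \<rho>'"
      and cont: "\<And>s v. \<bar>s - t\<bar> < \<rho>' \<Longrightarrow> \<bar>v - u\<bar> < \<rho>' \<Longrightarrow> isCont (\<lambda>(s, v). p s v) (s, v)"
      and incr: "\<And>s v v'. \<bar>s - t\<bar> < \<rho>' \<Longrightarrow> \<bar>v - u\<bar> < \<rho>' \<Longrightarrow> \<bar>v' - u\<bar> < \<rho>' \<Longrightarrow> v < v' \<Longrightarrow>
        \<bar>p s v' - p s v - q * (v' - v)\<bar> \<le> e / 2 * (v' - v)" unfolding q_eq by metis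
    show "eventually (\<lambda>n. dist ((LINT w|M. den n (W w)) / (\<Delta>1 n * \<Delta>2 n)) q < e) sequentially"
      using order_tendstoD(2)[OF assms(27) \<rho>'] order_tendstoD(2)[OF assms(28) \<rho>'] eventually_ge_at_top[of n0]
    proof eventually_elim
      fix n assume n: "\<Delta>1 n < \<rho>'" "\<Delta>2 n < \<rho>'" "n0 \<le> n"
      interpret C: observed_cell M Z R \<mu> "a1 n" "b1 n" "a2 n" "b2 n" j k by (rule oc[OF n(3)])
      have EW: "den n (W w) = C.expo w" for w by (simp add: den_def W_def C.expo_def)
      have ns: "\<bar>s - t\<bar> < \<rho>'" if "s \<in> {a1 n..<b1 n}" for s using that ab[of n] n by auto
      have nv: "\<bar>a2 n - u\<bar> < \<rho>'" "\<bar>b2 n - u\<bar> < \<rho>'" using ab[of n] n by auto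
      have inc: "\<bar>p s (b2 n) - p s (a2 n) - q * \<Delta>2 n\<bar> \<le> e / 2 * \<Delta>2 n" if "s \<in> {a1 n..<b1 n}" for s
        using incr[OF ns[OF that] nv] ab[of n] by simp
      have ct: "isCont (\<lambda>(s, v). p s v) (s, v)" if "s \<in> {a1 n..<b1 n}" "v \<in> {a2 n, b2 n}" for s v
        using cont[OF ns[OF that(1)], of v] nv that(2) by auto
      have lo: "(q - e / 2) * \<Delta>2 n \<le> p s (b2 n) - p s (a2 n)" if "s \<in> {a1 n..<b1 n}" for s
        using inc[OF that] unfolding left_diff_distrib by linarith
      have hi: "p s (b2 n) - p s (a2 n) \<le> (q + e / 2) * \<Delta>2 n" if "s \<in> {a1 n..<b1 n}" for s
        using inc[OF that] unfolding distrib_right by linarith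
      note bnd = C.expected_exposure_bounds[of "(q - e / 2) * \<Delta>2 n" "(q + e / 2) * \<Delta>2 n",
          folded p_def, OF ct lo hi, folded ab(5)]
      have "q - e / 2 \<le> (LINT w|M. den n (W w)) / (\<Delta>1 n * \<Delta>2 n)"
        using bnd(1) \<Delta>[of n] unfolding EW by (simp add: le_divide_eq mult_ac)
      moreover have "(LINT w|M. den n (W w)) / (\<Delta>1 n * \<Delta>2 n) \<le> q + e / 2"
        using bnd(2) \<Delta>[of n] unfolding EW by (simp add: divide_le_eq mult_ac)
      ultimately show "dist ((LINT w|M. den n (W w)) / (\<Delta>1 n * \<Delta>2 n)) q < e"
        using \<open>0 < e\<close> by (simp add: dist_real_def abs_less_iff)
    qed
  qed
  define s where "s n = sqrt (real n * (\<Delta>1 n * \<Delta>2 n))" for n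
  have s_top: "filterlim s at_top sequentially"
    using filterlim_compose[OF sqrt_at_top assms(29)] by (simp add: s_def[abs_def] mult.assoc)
  have s0: "0 \<le> s n" for n using \<Delta>[of n] by (simp add: s_def)
  \<comment> \<open>the bias condition: the squares of both summands tend to zero by assumption\<close>
  have s\<Delta>: "(\<lambda>n. s n * (\<Delta>1 n + \<Delta>2 n)) \<longlonglongrightarrow> 0"
  proof -
    have "s n * \<Delta>1 n = sqrt (real n * \<Delta>1 n ^ 3 * \<Delta>2 n)" "s n * \<Delta>2 n = sqrt (real n * \<Delta>1 n * \<Delta>2 n ^ 3)" for n
    proof -
      have root: "sqrt a * b = sqrt (a * b\<^sup>2)" if "0 < b" for a b :: real
        using that by (simp add: real_sqrt_mult)
      show "s n * \<Delta>1 n = sqrt (real n * \<Delta>1 n ^ 3 * \<Delta>2 n)"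
        unfolding s_def root[OF \<Delta>(1)] by (simp add: power2_eq_square power3_eq_cube mult_ac)
      show "s n * \<Delta>2 n = sqrt (real n * \<Delta>1 n * \<Delta>2 n ^ 3)"
        unfolding s_def root[OF \<Delta>(2)] by (simp add: power2_eq_square power3_eq_cube mult_ac)
    qed
    moreover have "(\<lambda>n. sqrt (real n * \<Delta>1 n ^ 3 * \<Delta>2 n) + sqrt (real n * \<Delta>1 n * \<Delta>2 n ^ 3)) \<longlonglongrightarrow> sqrt 0 + sqrt 0"
      by (intro tendsto_intros assms(30,31))
    ultimately show ?thesis by (simp add: distrib_left)
  qed
  have bias0: "(\<lambda>n. s n * (((LINT w|M. num n (W w)) - c * (LINT w|M. den n (W w))) / (\<Delta>1 n * \<Delta>2 n))) \<longlonglongrightarrow> 0"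
  proof (rule Lim_null_comparison)
    show "eventually (\<lambda>n. norm (s n * (((LINT w|M. num n (W w)) - c * (LINT w|M. den n (W w))) / (\<Delta>1 n * \<Delta>2 n)))
      \<le> K * (s n * (\<Delta>1 n + \<Delta>2 n)) * ((LINT w|M. den n (W w)) / (\<Delta>1 n * \<Delta>2 n))) sequentially"
      using eventually_ge_at_top[of n0]
    proof eventually_elim
      fix n assume n: "n0 \<le> n"
      have "norm (s n * (((LINT w|M. num n (W w)) - c * (LINT w|M. den n (W w))) / (\<Delta>1 n * \<Delta>2 n))) =
          s n * (\<bar>(LINT w|M. num n (W w)) - c * (LINT w|M. den n (W w))\<bar> / (\<Delta>1 n * \<Delta>2 n))"
        using s0[of n] \<Delta>[of n] by (simp add: abs_mult)
      also have "\<dots> \<le> s n * (K * (\<Delta>1 n + \<Delta>2 n) * (LINT w|M. den n (W w)) / (\<Delta>1 n * \<Delta>2 n))"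
        using s0[of n] \<Delta>[of n] by (intro mult_left_mono divide_right_mono bias n) auto
      finally show "norm (s n * (((LINT w|M. num n (W w)) - c * (LINT w|M. den n (W w))) / (\<Delta>1 n * \<Delta>2 n)))
        \<le> K * (s n * (\<Delta>1 n + \<Delta>2 n)) * ((LINT w|M. den n (W w)) / (\<Delta>1 n * \<Delta>2 n))"
        by (simp add: mult_ac)
    qed
    have "(\<lambda>n. K * (s n * (\<Delta>1 n + \<Delta>2 n)) * ((LINT w|M. den n (W w)) / (\<Delta>1 n * \<Delta>2 n))) \<longlonglongrightarrow> K * 0 * q"
      by (intro tendsto_intros s\<Delta> mean_e)
    then show "(\<lambda>n. K * (s n * (\<Delta>1 n + \<Delta>2 n)) * ((LINT w|M. den n (W w)) / (\<Delta>1 n * \<Delta>2 n))) \<longlonglongrightarrow> 0" by simp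
  qed
  have iid: "\<And>i w. 1 \<le> i \<Longrightarrow> w \<in> space P \<Longrightarrow> jump_path (\<lambda>r. Zs i r w)"
    "prob_space.indep_vars P (\<lambda>_. ?S) Y {1..}" "\<And>i. 1 \<le> i \<Longrightarrow> distr P ?S (Y i) = distr M ?S W"
    using assms(10) unfolding iid_copies_def Y_def[abs_def] W_def[abs_def] by auto
  interpret P: prob_space P by (rule assms(9))
  have YmP: "Y i \<in> measurable P ?S" if "1 \<le> i" for i
    using iid(2) that unfolding P.indep_vars_def by auto
  define dev where "dev n w = s n * ((\<Sum>i=1..n. num n (Y i w)) / (\<Sum>i=1..n. den n (Y i w)) - c)" for n w
  have rate: "sqrt (real n * \<Delta>1 n * \<Delta>2 n) *
       (oe_rate Zs Rs j k n (\<tau> n) (\<upsilon> n) (m1 n) (m2 n) w - \<mu> j k t u) = dev n w"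
    if n: "n0 \<le> n" and w: "w \<in> space P" for n w
  proof -
    interpret C: observed_cell M Z R \<mu> "a1 n" "b1 n" "a2 n" "b2 n" j k by (rule oc[OF n])
    have "occurrence Zs Rs j k n (\<tau> n) (\<upsilon> n) (m1 n) (m2 n) w = (\<Sum>i=1..n. num n (Y i w))"
      unfolding occurrence_def num_def Y_def random_path_def
      using C.occurrence_eq_fun[OF iid(1)[OF _ w]]
      by (intro sum.cong) (auto simp: a1_def b1_def a2_def b2_def)
    moreover have "exposure Zs Rs j n (\<tau> n) (\<upsilon> n) (m1 n) (m2 n) w = (\<Sum>i=1..n. den n (Y i w))"
      unfolding exposure_def den_def Y_def random_path_def
      using C.exposure_eq_fun[OF iid(1)[OF _ w]]
      by (intro sum.cong) (auto simp: a1_def b1_def a2_def b2_def)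
    ultimately show ?thesis by (simp add: oe_rate_def dev_def s_def c_def mult.assoc)
  qed
  have eP: "0 \<le> den n (Y i w)" if "n0 \<le> n" "1 \<le> i" "w \<in> space P" for n i w
  proof -
    interpret C: observed_cell M Z R \<mu> "a1 n" "b1 n" "a2 n" "b2 n" j k by (rule oc[OF that(1)])
    show ?thesis using C.exposure_fun_nonneg[OF iid(1)[OF that(2,3)], of "Rs i w"]
      by (simp add: den_def Y_def random_path_def)
  qed
  \<comment> \<open>the cells are small enough only from \<open>n0\<close> on, so all sequences are shifted\<close>
  have main: "(\<lambda>n. measure P {w \<in> space P. dev (n + n0) w \<le> x}) \<longlonglongrightarrow> cdf std_normal_distribution (x * sqrt (q / c))" for x
    unfolding dev_def
  proof (rule ratio_clt[OF assms(9,1) iid(2,3) Wm, where d = "\<lambda>n. \<Delta>1 (n + n0)" and r = "\<lambda>n. \<Delta>1 (n + n0) * \<Delta>2 (n + n0)"])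
    show "filterlim (\<lambda>n. n + n0) at_top sequentially" by (rule filterlim_add_const_nat_at_top)
    show "filterlim (\<lambda>n. s (n + n0)) at_top sequentially"
      by (rule filterlim_compose[OF s_top filterlim_add_const_nat_at_top])
    show "s (n + n0) = sqrt (real (n + n0) * (\<Delta>1 (n + n0) * \<Delta>2 (n + n0)))" for n by (simp add: s_def)
    show "(\<lambda>n. \<Delta>1 (n + n0)) \<longlonglongrightarrow> 0" by (rule LIMSEQ_ignore_initial_segment[OF assms(27)])
    show "(\<lambda>n. (LINT w|M. den (n + n0) (W w)) / (\<Delta>1 (n + n0) * \<Delta>2 (n + n0))) \<longlonglongrightarrow> q"
      by (rule LIMSEQ_ignore_initial_segment[OF mean_e])
    show "(\<lambda>n. s (n + n0) * (((LINT w|M. num (n + n0) (W w)) - c * (LINT w|M. den (n + n0) (W w))) /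
        (\<Delta>1 (n + n0) * \<Delta>2 (n + n0)))) \<longlonglongrightarrow> 0"
      by (rule LIMSEQ_ignore_initial_segment[OF bias0])
    show "num (n + n0) (W w) \<in> {0, 1}" if "w \<in> space M" for n w
      using o01[of "n + n0" w] that by simp
  qed (auto intro!: Om Em e0 ed eP mult_pos_pos \<Delta> q c)
  have dev_measurable: "dev n \<in> borel_measurable P" if "n0 \<le> n" for n
  proof -
    have "(\<lambda>w. \<Sum>i=1..n. num n (Y i w)) \<in> borel_measurable P" "(\<lambda>w. \<Sum>i=1..n. den n (Y i w)) \<in> borel_measurable P"
      by (intro borel_measurable_sum measurable_compose[OF YmP Om] measurable_compose[OF YmP Em] that; simp)+
    then show ?thesis unfolding dev_def by measurable
  qed
  have scale: "x / sqrt (c / q) = x * sqrt (q / c)" for x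
    by (simp add: real_sqrt_divide)
  show ?thesis
    unfolding weak_conv_m_def weak_conv_def
  proof (intro allI impI)
    fix x
    let ?T = "\<lambda>n w. sqrt (real n * \<Delta>1 n * \<Delta>2 n) *
       (oe_rate Zs Rs j k n (\<tau> n) (\<upsilon> n) (m1 n) (m2 n) w - \<mu> j k t u)"
    have cdf_T: "cdf (distr P borel (?T n)) x = measure P {w \<in> space P. dev n w \<le> x}" if n: "n0 \<le> n" for n
    proof -
      have "distr P borel (?T n) = distr P borel (dev n)"
        by (rule distr_cong) (use rate[OF n] in auto)
      then have "cdf (distr P borel (?T n)) x = measure P (dev n -` {..x} \<inter> space P)"
        unfolding cdf_def using dev_measurable[OF n] by (simp add: measure_distr)
      also have "dev n -` {..x} \<inter> space P = {w \<in> space P. dev n w \<le> x}" by auto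
      finally show ?thesis .
    qed
    have "(\<lambda>n. cdf (distr P borel (?T (n + n0))) x) \<longlonglongrightarrow> cdf std_normal_distribution (x * sqrt (q / c))"
      using main[of x] by (simp only: cdf_T[OF le_add2])
    then have "(\<lambda>n. cdf (distr P borel (?T n)) x) \<longlonglongrightarrow> cdf std_normal_distribution (x * sqrt (q / c))"
      by (rule LIMSEQ_offset)
    moreover have "cdf (density lborel (normal_density 0 (sqrt (c / q)))) x = cdf std_normal_distribution (x * sqrt (q / c))"
      using c q by (subst cdf_normal_density) (auto simp: scale)
    ultimately show "(\<lambda>n. cdf (distr P borel (?T n)) x) \<longlonglongrightarrow>
        cdf (density lborel (normal_density 0 (sqrt (\<mu> j k t u / deriv (\<lambda>v. censored_prob M Z R j t v) u)))) x"
      by (simp add: c_def q_def)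
  qed
qed

end
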